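(* Let $P$ be a finitely generated symmetric or shuffle operad over a field of characteristic zero with a finite shuffle regular Gröbner basis. Suppose that the growth of the sequence of dimensions $\dim P(n)$ is subfactorial. Then the exponential generating series $E_P(z)=\sum_{n\ge1}\frac{\dim P(n)}{n!}z^n$ satisfies a (non-trivial) linear differential equation with constant coefficients. Equivalently, the ordinary generating series $G_P(z)=\sum_{n\ge1}\dim P(n)z^n$ is rational. In particular, the sequence $\dim P(n)$ has either exponential growth ($1<\limsup_n(\dim P(n))^{1/n}<\infty$) or polynomial growth with integer exponent (either $\dim P(n)=0$ for all large $n$, or $0<\limsup_n\dim P(n)/n^d<\infty$ for some integer $d\ge0$).
   Context: A sequence $\{a_n\}_{n\ge0}$ of nonnegative real numbers has subfactorial growth if for all constants $A,B>0$ there exists a constant $C>0$ such that $a_n<C\left(\frac nA\right)^{n/B}$ for all sufficiently large $n$. Let $\Upsilon=\bigsqcup_{n\ge1}\Upsilon_n$ be a finite set of operations ($\Upsilon_n$ the $n$-ary ones). A shuffle monomial of arity $n$ is a planar rooted tree with $n$ leaves, each vertex having at least one input, each vertex with $k$ inputs labeled by an element of $\Upsilon_k$, and the leaves labeled bijectively by $1,\dots,n$ such that at every vertex the minimal leaf labels reachable through its inputs increase from left to right. Shuffle monomials form a basis of the free shuffle operad $\mathcal F(\Upsilon)$; shuffle compositions are graftings with any relabeling of leaves that keeps the relative order of the leaves of the grafted tree and of the leaves of the lower tree (the grafted tree being represented by its minimal leaf) and yields a shuffle monomial. A connected subtree $u$ of $v$ becomes a shuffle tree by assigning to each input of $u$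 the minimum of the leaves of $v$ reached through it; $v$ is divisible by $w$ if some such $u$ is isomorphic to $w$ as a labeled tree by an isomorphism preserving the order of the leaves. A shuffle operad is presented as a quotient $\mathcal F(\Upsilon)/C$ by an ideal $C$ (with respect to shuffle compositions); a symmetric operad is considered as a shuffle operad (forgetting the symmetric group actions), $\Upsilon$ being then a linear basis of the generating symmetric collection. An admissible order is a total well-order on the shuffle monomials of each arity compatible with shuffle compositions; a Gröbner basis of $C$ is a subset $G\subset C$ such that the leading (largest) monomial of every nonzero element of $C$ is divisible by the leading monomial of some element of $G$; it is reduced if leading coefficients are $1$ and no monomial occurring in an element of $G$ is divisible by the leading monomial of another element of $G$. The planar skeleton of a shuffle monomial is obtained by erasing the leaf labels; a set $M$ of shuffle monomials is shuffle regular if with each $m\in M$ it contains all shuffle monomials with the same planar skeleton. A finite shuffle regular Gröbner basis is a finite reduced Gröbner basis (for some admissible order) whose set of leading monomials is shuffle regular. *)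

theory Defs
  imports
    "HOL-Library.Poly_Mapping"
    "HOL-Library.Extended_Real"
    "HOL-Library.Liminf_Limsup"
    "HOL-Combinatorics.Permutations"
    "HOL-Computational_Algebra.Computational_Algebra"
begin

section \<open>Symmetric and shuffle operads\<close>

text \<open>
  Collections are written in coordinate-free form: the component \<open>component P S\<close> is attached to every
  finite nonempty set \<open>S\<close> of labels (natural numbers), and relabelings of \<open>S\<close> act by transport. The
  component of arity \<open>n\<close> is \<open>component P {1..n}\<close>. For a symmetric collection all bijections act, so
  that the permutations of \<open>{1..n}\<close> give the action of the symmetric group; for a shuffle
  (nonsymmetric) collection only the order-preserving bijections act, which merely identifies
  \<open>component P S\<close> with \<open>component P {1..card S}\<close>. All components are subspaces of one ambient vector space.

  The element \<open>circ P S s T a b\<close> is the partial composition of \<open>a\<close>, with inputs \<open>S\<close>, and \<open>b\<close>,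
  with inputs \<open>T\<close>, at the input \<open>s\<close> of \<open>a\<close>; its inputs are \<open>S - {s} \<union> T\<close>.
\<close>

record 'p operad_data =
  component :: "nat set \<Rightarrow> 'p set"
  relab :: "nat set \<Rightarrow> (nat \<Rightarrow> nat) \<Rightarrow> 'p \<Rightarrow> 'p"
  circ :: "nat set \<Rightarrow> nat \<Rightarrow> nat set \<Rightarrow> 'p \<Rightarrow> 'p \<Rightarrow> 'p"
  unit_elem :: "nat \<Rightarrow> 'p"

definition label_set :: "nat set \<Rightarrow> bool" where
  "label_set S \<longleftrightarrow> finite S \<and> S \<noteq> {}"

text \<open>
  The axioms are stated relative to a class of admissible relabelings \<open>rel S h\<close> and a class of
  admissible partial compositions \<open>ok S s T\<close>.
\<close>

locale operad_over = vector_space scale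
  for scale :: "'k::field \<Rightarrow> 'p::ab_group_add \<Rightarrow> 'p" +
  fixes rel :: "nat set \<Rightarrow> (nat \<Rightarrow> nat) \<Rightarrow> bool"
    and ok :: "nat set \<Rightarrow> nat \<Rightarrow> nat set \<Rightarrow> bool"
    and P :: "'p operad_data"
  assumes comp_subspace: "label_set S \<Longrightarrow> subspace (component P S)"
    and relab_closed:
      "\<lbrakk>label_set S; rel S h; a \<in> component P S\<rbrakk> \<Longrightarrow> relab P S h a \<in> component P (h ` S)"
    and relab_add:
      "\<lbrakk>label_set S; rel S h; a \<in> component P S; a' \<in> component P S\<rbrakk>
        \<Longrightarrow> relab P S h (a + a') = relab P S h a + relab P S h a'"
    and relab_scale:
      "\<lbrakk>label_set S; rel S h; a \<in> component P S\<rbrakk>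
        \<Longrightarrow> relab P S h (scale k a) = scale k (relab P S h a)"
    and relab_cong:
      "\<lbrakk>label_set S; rel S h; rel S h'; \<And>x. x \<in> S \<Longrightarrow> h x = h' x; a \<in> component P S\<rbrakk>
        \<Longrightarrow> relab P S h a = relab P S h' a"
    and relab_id: "\<lbrakk>label_set S; rel S id; a \<in> component P S\<rbrakk> \<Longrightarrow> relab P S id a = a"
    and relab_comp:
      "\<lbrakk>label_set S; rel S h; rel (h ` S) h'; rel S (h' \<circ> h); a \<in> component P S\<rbrakk>
        \<Longrightarrow> relab P (h ` S) h' (relab P S h a) = relab P S (h' \<circ> h) a"
    and circ_closed:
      "\<lbrakk>label_set S; label_set T; ok S s T; a \<in> component P S; b \<in> component P T\<rbrakk>
        \<Longrightarrow> circ P S s T a b \<in> component P (S - {s} \<union> T)"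
    and circ_add_left:
      "\<lbrakk>label_set S; label_set T; ok S s T; a \<in> component P S; a' \<in> component P S; b \<in> component P T\<rbrakk>
        \<Longrightarrow> circ P S s T (a + a') b = circ P S s T a b + circ P S s T a' b"
    and circ_add_right:
      "\<lbrakk>label_set S; label_set T; ok S s T; a \<in> component P S; b \<in> component P T; b' \<in> component P T\<rbrakk>
        \<Longrightarrow> circ P S s T a (b + b') = circ P S s T a b + circ P S s T a b'"
    and circ_scale_left:
      "\<lbrakk>label_set S; label_set T; ok S s T; a \<in> component P S; b \<in> component P T\<rbrakk>
        \<Longrightarrow> circ P S s T (scale k a) b = scale k (circ P S s T a b)"
    and circ_scale_right:
      "\<lbrakk>label_set S; label_set T; ok S s T; a \<in> component P S; b \<in> component P T\<rbrakk>
        \<Longrightarrow> circ P S s T a (scale k b) = scale k (circ P S s T a b)"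
    and equivariance:
      "\<lbrakk>label_set S; label_set T; ok S s T; a \<in> component P S; b \<in> component P T;
        rel S h; rel T h'; ok (h ` S) (h s) (h' ` T); rel (S - {s} \<union> T) r;
        \<And>x. x \<in> S - {s} \<Longrightarrow> r x = h x; \<And>x. x \<in> T \<Longrightarrow> r x = h' x\<rbrakk>
        \<Longrightarrow> relab P (S - {s} \<union> T) r (circ P S s T a b)
            = circ P (h ` S) (h s) (h' ` T) (relab P S h a) (relab P T h' b)"
    and unit_closed: "unit_elem P s \<in> component P {s}"
    and relab_unit: "rel {s} h \<Longrightarrow> relab P {s} h (unit_elem P s) = unit_elem P (h s)"
    and unit_left:
      "\<lbrakk>label_set T; ok {s} s T; b \<in> component P T\<rbrakk> \<Longrightarrow> circ P {s} s T (unit_elem P s) b = b"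
    and unit_right:
      "\<lbrakk>label_set S; ok S s {s}; a \<in> component P S\<rbrakk> \<Longrightarrow> circ P S s {s} a (unit_elem P s) = a"
    and assoc_sequential:
      "\<lbrakk>label_set S; label_set T; label_set U; a \<in> component P S; b \<in> component P T; c \<in> component P U;
        t \<in> T; ok S s T; ok (S - {s} \<union> T) t U; ok T t U; ok S s (T - {t} \<union> U)\<rbrakk>
        \<Longrightarrow> circ P (S - {s} \<union> T) t U (circ P S s T a b) c
            = circ P S s (T - {t} \<union> U) a (circ P T t U b c)"
    and assoc_parallel:
      "\<lbrakk>label_set S; label_set T; label_set U; a \<in> component P S; b \<in> component P T; c \<in> component P U;
        s \<in> S; u \<in> S; s \<noteq> u; ok S s T; ok (S - {s} \<union> T) u U; ok S u U; ok (S - {u} \<union> U) s T\<rbrakk>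
        \<Longrightarrow> circ P (S - {s} \<union> T) u U (circ P S s T a b) c
            = circ P (S - {u} \<union> U) s T (circ P S u U a c) b"

definition graftable :: "nat set \<Rightarrow> nat \<Rightarrow> nat set \<Rightarrow> bool" where
  "graftable S s T \<longleftrightarrow> s \<in> S \<and> (S - {s}) \<inter> T = {}"

text \<open>
  In a shuffle composition the grafted element takes the place of the input of the lower element
  whose label is the minimal label of the grafted one.
\<close>

definition shuffle_graftable :: "nat set \<Rightarrow> nat \<Rightarrow> nat set \<Rightarrow> bool" where
  "shuffle_graftable S s T \<longleftrightarrow> S \<inter> T = {s} \<and> s = Min T"

definition symmetric_operad ::
    "('k::field \<Rightarrow> 'p::ab_group_add \<Rightarrow> 'p) \<Rightarrow> 'p operad_data \<Rightarrow> bool" where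
  "symmetric_operad scale P \<longleftrightarrow> operad_over scale (\<lambda>S h. inj_on h S) graftable P"

definition shuffle_operad ::
    "('k::field \<Rightarrow> 'p::ab_group_add \<Rightarrow> 'p) \<Rightarrow> 'p operad_data \<Rightarrow> bool" where
  "shuffle_operad scale P \<longleftrightarrow> operad_over scale (\<lambda>S h. strict_mono_on S h) shuffle_graftable P"

text \<open>Forgetting the symmetric group actions turns a symmetric operad into a shuffle operad.\<close>

lemma symmetric_operad_imp_shuffle_operad:
  assumes "symmetric_operad scale P"
  shows "shuffle_operad scale P"
proof -
  interpret operad_over scale "\<lambda>S h. inj_on h S" graftable P
    using assms by (simp add: symmetric_operad_def)
  have r: "inj_on h S" if "strict_mono_on S h" for h :: "nat \<Rightarrow> nat" and S
    using that by (rule strict_mono_on_imp_inj_on)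
  have g: "graftable S s T" if "shuffle_graftable S s T" for S s T
    using that by (auto simp: graftable_def shuffle_graftable_def)
  show ?thesis
    unfolding shuffle_operad_def
    apply (intro operad_over.intro operad_over_axioms.intro)
    apply (rule vector_space_axioms)
    apply (erule comp_subspace)
    apply (blast intro: relab_closed r)
    apply (blast intro: relab_add r)
    apply (blast intro: relab_scale r)
    apply (blast intro: relab_cong r)
    apply (blast intro: relab_id r)
    apply (blast intro: relab_comp r)
    apply (blast intro: circ_closed g)
    apply (blast intro: circ_add_left g)
    apply (blast intro: circ_add_right g)
    apply (blast intro: circ_scale_left g)
    apply (blast intro: circ_scale_right g)
    apply (rule equivariance; blast intro: r g)
    apply (rule unit_closed)
    apply (blast intro: relab_unit r)
    apply (blast intro: unit_left g)
    apply (blast intro: unit_right g)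
    apply (rule assoc_sequential; blast intro: g)
    apply (rule assoc_parallel; blast intro: g)
    done
qed

definition shuffle_operad_hom ::
    "('k \<Rightarrow> 'p::ab_group_add \<Rightarrow> 'p) \<Rightarrow> 'p operad_data
      \<Rightarrow> ('k \<Rightarrow> 'q::ab_group_add \<Rightarrow> 'q) \<Rightarrow> 'q operad_data \<Rightarrow> (nat set \<Rightarrow> 'p \<Rightarrow> 'q) \<Rightarrow> bool" where
  "shuffle_operad_hom scale P scale' Q \<phi> \<longleftrightarrow>
    (\<forall>S. label_set S \<longrightarrow>
      (\<forall>a\<in>component P S. \<phi> S a \<in> component Q S) \<and>
      (\<forall>a\<in>component P S. \<forall>a'\<in>component P S. \<phi> S (a + a') = \<phi> S a + \<phi> S a') \<and>
      (\<forall>k. \<forall>a\<in>component P S. \<phi> S (scale k a) = scale' k (\<phi> S a)) \<and>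
      (\<forall>h. \<forall>a\<in>component P S. strict_mono_on S h \<longrightarrow>
        \<phi> (h ` S) (relab P S h a) = relab Q S h (\<phi> S a))) \<and>
    (\<forall>S s T. label_set S \<longrightarrow> label_set T \<longrightarrow> shuffle_graftable S s T \<longrightarrow>
      (\<forall>a\<in>component P S. \<forall>b\<in>component P T.
        \<phi> (S - {s} \<union> T) (circ P S s T a b) = circ Q S s T (\<phi> S a) (\<phi> T b))) \<and>
    (\<forall>s. \<phi> {s} (unit_elem P s) = unit_elem Q s)"


section \<open>Shuffle monomials and free shuffle operads\<close>

datatype ('u, leaves: 'l) ptree = Leaf 'l | Node 'u "('u, 'l) ptree list"

text \<open>
  \<open>map_ptree id h\<close> relabels the leaves along \<open>h\<close>, and \<open>leaves t\<close> is the set of leaf labels.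
\<close>

fun leaf_list :: "('u, 'l) ptree \<Rightarrow> 'l list" where
  "leaf_list (Leaf l) = [l]"
| "leaf_list (Node u ts) = concat (map leaf_list ts)"

definition min_leaf :: "('u, nat) ptree \<Rightarrow> nat" where
  "min_leaf t = Min (leaves t)"

fun shuffle_tree :: "'u set \<Rightarrow> ('u \<Rightarrow> nat) \<Rightarrow> ('u, nat) ptree \<Rightarrow> bool" where
  "shuffle_tree \<Upsilon> ar (Leaf l) \<longleftrightarrow> True"
| "shuffle_tree \<Upsilon> ar (Node u ts) \<longleftrightarrow>
    u \<in> \<Upsilon> \<and> length ts = ar u \<and> sorted_wrt (<) (map min_leaf ts) \<and>
    (\<forall>t\<in>set ts. shuffle_tree \<Upsilon> ar t)"

text \<open>
  The shuffle monomials whose leaves are labeled bijectively by \<open>S\<close>; those of arity \<open>n\<close> are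
  obtained for \<open>S = {1..n}\<close>. The tree \<open>Leaf s\<close> without vertices is the unit.
\<close>

definition shuffle_monomials :: "'u set \<Rightarrow> ('u \<Rightarrow> nat) \<Rightarrow> nat set \<Rightarrow> ('u, nat) ptree set" where
  "shuffle_monomials \<Upsilon> ar S =
    {t. shuffle_tree \<Upsilon> ar t \<and> distinct (leaf_list t) \<and> leaves t = S}"

fun graft :: "('u, nat) ptree \<Rightarrow> nat \<Rightarrow> ('u, nat) ptree \<Rightarrow> ('u, nat) ptree" where
  "graft (Leaf l) s b = (if l = s then b else Leaf l)"
| "graft (Node u ts) s b = Node u (map (\<lambda>t. graft t s b) ts)"

definition pm_scale :: "'k::field \<Rightarrow> ('a \<Rightarrow>\<^sub>0 'k) \<Rightarrow> 'a \<Rightarrow>\<^sub>0 'k" where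
  "pm_scale c x = Poly_Mapping.map ((*) c) x"

text \<open>
  Every shuffle composition of two monomials (grafting followed by an admissible relabeling of the
  leaves) is a \<open>graft\<close> of order-preserving relabelings of them, with labels chosen as in
  \<open>shuffle_graftable\<close>.
\<close>

definition free_shuffle_operad ::
    "'u set \<Rightarrow> ('u \<Rightarrow> nat) \<Rightarrow> (('u, nat) ptree \<Rightarrow>\<^sub>0 'k::field) operad_data" where
  "free_shuffle_operad \<Upsilon> ar =
    \<lparr>component = (\<lambda>S. {x. Poly_Mapping.keys x \<subseteq> shuffle_monomials \<Upsilon> ar S}),
     relab = (\<lambda>S h x. \<Sum>t\<in>Poly_Mapping.keys x.
       Poly_Mapping.single (map_ptree id h t) (Poly_Mapping.lookup x t)),
     circ = (\<lambda>S s T x y. \<Sum>a\<in>Poly_Mapping.keys x. \<Sum>b\<in>Poly_Mapping.keys y.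
       Poly_Mapping.single (graft a s b) (Poly_Mapping.lookup x a * Poly_Mapping.lookup y b)),
     unit_elem = (\<lambda>s. Poly_Mapping.single (Leaf s) 1)\<rparr>"


section \<open>Presentations\<close>

text \<open>
  \<open>P\<close> is presented as the quotient of the free shuffle operad by the ideal \<open>C\<close>, the kernel of the
  surjective morphism \<open>\<pi>\<close>.
\<close>

definition shuffle_presentation ::
    "('k::field \<Rightarrow> 'p::ab_group_add \<Rightarrow> 'p) \<Rightarrow> 'p operad_data \<Rightarrow> 'u set \<Rightarrow> ('u \<Rightarrow> nat)
      \<Rightarrow> (nat set \<Rightarrow> (('u, nat) ptree \<Rightarrow>\<^sub>0 'k) \<Rightarrow> 'p)
      \<Rightarrow> (nat set \<Rightarrow> (('u, nat) ptree \<Rightarrow>\<^sub>0 'k) set) \<Rightarrow> bool" where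
  "shuffle_presentation scale P \<Upsilon> ar \<pi> C \<longleftrightarrow>
    (\<forall>u\<in>\<Upsilon>. 1 \<le> ar u) \<and>
    shuffle_operad_hom pm_scale (free_shuffle_operad \<Upsilon> ar) scale P \<pi> \<and>
    (\<forall>S. label_set S \<longrightarrow> \<pi> S ` component (free_shuffle_operad \<Upsilon> ar) S = component P S) \<and>
    (\<forall>S. C S = {x \<in> component (free_shuffle_operad \<Upsilon> ar) S. \<pi> S x = 0})"

definition corolla :: "('u \<Rightarrow> nat) \<Rightarrow> 'u \<Rightarrow> ('u, nat) ptree" where
  "corolla ar u = Node u (map Leaf [1..<Suc (ar u)])"

definition generator_space :: "'u set \<Rightarrow> ('u \<Rightarrow> nat) \<Rightarrow> nat \<Rightarrow> (('u, nat) ptree \<Rightarrow>\<^sub>0 'k::field) set" where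
  "generator_space \<Upsilon> ar n = {x. Poly_Mapping.keys x \<subseteq> corolla ar ` {u \<in> \<Upsilon>. ar u = n}}"

text \<open>
  For a symmetric operad, \<open>\<Upsilon>\<close> is a linear basis of the generating symmetric collection: the symmetric
  groups act linearly on the spans of the generators, and the generators map equivariantly to \<open>P\<close>.
\<close>

definition symmetric_presentation ::
    "('k::field \<Rightarrow> 'p::ab_group_add \<Rightarrow> 'p) \<Rightarrow> 'p operad_data \<Rightarrow> 'u set \<Rightarrow> ('u \<Rightarrow> nat)
      \<Rightarrow> (nat set \<Rightarrow> (('u, nat) ptree \<Rightarrow>\<^sub>0 'k) \<Rightarrow> 'p)
      \<Rightarrow> (nat set \<Rightarrow> (('u, nat) ptree \<Rightarrow>\<^sub>0 'k) set) \<Rightarrow> bool" where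
  "symmetric_presentation scale P \<Upsilon> ar \<pi> C \<longleftrightarrow>
    shuffle_presentation scale P \<Upsilon> ar \<pi> C \<and>
    (\<exists>act :: nat \<Rightarrow> (nat \<Rightarrow> nat) \<Rightarrow> (('u, nat) ptree \<Rightarrow>\<^sub>0 'k) \<Rightarrow> (('u, nat) ptree \<Rightarrow>\<^sub>0 'k).
      \<forall>n\<ge>1. \<forall>x\<in>generator_space \<Upsilon> ar n.
        act n id x = x \<and>
        (\<forall>\<sigma>. \<sigma> permutes {1..n} \<longrightarrow>
          act n \<sigma> x \<in> generator_space \<Upsilon> ar n \<and>
          (\<forall>y\<in>generator_space \<Upsilon> ar n. act n \<sigma> (x + y) = act n \<sigma> x + act n \<sigma> y) \<and>
          (\<forall>k. act n \<sigma> (pm_scale k x) = pm_scale k (act n \<sigma> x)) \<and>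
          (\<forall>\<tau>. \<tau> permutes {1..n} \<longrightarrow> act n \<sigma> (act n \<tau> x) = act n (\<sigma> \<circ> \<tau>) x) \<and>
          \<pi> {1..n} (act n \<sigma> x) = relab P {1..n} \<sigma> (\<pi> {1..n} x)))"


section \<open>Groebner bases\<close>

inductive subterm :: "('u, 'l) ptree \<Rightarrow> ('u, 'l) ptree \<Rightarrow> bool" where
  "subterm t t"
| "subterm t v \<Longrightarrow> v \<in> set ts \<Longrightarrow> subterm t (Node u ts)"

text \<open>
  \<open>truncation t w\<close>: \<open>w\<close> arises from \<open>t\<close> by cutting off some subtrees and putting in place of each
  of them a leaf labeled by its minimal leaf. So the connected subtrees of \<open>v\<close>, as shuffle trees,
  are the truncations of the subterms of \<open>v\<close>.
\<close>

inductive truncation :: "('u, nat) ptree \<Rightarrow> ('u, nat) ptree \<Rightarrow> bool" where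
  "truncation t (Leaf (min_leaf t))"
| "list_all2 truncation ts ws \<Longrightarrow> truncation (Node u ts) (Node u ws)"

definition divides :: "('u, nat) ptree \<Rightarrow> ('u, nat) ptree \<Rightarrow> bool" where
  "divides w v \<longleftrightarrow>
    (\<exists>t u h. subterm t v \<and> truncation t u \<and> strict_mono_on (leaves u) h \<and> map_ptree id h u = w)"

definition admissible_order ::
    "'u set \<Rightarrow> ('u \<Rightarrow> nat) \<Rightarrow> ('u, nat) ptree rel \<Rightarrow> bool" where
  "admissible_order \<Upsilon> ar ord \<longleftrightarrow>
    (\<forall>S. label_set S \<longrightarrow>
      well_order_on (shuffle_monomials \<Upsilon> ar S) (Restr ord (shuffle_monomials \<Upsilon> ar S))) \<and>
    (\<forall>S h. label_set S \<longrightarrow> strict_mono_on S h \<longrightarrow>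
      (\<forall>a\<in>shuffle_monomials \<Upsilon> ar S. \<forall>a'\<in>shuffle_monomials \<Upsilon> ar S.
        (a, a') \<in> ord \<longrightarrow> (map_ptree id h a, map_ptree id h a') \<in> ord)) \<and>
    (\<forall>S s T. label_set S \<longrightarrow> label_set T \<longrightarrow> shuffle_graftable S s T \<longrightarrow>
      (\<forall>a\<in>shuffle_monomials \<Upsilon> ar S. \<forall>a'\<in>shuffle_monomials \<Upsilon> ar S.
        \<forall>b\<in>shuffle_monomials \<Upsilon> ar T.
          (a, a') \<in> ord \<longrightarrow> (graft a s b, graft a' s b) \<in> ord) \<and>
      (\<forall>a\<in>shuffle_monomials \<Upsilon> ar S. \<forall>b\<in>shuffle_monomials \<Upsilon> ar T.
        \<forall>b'\<in>shuffle_monomials \<Upsilon> ar T.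
          (b, b') \<in> ord \<longrightarrow> (graft a s b, graft a s b') \<in> ord))"

definition leading_monomial :: "'m rel \<Rightarrow> ('m \<Rightarrow>\<^sub>0 'k::zero) \<Rightarrow> 'm" where
  "leading_monomial ord x =
    (THE m. m \<in> Poly_Mapping.keys x \<and> (\<forall>m'\<in>Poly_Mapping.keys x. (m', m) \<in> ord))"

definition groebner_basis ::
    "('u, nat) ptree rel \<Rightarrow> (nat set \<Rightarrow> (('u, nat) ptree \<Rightarrow>\<^sub>0 'k::field) set)
      \<Rightarrow> (('u, nat) ptree \<Rightarrow>\<^sub>0 'k) set \<Rightarrow> bool" where
  "groebner_basis ord C G \<longleftrightarrow>
    G \<subseteq> (\<Union>n\<in>{1..}. C {1..n}) \<and>
    (\<forall>n\<ge>1. \<forall>x\<in>C {1..n}. x \<noteq> 0 \<longrightarrow>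
      (\<exists>g\<in>G. g \<noteq> 0 \<and> divides (leading_monomial ord g) (leading_monomial ord x)))"

definition reduced_groebner_basis ::
    "('u, nat) ptree rel \<Rightarrow> (nat set \<Rightarrow> (('u, nat) ptree \<Rightarrow>\<^sub>0 'k::field) set)
      \<Rightarrow> (('u, nat) ptree \<Rightarrow>\<^sub>0 'k) set \<Rightarrow> bool" where
  "reduced_groebner_basis ord C G \<longleftrightarrow>
    groebner_basis ord C G \<and>
    (\<forall>g\<in>G. g \<noteq> 0 \<and> Poly_Mapping.lookup g (leading_monomial ord g) = 1) \<and>
    (\<forall>g\<in>G. \<forall>g'\<in>G. g' \<noteq> g \<longrightarrow>
      (\<forall>m\<in>Poly_Mapping.keys g'. \<not> divides (leading_monomial ord g) m))"

definition skeleton :: "('u, 'l) ptree \<Rightarrow> ('u, unit) ptree" where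
  "skeleton = map_ptree id (\<lambda>_. ())"

definition shuffle_regular :: "'u set \<Rightarrow> ('u \<Rightarrow> nat) \<Rightarrow> ('u, nat) ptree set \<Rightarrow> bool" where
  "shuffle_regular \<Upsilon> ar M \<longleftrightarrow>
    (\<forall>m\<in>M. \<forall>n\<ge>1. \<forall>m'\<in>shuffle_monomials \<Upsilon> ar {1..n}. skeleton m' = skeleton m \<longrightarrow> m' \<in> M)"

definition has_finite_shuffle_regular_groebner_basis ::
    "'u set \<Rightarrow> ('u \<Rightarrow> nat) \<Rightarrow> (nat set \<Rightarrow> (('u, nat) ptree \<Rightarrow>\<^sub>0 'k::field) set) \<Rightarrow> bool" where
  "has_finite_shuffle_regular_groebner_basis \<Upsilon> ar C \<longleftrightarrow>
    (\<exists>ord G. admissible_order \<Upsilon> ar ord \<and> reduced_groebner_basis ord C G \<and> finite G \<and>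
      shuffle_regular \<Upsilon> ar (leading_monomial ord ` G))"


section \<open>Dimensions and growth\<close>

definition finite_dim :: "('k::field \<Rightarrow> 'p::ab_group_add \<Rightarrow> 'p) \<Rightarrow> 'p set \<Rightarrow> bool" where
  "finite_dim scale V \<longleftrightarrow> (\<exists>B. finite B \<and> V \<subseteq> module.span scale B)"

definition operad_dim ::
    "('k::field \<Rightarrow> 'p::ab_group_add \<Rightarrow> 'p) \<Rightarrow> 'p operad_data \<Rightarrow> nat \<Rightarrow> nat" where
  "operad_dim scale P n = vector_space.dim scale (component P {1..n})"

definition subfactorial_growth :: "(nat \<Rightarrow> real) \<Rightarrow> bool" where
  "subfactorial_growth a \<longleftrightarrow>
    (\<forall>A>0. \<forall>B>0. \<exists>C>0. \<forall>\<^sub>F n in sequentially. a n < C * (real n / A) powr (real n / B))"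

text \<open>
  The series \<open>E\<^sub>P\<close> and \<open>G\<^sub>P\<close> have rational coefficients, so they are taken over the rationals; there
  is no term of degree 0.
\<close>

definition egf :: "(nat \<Rightarrow> nat) \<Rightarrow> rat fps" where
  "egf d = Abs_fps (\<lambda>n. if n = 0 then 0 else of_nat (d n) / fact n)"

definition ogf :: "(nat \<Rightarrow> nat) \<Rightarrow> rat fps" where
  "ogf d = Abs_fps (\<lambda>n. if n = 0 then 0 else of_nat (d n))"

definition satisfies_linear_ode_const_coeffs :: "'a::field fps \<Rightarrow> bool" where
  "satisfies_linear_ode_const_coeffs f \<longleftrightarrow>
    (\<exists>p :: 'a poly. p \<noteq> 0 \<and>
      (\<Sum>i\<le>degree p. fps_const (coeff p i) * (fps_deriv ^^ i) f) = 0)"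

definition rational_fps :: "'a::field fps \<Rightarrow> bool" where
  "rational_fps f \<longleftrightarrow>
    (\<exists>p q :: 'a poly. q \<noteq> 0 \<and> fps_of_poly q * f = fps_of_poly p)"

definition exponential_growth :: "(nat \<Rightarrow> nat) \<Rightarrow> bool" where
  "exponential_growth d \<longleftrightarrow>
    1 < limsup (\<lambda>n. ereal (root n (real (d n)))) \<and>
    limsup (\<lambda>n. ereal (root n (real (d n)))) < \<infinity>"

definition polynomial_growth :: "(nat \<Rightarrow> nat) \<Rightarrow> bool" where
  "polynomial_growth d \<longleftrightarrow>
    (\<forall>\<^sub>F n in sequentially. d n = 0) \<or>
    (\<exists>e :: nat. 0 < limsup (\<lambda>n. ereal (real (d n) / real n ^ e)) \<and>
      limsup (\<lambda>n. ereal (real (d n) / real n ^ e)) < \<infinity>)"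

end

theory Submission
  imports Defs "HOL-Real_Asymp.Real_Asymp"
begin

text \<open>
  The dimension of \<open>P(n)\<close> is the number of shuffle monomials of arity \<open>n\<close> that are not divisible by a
  leading monomial of the Groebner basis. By shuffle regularity, divisibility depends on the planar
  skeleton only, so the dimensions count the shuffle labelings of the planar trees that avoid finitely
  many patterns. Recording which subpatterns match at the root sorts these trees into finitely many
  states, whose exponential generating series satisfy a system of equations of the form
  \<open>y\<^sub>q = \<Sum> \<integral> y\<^sub>1' \<integral> y\<^sub>2' \<dots> \<integral> y\<^sub>k'\<close>.

  If a state recurs below itself in a child that is not the last one, or beside a left sibling with
  more than one leaf, then iterating this context multiplies the number of labelings by the arity at
  every round, and the growth is factorial. Under subfactorial growth, every equation is therefore linear
  with constant coefficients modulo states that are strictly lower in the recurrence order, and by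
  induction the series lie in finite-dimensional spaces closed under differentiation. The growth
  dichotomy is read off from the resulting linear recurrence.
\<close>

section \<open>Growth of linear recurrences\<close>

text \<open>The obstacle is the product inside the nested integrals, which makes the system
  nonlinear. Products of series from strictly lower recurrence classes are harmless, because series
  whose derivatives span a finite-dimensional space are closed under sums, products and integration.
  Within one class the growth hypothesis leaves only constant multiples of iterated integrals of a
  single unknown, so adjoining finitely many iterated integrals gives a space that is almost stable
  under differentiation. What remains are unary operations, which contribute an unknown with no
  integral in front; finite dimensionality excludes cycles of these, so the derivatives of the
  unknowns can be eliminated in turn. On the algebraic side, normal monomials are handled through
  the set of all leading monomials of the ideal, which is closed under relabeling and grafting,
  hence under passing to multiples. For the growth, dominant complex roots of equal modulus may
  oscillate; it suffices that their joint contribution does not tend to 0, since the claims concern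
  upper limits.\<close>

text \<open>The basis of binomials times \<mu> ^ (n - j), instead of n ^ j * \<mu> ^ n, also covers
  \<mu> = 0: the term is then 1 at n = j and 0 elsewhere. So finitely supported sequences, which
  occur when a recurrence has the root 0, need no separate case.\<close>

inductive exp_poly :: "(nat \<Rightarrow> complex) \<Rightarrow> bool" where
  exp_poly_0: "exp_poly (\<lambda>n. 0)"
| exp_poly_add_term: "exp_poly a \<Longrightarrow> exp_poly (\<lambda>n. a n + c * (of_nat (n choose j) * \<mu> ^ (n - j)))"

lemma exp_poly_term: "exp_poly (\<lambda>n. c * (of_nat (n choose j) * \<mu> ^ (n - j)))"
  using exp_poly_add_term[OF exp_poly_0, of c j \<mu>] by simp

lemma exp_poly_add: "exp_poly b \<Longrightarrow> exp_poly a \<Longrightarrow> exp_poly (\<lambda>n. a n + b n)"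
proof (induction b rule: exp_poly.induct)
  case exp_poly_0
  then show ?case by simp
next
  case (exp_poly_add_term b c j \<mu>)
  then show ?case
    using exp_poly.exp_poly_add_term[of "\<lambda>n. a n + b n" c j \<mu>] by (simp add: add.assoc)
qed

lemma exp_poly_scale: "exp_poly a \<Longrightarrow> exp_poly (\<lambda>n. k * a n)"
proof (induction a rule: exp_poly.induct)
  case exp_poly_0
  then show ?case by (simp add: exp_poly.exp_poly_0)
next
  case (exp_poly_add_term b c j \<mu>)
  then show ?case
    using exp_poly.exp_poly_add_term[of "\<lambda>n. k * b n" "k * c" j \<mu>] by (simp add: algebra_simps)
qed

text \<open>Pascal's rule: the shift acts on the terms with fixed \<mu> as a Jordan block with
  eigenvalue \<mu>.\<close>

lemma binomial_power_shift:
  fixes \<mu> :: complex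
  shows "of_nat (Suc n choose Suc j) * \<mu> ^ (Suc n - Suc j)
    = \<mu> * (of_nat (n choose Suc j) * \<mu> ^ (n - Suc j)) + of_nat (n choose j) * \<mu> ^ (n - j)"
proof (cases "j < n")
  case True
  then have "n - j = Suc (n - Suc j)" by simp
  then show ?thesis by (simp add: algebra_simps)
next
  case False
  then show ?thesis by (cases "n = j") (auto simp: binomial_eq_0)
qed

text \<open>If \<mu> = \<rho>, the shift minus \<rho> sends the next term of the Jordan chain to the
  given one. Otherwise it is triangular on the chain with diagonal entry \<mu> - \<rho>, and is
  inverted by induction on j.\<close>

lemma exp_poly_shift_surj_term:
  "\<exists>b. exp_poly b \<and> (\<forall>n. b (Suc n) - \<rho> * b n = of_nat (n choose j) * \<mu> ^ (n - j))"
proof (cases "\<mu> = \<rho>")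
  case True
  show ?thesis
    by (rule exI[of _ "\<lambda>n. 1 * (of_nat (n choose Suc j) * \<mu> ^ (n - Suc j))"], intro conjI exp_poly_term allI)
      (use binomial_power_shift[of _ j \<mu>] True in simp)
next
  case False
  show ?thesis
  proof (induction j)
    case 0
    show ?case
      by (rule exI[of _ "\<lambda>n. (1 / (\<mu> - \<rho>)) * (of_nat (n choose 0) * \<mu> ^ (n - 0))"],
          intro conjI exp_poly_term allI)
        (use False in \<open>simp add: right_diff_distrib[symmetric] mult.assoc[symmetric]
          diff_divide_distrib[symmetric] left_diff_distrib[symmetric]\<close>)
  next
    case (Suc j)
    then obtain b where b: "exp_poly b" "\<And>n. b (Suc n) - \<rho> * b n = of_nat (n choose j) * \<mu> ^ (n - j)"
      by blast
    define e where "e j n = of_nat (n choose j) * \<mu> ^ (n - j)" for j n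
    \<comment> \<open>The shift minus \<rho> sends \<open>e (Suc j)\<close> to (\<mu> - \<rho>)
      times itself plus \<open>e j\<close>; subtracting \<open>b\<close> cancels the second
      summand.\<close>
    define b' where "b' n = (1 / (\<mu> - \<rho>)) * (- 1 * b n + 1 * e (Suc j) n)" for n
    have e: "e (Suc j) (Suc n) = \<mu> * e (Suc j) n + e j n" for n
      unfolding e_def by (rule binomial_power_shift)
    have "exp_poly b'"
      unfolding b'_def e_def
      by (intro exp_poly_scale exp_poly_add_term b)
    moreover have "b' (Suc n) - \<rho> * b' n = e (Suc j) n" for n
    proof -
      have "b (Suc n) = \<rho> * b n + e j n" using b(2)[of n] by (simp add: e_def algebra_simps)
      then have "b' (Suc n) - \<rho> * b' n = (1 / (\<mu> - \<rho>)) * ((\<mu> - \<rho>) * e (Suc j) n)"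
        unfolding b'_def e by (simp add: algebra_simps)
      then show ?thesis using False by simp
    qed
    ultimately show ?case unfolding e_def by blast
  qed
qed

lemma exp_poly_shift_surj: "exp_poly a \<Longrightarrow> \<exists>b. exp_poly b \<and> (\<forall>n. b (Suc n) - \<rho> * b n = a n)"
proof (induction a rule: exp_poly.induct)
  case exp_poly_0
  then show ?case using exp_poly.exp_poly_0 by force
next
  case (exp_poly_add_term a c j \<mu>)
  then obtain b where b: "exp_poly b" "\<And>n. b (Suc n) - \<rho> * b n = a n" by blast
  obtain b' where b': "exp_poly b'" "\<And>n. b' (Suc n) - \<rho> * b' n = of_nat (n choose j) * \<mu> ^ (n - j)"
    using exp_poly_shift_surj_term by blast
  have "exp_poly (\<lambda>n. b n + c * b' n)" by (intro exp_poly_add exp_poly_scale b b')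
  moreover have "(b (Suc n) + c * b' (Suc n)) - \<rho> * (b n + c * b' n)
      = a n + c * (of_nat (n choose j) * \<mu> ^ (n - j))" for n
    unfolding b(2)[symmetric] b'(2)[symmetric] by (simp add: algebra_simps)
  ultimately show ?case by blast
qed

text \<open>Two solutions of the same first-order recurrence differ by a multiple of \<rho> ^ n,
  which is the term with j = 0.\<close>

lemma exp_poly_shift:
  assumes "exp_poly (\<lambda>n. a (Suc n) - \<rho> * a n)"
  shows "exp_poly a"
proof -
  obtain b where b: "exp_poly b" "\<And>n. b (Suc n) - \<rho> * b n = a (Suc n) - \<rho> * a n"
    using exp_poly_shift_surj[OF assms, of \<rho>] by blast
  have d: "a n = b n + (a 0 - b 0) * (of_nat (n choose 0) * \<rho> ^ (n - 0))" for n
  proof (induction n)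
    case (Suc n)
    have "a (Suc n) = b (Suc n) + \<rho> * (a n - b n)" using b(2)[of n] by (simp add: algebra_simps)
    also have "a n - b n = (a 0 - b 0) * \<rho> ^ n" using Suc by simp
    finally show ?case by (simp add: algebra_simps)
  qed simp
  show ?thesis
    by (subst d[THEN ext]) (intro exp_poly_add_term b)
qed

text \<open>A complex root z splits the recurrence operator into the shift minus z and an operator
  of smaller degree. The induction hypothesis applies to a (n + 1) - z * a n, and
  \<open>exp_poly_shift\<close> returns to \<open>a\<close>.\<close>

lemma exp_poly_linear_recurrence:
  fixes p :: "complex poly"
  assumes "p \<noteq> 0" "exp_poly (\<lambda>n. \<Sum>i\<le>degree p. coeff p i * a (n + i))"
  shows "exp_poly a"
  using assms
proof (induction "degree p" arbitrary: p a)
  case 0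
  then have c: "coeff p 0 \<noteq> 0" by (metis leading_coeff_0_iff)
  from 0 have "exp_poly (\<lambda>n. coeff p 0 * a n)" by simp
  from exp_poly_scale[OF this, of "1 / coeff p 0"] c show ?case by simp
next
  case (Suc k)
  have "\<not> constant (poly p)" using Suc.hyps(2) by (simp add: constant_degree)
  then obtain z where "poly p z = 0" using fundamental_theorem_of_algebra by blast
  then obtain q where q: "p = [:-z, 1:] * q" using poly_eq_0_iff_dvd by (metis dvdE)
  have q0: "q \<noteq> 0" using q Suc.prems by auto
  have dq: "degree q = k" using Suc.hyps(2) q q0 by (simp add: degree_mult_eq del: mult_pCons_left)
  define b where "b n = a (Suc n) - z * a n" for n
  have "(\<Sum>i\<le>degree p. coeff p i * a (n + i)) = (\<Sum>i\<le>degree q. coeff q i * b (n + i))" for n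
  proof -
    have "(\<Sum>i\<le>degree q. coeff q i * b (n + i))
        = (\<Sum>i\<le>k. coeff q i * a (n + Suc i)) - z * (\<Sum>i\<le>k. coeff q i * a (n + i))"
      by (simp add: b_def dq sum_distrib_left algebra_simps sum_subtractf)
    also have "(\<Sum>i\<le>k. coeff q i * a (n + i)) = (\<Sum>i\<le>Suc k. coeff q i * a (n + i))"
      using dq by (simp add: coeff_eq_0)
    also have "(\<Sum>i\<le>k. coeff q i * a (n + Suc i)) = (\<Sum>i\<le>Suc k. coeff (pCons 0 q) i * a (n + i))"
      by (subst sum.atMost_Suc_shift) simp
    also have "\<dots> - z * (\<Sum>i\<le>Suc k. coeff q i * a (n + i)) = (\<Sum>i\<le>Suc k. coeff p i * a (n + i))"
      unfolding q by (simp add: sum_distrib_left sum_subtractf[symmetric] algebra_simps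
          del: sum.atMost_Suc)
    finally show ?thesis using Suc.hyps(2) by simp
  qed
  then have "exp_poly (\<lambda>n. \<Sum>i\<le>degree q. coeff q i * b (n + i))" using Suc.prems by simp
  then have "exp_poly b" using Suc.hyps(1) dq q0 by metis
  then show ?case unfolding b_def by (rule exp_poly_shift)
qed

text \<open>Equal pairs are collected and zero coefficients discarded, since the inductive
  definition permits repeated and cancelling terms, which would spoil the choice of a dominant
  term.\<close>

lemma exp_poly_finite_sum:
  assumes "exp_poly a"
  obtains I c where "finite I" "\<And>x. x \<in> I \<Longrightarrow> c x \<noteq> 0"
    "\<And>n. a n = (\<Sum>(\<mu>, j)\<in>I. c (\<mu>, j) * (of_nat (n choose j) * \<mu> ^ (n - j)))"
proof -
  have "\<exists>J c. finite J \<and> (\<forall>n. a n = (\<Sum>x\<in>J. c x * (of_nat (n choose snd x) * fst x ^ (n - snd x))))"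
    using assms
  proof induction
    case exp_poly_0
    then show ?case by (intro exI[of _ "{}"]) auto
  next
    case (exp_poly_add_term a c j \<mu>)
    then obtain J c' where J: "finite J"
      "\<And>n. a n = (\<Sum>x\<in>J. c' x * (of_nat (n choose snd x) * fst x ^ (n - snd x)))" by blast
    define J' where "J' = insert (\<mu>, j) J"
    define c1 where "c1 x = (if x \<in> J then c' x else 0) + (if x = (\<mu>, j) then c else 0)" for x
    have "a n + c * (of_nat (n choose j) * \<mu> ^ (n - j))
        = (\<Sum>x\<in>J'. c1 x * (of_nat (n choose snd x) * fst x ^ (n - snd x)))" for n
    proof -
      have "(\<Sum>x\<in>J'. c1 x * (of_nat (n choose snd x) * fst x ^ (n - snd x)))
        = (\<Sum>x\<in>J'. if x \<in> J then c' x * (of_nat (n choose snd x) * fst x ^ (n - snd x)) else 0)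
          + (\<Sum>x\<in>J'. if x = (\<mu>, j) then c * (of_nat (n choose snd x) * fst x ^ (n - snd x)) else 0)"
        unfolding sum.distrib[symmetric] by (rule sum.cong) (auto simp: c1_def algebra_simps)
      also have "(\<Sum>x\<in>J'. if x \<in> J then c' x * (of_nat (n choose snd x) * fst x ^ (n - snd x)) else 0)
        = a n" unfolding J(2) by (rule sum.mono_neutral_cong_right) (use J in \<open>auto simp: J'_def\<close>)
      finally show ?thesis using J(1) by (simp add: J'_def)
    qed
    then show ?case using J(1) by (intro exI[of _ J'] exI[of _ c1]) (auto simp: J'_def)
  qed
  then obtain J c where J: "finite J"
      "\<And>n. a n = (\<Sum>x\<in>J. c x * (of_nat (n choose snd x) * fst x ^ (n - snd x)))" by blast
  show ?thesis
  proof (rule that[of "{x\<in>J. c x \<noteq> 0}" c])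
    show "a n = (\<Sum>(\<mu>, j)\<in>{x\<in>J. c x \<noteq> 0}. c (\<mu>, j) * (of_nat (n choose j) * \<mu> ^ (n - j)))" for n
      unfolding J(2) by (rule sum.mono_neutral_cong_right) (use J in auto)
  qed (use J in auto)
qed

section \<open>Asymptotics of exponential polynomials and the growth dichotomy\<close>

text \<open>The shift minus u removes the frequency u and multiplies the coefficient of every other
  w by w - u, which is nonzero. By induction only one frequency is left, and its term has constant
  modulus.\<close>

lemma trig_sum_tendsto_0_imp:
  fixes c :: "complex \<Rightarrow> complex"
  assumes "finite W" "\<And>w. w \<in> W \<Longrightarrow> norm w = 1"
    and "(\<lambda>n. \<Sum>w\<in>W. c w * w ^ n) \<longlonglongrightarrow> 0" "v \<in> W"
  shows "c v = 0"
  using assms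
proof (induction W arbitrary: c v rule: finite_induct)
  case (insert u W)
  define f where "f n = (\<Sum>w\<in>insert u W. c w * w ^ n)" for n
  have "(\<lambda>n. f (Suc n) - u * f n) \<longlonglongrightarrow> 0 - u * 0"
    using insert.prems(2) by (intro tendsto_intros) (auto simp: f_def[symmetric] filterlim_sequentially_Suc)
  also have "(\<lambda>n. f (Suc n) - u * f n) = (\<lambda>n. \<Sum>w\<in>W. (c w * (w - u)) * w ^ n)"
    using insert.hyps
    by (auto simp: f_def sum_distrib_left sum_subtractf[symmetric] algebra_simps)
  finally have "(\<lambda>n. \<Sum>w\<in>W. (c w * (w - u)) * w ^ n) \<longlonglongrightarrow> 0" by simp
  then have "c w * (w - u) = 0" if "w \<in> W" for w
    using insert.IH[of "\<lambda>w. c w * (w - u)"] insert.prems(1) that by simp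
  then have W: "c w = 0" if "w \<in> W" for w
    using insert.hyps that by fastforce
  then have "(\<lambda>n. c u * u ^ n) \<longlonglongrightarrow> 0"
    using insert.prems(2) insert.hyps by simp
  then have "(\<lambda>n. norm (c u * u ^ n)) \<longlonglongrightarrow> 0" by (rule tendsto_norm_zero)
  then have "(\<lambda>n::nat. norm (c u)) \<longlonglongrightarrow> 0" using insert.prems(1) by (simp add: norm_mult norm_power)
  then have "c u = 0" by (simp add: LIMSEQ_const_iff)
  with W insert.prems(3) show ?case by auto
qed simp

lemma binomial_over_power_tendsto:
  "(\<lambda>n. real (n choose j) / real n ^ j) \<longlonglongrightarrow> 1 / fact j"
proof (induction j)
  case (Suc j)
  have "(\<lambda>n. (real (n choose j) / real n ^ j) * ((real n - real j) / real n / (real j + 1)))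
      \<longlonglongrightarrow> (1 / fact j) * inverse (real j + 1)"
    by (intro tendsto_mult Suc) real_asymp
  also have "(1 / fact j) * inverse (real j + 1) = 1 / fact (Suc j)" by (simp add: field_simps)
  finally show ?case
  proof (rule Lim_transform_eventually)
    show "\<forall>\<^sub>F n in sequentially. real (n choose j) / real n ^ j * ((real n - real j) / real n / (real j + 1))
        = real (n choose Suc j) / real n ^ Suc j"
    proof (rule eventually_sequentiallyI[of "Suc j"])
      fix n assume n: "Suc j \<le> n"
      have "(n choose j) * (n - j) = Suc j * (n choose Suc j)"
        by (metis binomial_absorb_comp mult.commute binomial_absorption)
      then have "real (n choose j) * (real n - real j) = (real j + 1) * real (n choose Suc j)"
        using n by (metis Suc_leD of_nat_Suc of_nat_diff of_nat_mult add.commute)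
      then show "real (n choose j) / real n ^ j * ((real n - real j) / real n / (real j + 1))
        = real (n choose Suc j) / real n ^ Suc j"
        using n by (simp add: power_Suc2 mult.commute[of "real j + 1"] del: power_Suc)
    qed
  qed
qed simp

text \<open>Here r is the largest modulus of a nonzero base, and d the largest j among the terms of
  that modulus. After normalization only the terms in \<open>T\<close> survive; they approach a sum
  of unimodular exponentials, which may have no limit but cannot tend to 0.\<close>

lemma exp_poly_asymptotics:
  assumes "exp_poly a" and nz: "\<not> (\<forall>\<^sub>F n in sequentially. a n = 0)"
  obtains r d where "r > 0" "Bseq (\<lambda>n. a n / of_real (r ^ n * real n ^ d))"
    "\<not> (\<lambda>n. a n / of_real (r ^ n * real n ^ d)) \<longlonglongrightarrow> 0"
proof -
  obtain I c where I: "finite I" "\<And>x. x \<in> I \<Longrightarrow> c x \<noteq> 0"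
    and a: "\<And>n. a n = (\<Sum>(\<mu>, j)\<in>I. c (\<mu>, j) * (of_nat (n choose j) * \<mu> ^ (n - j)))"
    using exp_poly_finite_sum[OF assms(1)] by blast
  \<comment> \<open>A term with base 0 vanishes for n > j. If no other terms existed, the sequence
    would be eventually zero.\<close>
  define I' where "I' = {x\<in>I. fst x \<noteq> 0}"
  have "I' \<noteq> {}"
  proof
    assume e: "I' = {}"
    have "\<forall>\<^sub>F n in sequentially. \<forall>x\<in>I. n > snd x"
      using I(1) by (intro eventually_ball_finite ballI eventually_gt_at_top)
    then have "\<forall>\<^sub>F n in sequentially. a n = 0"
    proof eventually_elim
      case (elim n)
      show ?case unfolding a
      proof (rule sum.neutral, safe)
        fix \<mu> j assume "(\<mu>, j) \<in> I"
        then show "c (\<mu>, j) * (of_nat (n choose j) * \<mu> ^ (n - j)) = 0"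
          using e elim by (auto simp: I'_def)
      qed
    qed
    with nz show False ..
  qed
  define r where "r = Max ((\<lambda>x. norm (fst x)) ` I')"
  define R where "R = {x\<in>I'. norm (fst x) = r}"
  have fin: "finite I'" "finite R" using I(1) by (auto simp: I'_def R_def)
  have "r \<in> (\<lambda>x. norm (fst x)) ` I'"
    unfolding r_def using \<open>I' \<noteq> {}\<close> fin by (intro Max_in) auto
  then have r0: "r > 0" and "R \<noteq> {}" by (auto simp: I'_def R_def)
  have r_max: "norm (fst x) \<le> r" if "x \<in> I'" for x
    unfolding r_def using that fin by auto
  define d where "d = Max (snd ` R)"
  have "d \<in> snd ` R" unfolding d_def using \<open>R \<noteq> {}\<close> fin by (intro Max_in) auto
  then obtain x0 where x0: "x0 \<in> R" "snd x0 = d" by auto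
  have d_max: "snd x \<le> d" if "x \<in> R" for x unfolding d_def using that fin by auto
  define T where "T = {x\<in>R. snd x = d}"
  define t where "t x n = c x * (of_nat (n choose snd x) * fst x ^ (n - snd x)) / of_real (r ^ n * real n ^ d)"
    for x n
  define k where "k x = c x / (fst x ^ d * fact d)" for x
  define \<omega> where "\<omega> x = fst x / of_real r" for x :: "complex \<times> nat"
  have t_eq: "\<forall>\<^sub>F n in sequentially. t x n
      = c x / fst x ^ snd x * of_real (real (n choose snd x) / real n ^ snd x)
        * (\<omega> x ^ n * (of_nat n ^ snd x / of_nat n ^ d))" if "x \<in> I'" for x
  proof (rule eventually_sequentiallyI[of "Suc (snd x)"])
    fix n assume n: "Suc (snd x) \<le> n"
    have "fst x ^ (n - snd x) = fst x ^ n / fst x ^ snd x"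
      using n that by (simp add: power_diff I'_def)
    then show "t x n = c x / fst x ^ snd x * of_real (real (n choose snd x) / real n ^ snd x)
        * (\<omega> x ^ n * (of_nat n ^ snd x / of_nat n ^ d))"
      using n that r0 by (simp add: t_def \<omega>_def I'_def power_divide field_simps)
  qed
  have binl: "(\<lambda>n. complex_of_real (real (n choose j) / real n ^ j)) \<longlonglongrightarrow> of_real (1 / fact j)" for j
    by (intro tendsto_of_real binomial_over_power_tendsto)
  have low: "t x \<longlonglongrightarrow> 0" if x: "x \<in> I - T" for x
  proof (cases "fst x = 0")
    case True
    have "\<forall>\<^sub>F n in sequentially. t x n = 0"
      by (rule eventually_sequentiallyI[of "Suc (snd x)"]) (auto simp: t_def True)
    then show ?thesis by (rule tendsto_eventually)
  next
    case False
    with x have xI: "x \<in> I'" by (auto simp: I'_def)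
    have "(\<lambda>n. (norm (fst x) / r) ^ n * (real n ^ snd x / real n ^ d)) \<longlonglongrightarrow> 0"
    proof (cases "norm (fst x) = r")
      case True
      with x xI have "snd x < d" using d_max[of x] by (auto simp: T_def R_def)
      then have "(\<lambda>n. real n ^ snd x / real n ^ d) \<longlonglongrightarrow> 0" by real_asymp
      then show ?thesis using True r0 by simp
    next
      case neq: False
      define q where "q = norm (fst x) / r"
      have "0 < q" "q < 1" using r_max[OF xI] False r0 neq by (auto simp: q_def)
      then have "(\<lambda>n. q ^ n * (real n ^ snd x / real n ^ d)) \<longlonglongrightarrow> 0"
        by real_asymp
      then show ?thesis by (simp add: q_def)
    qed
    then have z: "(\<lambda>n. \<omega> x ^ n * (of_nat n ^ snd x / of_nat n ^ d)) \<longlonglongrightarrow> 0"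
      by (subst tendsto_norm_zero_iff[symmetric])
        (use r0 in \<open>simp add: norm_mult norm_power norm_divide \<omega>_def\<close>)
    have "(\<lambda>n. c x / fst x ^ snd x * of_real (real (n choose snd x) / real n ^ snd x)
        * (\<omega> x ^ n * (of_nat n ^ snd x / of_nat n ^ d))) \<longlonglongrightarrow>
        c x / fst x ^ snd x * of_real (1 / fact (snd x)) * 0"
      by (intro tendsto_mult tendsto_const binl z)
    then show ?thesis
      using t_eq[OF xI] by (simp add: tendsto_cong)
  qed
  have om1: "norm (\<omega> x) = 1" if "x \<in> T" for x
    using that r0 by (auto simp: T_def R_def \<omega>_def norm_divide)
  have top: "(\<lambda>n. t x n - k x * \<omega> x ^ n) \<longlonglongrightarrow> 0" if x: "x \<in> T" for x
  proof -
    have xI: "x \<in> I'" and xd: "snd x = d" using x by (auto simp: T_def R_def)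
    have "(\<lambda>n. complex_of_real (real (n choose d) / real n ^ d) - of_real (1 / fact d)) \<longlonglongrightarrow> 0"
      using binl[of d] by (simp add: LIM_zero_iff)
    then have "(\<lambda>n. c x / fst x ^ d * (of_real (real (n choose d) / real n ^ d) - of_real (1 / fact d)))
        \<longlonglongrightarrow> 0" by (rule tendsto_mult_right_zero)
    then have "(\<lambda>n. norm (c x / fst x ^ d * (of_real (real (n choose d) / real n ^ d) - of_real (1 / fact d))))
        \<longlonglongrightarrow> 0" by (rule tendsto_norm_zero)
    then have "(\<lambda>n. c x / fst x ^ d * (of_real (real (n choose d) / real n ^ d) - of_real (1 / fact d))
        * \<omega> x ^ n) \<longlonglongrightarrow> 0"
      by (subst tendsto_norm_zero_iff[symmetric])
        (simp add: norm_mult norm_power norm_divide om1[OF x])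
    moreover have "\<forall>\<^sub>F n in sequentially.
        c x / fst x ^ d * (of_real (real (n choose d) / real n ^ d) - of_real (1 / fact d)) * \<omega> x ^ n
        = t x n - k x * \<omega> x ^ n"
      using t_eq[OF xI] eventually_gt_at_top[of 0]
      by eventually_elim (simp add: xd k_def algebra_simps)
    ultimately show ?thesis by (rule Lim_transform_eventually)
  qed
  have TI: "T \<subseteq> I" "finite T" using I(1) by (auto simp: T_def R_def I'_def)
  define g where "g n = a n / of_real (r ^ n * real n ^ d)" for n
  have g: "g n = (\<Sum>x\<in>I - T. t x n) + (\<Sum>x\<in>T. t x n)" for n
    unfolding sum.subset_diff[OF TI(1) I(1), symmetric] g_def a t_def
    by (simp add: sum_divide_distrib split_beta)
  have lim: "(\<lambda>n. g n - (\<Sum>x\<in>T. k x * \<omega> x ^ n)) \<longlonglongrightarrow> 0"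
  proof -
    have "(\<lambda>n. (\<Sum>x\<in>I - T. t x n) + (\<Sum>x\<in>T. t x n - k x * \<omega> x ^ n))
        \<longlonglongrightarrow> (\<Sum>x\<in>I - T. 0) + (\<Sum>x\<in>T. 0)"
      by (intro tendsto_add tendsto_sum low top)
    then show ?thesis by (simp add: g sum_subtractf algebra_simps)
  qed
  have "Bseq (\<lambda>n. \<Sum>x\<in>T. k x * \<omega> x ^ n)"
  proof (rule BseqI'[of _ "\<Sum>x\<in>T. norm (k x)"])
    show "norm (\<Sum>x\<in>T. k x * \<omega> x ^ n) \<le> (\<Sum>x\<in>T. norm (k x))" for n
      by (rule sum_norm_le) (simp add: norm_mult norm_power om1)
  qed
  moreover have "Bseq (\<lambda>n. g n - (\<Sum>x\<in>T. k x * \<omega> x ^ n))"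
    by (rule convergent_imp_Bseq[OF convergentI[OF lim]])
  ultimately obtain K1 K2 where K: "\<And>n. norm (\<Sum>x\<in>T. k x * \<omega> x ^ n) \<le> K1"
      "\<And>n. norm (g n - (\<Sum>x\<in>T. k x * \<omega> x ^ n)) \<le> K2" by (meson BseqE)
  have "Bseq g"
  proof (rule BseqI'[of _ "K1 + K2"])
    fix n
    have "norm (g n) \<le> norm (\<Sum>x\<in>T. k x * \<omega> x ^ n) + norm (g n - (\<Sum>x\<in>T. k x * \<omega> x ^ n))"
      by (metis add.commute diff_add_cancel norm_triangle_ineq)
    then show "norm (g n) \<le> K1 + K2" using K[of n] by linarith
  qed
  moreover have "\<not> g \<longlonglongrightarrow> 0"
  proof
    assume "g \<longlonglongrightarrow> 0"
    from tendsto_diff[OF this lim] have s: "(\<lambda>n. \<Sum>x\<in>T. k x * \<omega> x ^ n) \<longlonglongrightarrow> 0" by simp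
    \<comment> \<open>All pairs in \<open>T\<close> have the second component d, so they are
      distinguished by their bases, and the frequencies are distinct.\<close>
    have inj: "inj_on \<omega> T" using r0 by (auto simp: inj_on_def \<omega>_def T_def prod_eq_iff)
    define c' where "c' w = k (the_inv_into T \<omega> w)" for w
    have "(\<Sum>x\<in>T. k x * \<omega> x ^ n) = (\<Sum>w\<in>\<omega> ` T. c' w * w ^ n)" for n
      by (subst sum.reindex[OF inj]) (simp add: c'_def the_inv_into_f_f[OF inj])
    with s have s': "(\<lambda>n. \<Sum>w\<in>\<omega> ` T. c' w * w ^ n) \<longlonglongrightarrow> 0" by simp
    have x0T: "x0 \<in> T" using x0 by (simp add: T_def)
    have "c' (\<omega> x0) = 0"
      by (rule trig_sum_tendsto_0_imp[OF _ _ s']) (use TI om1 x0T in auto)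
    then have "k x0 = 0" using x0T by (simp add: c'_def the_inv_into_f_f[OF inj])
    then show False using x0 I(2)[of x0] by (auto simp: k_def R_def I'_def)
  qed
  ultimately show ?thesis using that[of r d] r0 unfolding g_def by blast
qed

lemma frequently_ge_imp_le_limsup:
  fixes f :: "nat \<Rightarrow> ereal"
  assumes "\<exists>\<^sub>F n in sequentially. f n \<ge> c"
  shows "limsup f \<ge> c"
proof (rule ccontr)
  assume "\<not> limsup f \<ge> c"
  then have "\<forall>\<^sub>F n in sequentially. f n < c" by (intro Limsup_lessD) simp
  with assms have "\<exists>\<^sub>F n in sequentially. f n \<ge> c \<and> f n < c"
    by (rule frequently_eventually_frequently)
  then show False by (auto dest: frequently_ex)
qed

text \<open>The dominant modulus r decides: exponential growth for r > 1, polynomial growth for r =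
  1, and for r < 1 the values drop below 1 and, being integers, vanish. The sequences
  \<open>e\<close> and \<open>d\<close> are tied only at positive indices because the generating
  series have no term of degree 0.\<close>

lemma linear_recurrence_growth:
  fixes d :: "nat \<Rightarrow> nat" and p :: "rat poly"
  assumes "p \<noteq> 0" and rec: "\<And>n. (\<Sum>i\<le>degree p. coeff p i * e (n + i)) = 0"
    and e: "\<And>n. n > 0 \<Longrightarrow> e n = of_nat (d n)"
  shows "exponential_growth d \<or> polynomial_growth d"
proof -
  define a :: "nat \<Rightarrow> complex" where "a n = of_rat (e n)" for n
  define p' :: "complex poly" where "p' = map_poly of_rat p"
  have p': "p' \<noteq> 0" "degree p' = degree p" "\<And>i. coeff p' i = of_rat (coeff p i)"
    using assms(1) by (auto simp: p'_def degree_map_poly coeff_map_poly map_poly_eq_0_iff)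
  have "(\<Sum>i\<le>degree p'. coeff p' i * a (n + i)) = of_rat (\<Sum>i\<le>degree p. coeff p i * e (n + i))" for n
    by (simp add: p' a_def of_rat_sum of_rat_mult)
  then have "exp_poly (\<lambda>n. \<Sum>i\<le>degree p'. coeff p' i * a (n + i))"
    using rec by (simp add: exp_poly_0)
  then have ep: "exp_poly a" by (rule exp_poly_linear_recurrence[OF p'(1)])
  have ad: "a n = of_nat (d n)" if "n > 0" for n using e[OF that] by (simp add: a_def)
  show ?thesis
  proof (cases "\<forall>\<^sub>F n in sequentially. a n = 0")
    case True
    then have "\<forall>\<^sub>F n in sequentially. d n = 0"
      using eventually_gt_at_top[of 0] by eventually_elim (use ad in auto)
    then show ?thesis by (simp add: polynomial_growth_def)
  next
    case False
    obtain r k where r0: "r > 0" and B: "Bseq (\<lambda>n. a n / of_real (r ^ n * real n ^ k))"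
      and L: "\<not> (\<lambda>n. a n / of_real (r ^ n * real n ^ k)) \<longlonglongrightarrow> 0"
      by (rule exp_poly_asymptotics[OF ep False])
    have nrm: "norm (a n / of_real (r ^ n * real n ^ k)) = real (d n) / (r ^ n * real n ^ k)" if "n > 0" for n
      using that r0 by (simp add: ad norm_divide norm_mult norm_power)
    from B obtain K where K: "K > 0" "\<And>n. norm (a n / of_real (r ^ n * real n ^ k)) \<le> K"
      by (meson BseqE)
    have up: "real (d n) \<le> K * (r ^ n * real n ^ k)" if "n > 0" for n
      using K(2)[of n] nrm[OF that] that r0 by (simp add: divide_le_eq)
    obtain \<epsilon> where eps: "\<epsilon> > 0"
      "\<exists>\<^sub>F n in sequentially. norm (a n / of_real (r ^ n * real n ^ k)) \<ge> \<epsilon>"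
      using L by (auto simp: tendsto_iff not_eventually not_less)
    have low: "\<exists>\<^sub>F n in sequentially. n > 0 \<and> real (d n) \<ge> \<epsilon> * (r ^ n * real n ^ k)"
      using frequently_eventually_frequently[OF eps(2) eventually_gt_at_top[of 0]]
    proof (rule frequently_elim1)
      fix n assume "\<epsilon> \<le> norm (a n / of_real (r ^ n * real n ^ k)) \<and> 0 < n"
      then show "n > 0 \<and> real (d n) \<ge> \<epsilon> * (r ^ n * real n ^ k)"
        using nrm[of n] r0 by (simp add: le_divide_eq)
    qed
    consider "r > 1" | "r = 1" | "r < 1" by linarith
    then show ?thesis
    proof cases
      case 1
      \<comment> \<open>The gap between s and r absorbs the constant \<epsilon>.\<close>
      obtain s where s: "1 < s" "s < r" using 1 dense by blast
      have ev: "\<forall>\<^sub>F n in sequentially. s ^ n \<le> \<epsilon> * r ^ n"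
        using s eps(1) 1 by real_asymp
      have "\<exists>\<^sub>F n in sequentially. ereal (root n (real (d n))) \<ge> ereal s"
        using frequently_eventually_frequently[OF low ev]
      proof (rule frequently_elim1)
        fix n assume "(n > 0 \<and> real (d n) \<ge> \<epsilon> * (r ^ n * real n ^ k)) \<and> s ^ n \<le> \<epsilon> * r ^ n"
        then have *: "s ^ n \<le> \<epsilon> * r ^ n" and **: "n > 0 \<and> real (d n) \<ge> \<epsilon> * (r ^ n * real n ^ k)"
          by auto
        have "r ^ n * 1 \<le> r ^ n * real n ^ k"
          using ** r0 by (intro mult_left_mono one_le_power) auto
        from mult_left_mono[OF this, of \<epsilon>] have "\<epsilon> * (r ^ n * 1) \<le> \<epsilon> * (r ^ n * real n ^ k)"
          using eps(1) by (simp only: less_imp_le)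
        then have "s ^ n \<le> real (d n)" using * ** by simp
        then have "root n (s ^ n) \<le> root n (real (d n))" using ** by simp
        then show "ereal s \<le> ereal (root n (real (d n)))"
          using ** s by (simp add: real_root_power_cancel)
      qed
      from frequently_ge_imp_le_limsup[OF this] s(1)
      have "1 < limsup (\<lambda>n. ereal (root n (real (d n))))"
        using less_le_trans[of 1 "ereal s"] by simp
      \<comment> \<open>The factor 2 in the base absorbs the polynomial factor K * n ^ k.\<close>
      moreover have "limsup (\<lambda>n. ereal (root n (real (d n)))) \<le> ereal (2 * r)"
      proof (rule Limsup_bounded)
        have "\<forall>\<^sub>F n in sequentially. K * real n ^ k \<le> 2 ^ n" by real_asymp
        then show "\<forall>\<^sub>F n in sequentially. ereal (root n (real (d n))) \<le> ereal (2 * r)"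
          using eventually_gt_at_top[of 0]
        proof eventually_elim
          case (elim n)
          have "real (d n) \<le> (K * real n ^ k) * r ^ n" using up[OF elim(2)] by (simp add: algebra_simps)
          also have "\<dots> \<le> 2 ^ n * r ^ n" using elim r0 by (intro mult_right_mono) auto
          finally have "real (d n) \<le> (2 * r) ^ n" by (simp add: power_mult_distrib)
          then have "root n (real (d n)) \<le> root n ((2 * r) ^ n)"
            by (rule real_root_le_mono[OF elim(2)])
          also have "\<dots> = 2 * r" using elim r0 by (intro real_root_power_cancel) auto
          finally show ?case by simp
        qed
      qed
      ultimately show ?thesis by (auto simp: exponential_growth_def)
    next
      case 2
      have "\<exists>\<^sub>F n in sequentially. ereal (real (d n) / real n ^ k) \<ge> ereal \<epsilon>"
        using low by (rule frequently_elim1) (auto simp: 2 le_divide_eq)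
      from frequently_ge_imp_le_limsup[OF this] eps(1)
      have "0 < limsup (\<lambda>n. ereal (real (d n) / real n ^ k))"
        using less_le_trans[of 0 "ereal \<epsilon>"] by simp
      moreover have "limsup (\<lambda>n. ereal (real (d n) / real n ^ k)) \<le> ereal K"
        by (rule Limsup_bounded, rule eventually_sequentiallyI[of 1])
          (use up in \<open>auto simp: 2 divide_le_eq\<close>)
      ultimately show ?thesis unfolding polynomial_growth_def by auto
    next
      case 3
      have "\<forall>\<^sub>F n in sequentially. K * (r ^ n * real n ^ k) < 1" using 3 r0 by real_asymp
      then have "\<forall>\<^sub>F n in sequentially. d n = 0"
        using eventually_gt_at_top[of 0]
      proof eventually_elim
        case (elim n)
        then have "real (d n) < 1" using up[of n] by simp
        then show ?case by simp
      qed
      then show ?thesis by (simp add: polynomial_growth_def)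
    qed
  qed
qed

section \<open>Power series spanning finite-dimensional spaces of derivatives\<close>

interpretation fps_vs: vector_space "\<lambda>c (f :: 'a::field fps). fps_const c * f"
  by unfold_locales (auto simp: algebra_simps simp flip: fps_const_mult fps_const_add)

text \<open>The witness is a spanning set stable under differentiation rather than an equation.
  Closure under sums, products and integrals then needs only unions, pairwise products and the
  insertion of one element.\<close>

definition deriv_finite :: "'a::field_char_0 fps \<Rightarrow> bool" where
  "deriv_finite f \<longleftrightarrow>
    (\<exists>B. finite B \<and> f \<in> fps_vs.span B \<and> fps_deriv ` B \<subseteq> fps_vs.span B)"

lemma fps_deriv_in_span:
  assumes "fps_deriv ` B \<subseteq> fps_vs.span B'" "f \<in> fps_vs.span B"
  shows "fps_deriv f \<in> fps_vs.span B'"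
  using assms(2)
proof (induction rule: fps_vs.span_induct_alt)
  case base
  then show ?case by (simp add: fps_vs.span_zero)
next
  case (step c x y)
  then show ?case using assms(1)
    by (auto intro!: fps_vs.span_add fps_vs.span_scale)
qed

lemma deriv_finite_0: "deriv_finite 0"
  unfolding deriv_finite_def by (intro exI[of _ "{}"]) auto

lemma deriv_finite_add:
  assumes "deriv_finite f" "deriv_finite g"
  shows "deriv_finite (f + g)"
proof -
  obtain A where A: "finite A" "f \<in> fps_vs.span A" "fps_deriv ` A \<subseteq> fps_vs.span A"
    using assms(1) by (auto simp: deriv_finite_def)
  obtain B where B: "finite B" "g \<in> fps_vs.span B" "fps_deriv ` B \<subseteq> fps_vs.span B"
    using assms(2) by (auto simp: deriv_finite_def)
  have "fps_vs.span A \<subseteq> fps_vs.span (A \<union> B)" "fps_vs.span B \<subseteq> fps_vs.span (A \<union> B)"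
    by (auto intro!: fps_vs.span_mono)
  then show ?thesis
    unfolding deriv_finite_def using A B
    by (intro exI[of _ "A \<union> B"]) (auto intro!: fps_vs.span_add)
qed

lemma deriv_finite_sum: "(\<And>x. x \<in> A \<Longrightarrow> deriv_finite (f x)) \<Longrightarrow> deriv_finite (sum f A)"
  by (induction A rule: infinite_finite_induct) (auto intro: deriv_finite_0 deriv_finite_add)

lemma deriv_finite_deriv: "deriv_finite f \<Longrightarrow> deriv_finite (fps_deriv f)"
  unfolding deriv_finite_def using fps_deriv_in_span by blast

lemma deriv_finite_if_deriv:
  assumes "deriv_finite (fps_deriv f)"
  shows "deriv_finite f"
proof -
  obtain A where A: "finite A" "fps_deriv f \<in> fps_vs.span A" "fps_deriv ` A \<subseteq> fps_vs.span A"
    using assms(1) by (auto simp: deriv_finite_def)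
  have "fps_vs.span A \<subseteq> fps_vs.span (insert f A)" by (auto intro!: fps_vs.span_mono)
  then show ?thesis
    unfolding deriv_finite_def using A
    by (intro exI[of _ "insert f A"]) (auto intro: fps_vs.span_base)
qed

lemma deriv_finite_integral: "deriv_finite f \<Longrightarrow> deriv_finite (fps_integral0 f)"
  by (rule deriv_finite_if_deriv) (simp add: fps_deriv_fps_integral)

lemma deriv_finite_1: "deriv_finite 1"
  by (rule deriv_finite_if_deriv) (simp add: deriv_finite_0)

lemma deriv_finite_X: "deriv_finite fps_X"
  by (rule deriv_finite_if_deriv) (simp add: deriv_finite_1)

lemma fps_mult_in_span:
  assumes "f \<in> fps_vs.span A" "g \<in> fps_vs.span B"
  shows "f * g \<in> fps_vs.span ((\<lambda>(a, b). a * b) ` (A \<times> B))"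
  using assms(1)
proof (induction rule: fps_vs.span_induct_alt)
  case base
  then show ?case by (simp add: fps_vs.span_zero)
next
  case (step c a f)
  have "a * g \<in> fps_vs.span ((\<lambda>(a, b). a * b) ` (A \<times> B))"
    using assms(2)
  proof (induction rule: fps_vs.span_induct_alt)
    case base
    then show ?case by (simp add: fps_vs.span_zero)
  next
    case (step c b g)
    have "fps_const c * (a * b) + a * g \<in> fps_vs.span ((\<lambda>(a, b). a * b) ` (A \<times> B))"
      using step \<open>a \<in> A\<close> by (intro fps_vs.span_add fps_vs.span_scale)
        (auto intro!: fps_vs.span_base)
    then show ?case by (simp add: algebra_simps)
  qed
  then have "fps_const c * (a * g) + f * g \<in> fps_vs.span ((\<lambda>(a, b). a * b) ` (A \<times> B))"
    using step by (intro fps_vs.span_add fps_vs.span_scale)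
  then show ?case by (simp add: algebra_simps)
qed

lemma deriv_finite_mult:
  assumes "deriv_finite f" "deriv_finite g"
  shows "deriv_finite (f * g)"
proof -
  obtain A where A: "finite A" "f \<in> fps_vs.span A" "fps_deriv ` A \<subseteq> fps_vs.span A"
    using assms(1) by (auto simp: deriv_finite_def)
  obtain B where B: "finite B" "g \<in> fps_vs.span B" "fps_deriv ` B \<subseteq> fps_vs.span B"
    using assms(2) by (auto simp: deriv_finite_def)
  let ?C = "(\<lambda>(a, b). a * b) ` (A \<times> B)"
  have "fps_deriv (a * b) \<in> fps_vs.span ?C" if "a \<in> A" "b \<in> B" for a b
    using that A(3) B(3)
    by (auto intro!: fps_vs.span_add fps_mult_in_span intro: fps_vs.span_base)
  then show ?thesis
    unfolding deriv_finite_def using A B fps_mult_in_span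
    by (intro exI[of _ ?C]) auto
qed

lemma deriv_finite_imp_linear_ode:
  assumes "deriv_finite f"
  shows "satisfies_linear_ode_const_coeffs f"
proof -
  obtain B where B: "finite B" "f \<in> fps_vs.span B" "fps_deriv ` B \<subseteq> fps_vs.span B"
    using assms by (auto simp: deriv_finite_def)
  define D where "D i = (fps_deriv ^^ i) f" for i
  have D: "D i \<in> fps_vs.span B" for i
    unfolding D_def by (induction i) (use B fps_deriv_in_span in auto)
  obtain c :: "nat \<Rightarrow> 'a" and I where I: "finite I" "(\<Sum>i\<in>I. fps_const (c i) * D i) = 0" "\<exists>i\<in>I. c i \<noteq> 0"
  \<comment> \<open>Linear dependence is a notion for sets, so coinciding derivatives must be
    treated apart; they give the relation \<open>D i - D j = 0\<close> at once. If they are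
    distinct, there are more of them than elements of \<open>B\<close>.\<close>
  proof (cases "inj_on D {..card B}")
    case False
    then obtain i j where "i \<noteq> j" "D i = D j" by (auto simp: inj_on_def)
    then show ?thesis
      by (intro that[of "{i, j}" "\<lambda>k. if k = i then 1 else -1"]) (auto simp flip: fps_const_neg)
  next
    case True
    then have "card (D ` {..card B}) = Suc (card B)" by (simp add: card_image)
    moreover have "D ` {..card B} \<subseteq> fps_vs.span B" using D by auto
    ultimately have "fps_vs.dependent (D ` {..card B})"
      using fps_vs.independent_span_bound[OF B(1)] by fastforce
    then obtain u where "\<exists>v\<in>D ` {..card B}. u v \<noteq> 0"
      "(\<Sum>v\<in>D ` {..card B}. fps_const (u v) * v) = 0"
      by (auto simp: fps_vs.dependent_finite)
    then show ?thesis
      by (intro that[of "{..card B}" "\<lambda>i. u (D i)"]) (auto simp: sum.reindex[OF True])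
  qed
  define p where "p = (\<Sum>i\<in>I. monom (c i) i)"
  have p: "coeff p i = (if i \<in> I then c i else 0)" for i
    using I(1) by (simp add: p_def coeff_sum sum.delta')
  have "p \<noteq> 0" using I(3) p by (metis coeff_0)
  moreover have "(\<Sum>i\<le>degree p. fps_const (coeff p i) * D i) = 0"
  proof -
    have z: "c i = 0" if "i \<in> I" "\<not> i \<le> degree p" for i
      using that p[of i] le_degree[of p i] by auto
    have "(\<Sum>i\<le>degree p. fps_const (coeff p i) * D i) = (\<Sum>i\<in>I. fps_const (c i) * D i)"
      using I(1) z by (intro sum.mono_neutral_cong) (auto simp: p)
    with I show ?thesis by simp
  qed
  ultimately show ?thesis
    unfolding satisfies_linear_ode_const_coeffs_def D_def by blast
qed

section \<open>Linear systems with iterated integrals\<close>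

text \<open>The span of all \<open>A q\<close> and of the iterated integrals of the unknowns is
  stable under differentiation. Differentiating a proper integral lowers j by one. For the unknowns
  themselves, the derivative may involve derivatives of other unknowns, but only of predecessors in
  \<open>U\<close>, so induction along \<open>U\<close> places it in the span.\<close>

lemma deriv_finite_linear_system:
  assumes "finite K" "wf U" "J > 0"
    and y: "\<And>q. q \<in> K \<Longrightarrow> y q = g q + h q"
    and g: "\<And>q. q \<in> K \<Longrightarrow> deriv_finite (g q)"
    and h: "\<And>q. q \<in> K \<Longrightarrow> fps_deriv (h q) \<in>
      fps_vs.span ((\<lambda>(q', j). (fps_integral0 ^^ j) (y q')) ` (K \<times> {..<J})
        \<union> {fps_deriv (y q') | q'. q' \<in> K \<and> (q', q) \<in> U})"
    and "q \<in> K"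
  shows "deriv_finite (y q)"
proof -
  obtain A where A: "\<And>q. q \<in> K \<Longrightarrow> finite (A q)" "\<And>q. q \<in> K \<Longrightarrow> g q \<in> fps_vs.span (A q)"
      "\<And>q. q \<in> K \<Longrightarrow> fps_deriv ` A q \<subseteq> fps_vs.span (A q)"
    using g unfolding deriv_finite_def by metis
  define Y where "Y = (\<lambda>(q', j). (fps_integral0 ^^ j) (y q')) ` (K \<times> {..<J})"
  define B where "B = (\<Union>q\<in>K. A q) \<union> Y"
  have AB: "fps_vs.span (A q) \<subseteq> fps_vs.span B" if "q \<in> K" for q
    using that by (intro fps_vs.span_mono) (auto simp: B_def)
  have Dy: "q \<in> K \<Longrightarrow> fps_deriv (y q) \<in> fps_vs.span B" for q
    using \<open>wf U\<close>
  proof (induction q rule: wf_induct_rule)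
    case (less q)
    have "fps_deriv (g q) \<in> fps_vs.span B"
      using fps_deriv_in_span[OF A(3) A(2)] AB less.prems by blast
    moreover have "fps_vs.span (Y \<union> {fps_deriv (y q') | q'. q' \<in> K \<and> (q', q) \<in> U}) \<subseteq> fps_vs.span B"
      using less.IH by (intro fps_vs.span_minimal) (auto simp: B_def intro: fps_vs.span_base)
    then have "fps_deriv (h q) \<in> fps_vs.span B" using h[OF less.prems] by (auto simp: Y_def)
    ultimately show ?case using y[OF less.prems] by (simp add: fps_vs.span_add)
  qed
  have "fps_deriv b \<in> fps_vs.span B" if "b \<in> Y" for b
  proof -
    obtain q j where b: "b = (fps_integral0 ^^ j) (y q)" "q \<in> K" "j < J"
      using \<open>b \<in> Y\<close> by (auto simp: Y_def)
    show ?thesis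
    proof (cases j)
      case 0
      then show ?thesis using Dy b by simp
    next
      case (Suc i)
      then have "fps_deriv b = (fps_integral0 ^^ i) (y q)"
        using b by (simp add: fps_deriv_fps_integral)
      then show ?thesis using b Suc by (auto simp: B_def Y_def intro!: fps_vs.span_base)
    qed
  qed
  moreover have "fps_deriv b \<in> fps_vs.span B" if "b \<in> A q" "q \<in> K" for b q
    using A(3) AB that by blast
  ultimately have "fps_deriv ` B \<subseteq> fps_vs.span B" by (auto simp: B_def)
  moreover have "finite B" using A(1) \<open>finite K\<close> by (auto simp: B_def Y_def)
  moreover have "y q \<in> fps_vs.span B"
    using \<open>q \<in> K\<close> \<open>J > 0\<close>
    by (intro fps_vs.span_base) (force simp: B_def Y_def intro: rev_image_eqI[of "(q, 0)"])
  ultimately show ?thesis unfolding deriv_finite_def by blast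
qed

section \<open>From differential equations to recurrences and rational series\<close>

lemma fps_nth_deriv_fact:
  fixes f :: "'a::field_char_0 fps"
  shows "fps_nth ((fps_deriv ^^ i) f) n * fact n = fps_nth f (n + i) * fact (n + i)"
proof (induction i arbitrary: n)
  case (Suc i)
  have "fps_nth ((fps_deriv ^^ Suc i) f) n * fact n = fps_nth ((fps_deriv ^^ i) f) (Suc n) * fact (Suc n)"
    by (simp add: algebra_simps)
  also have "\<dots> = fps_nth f (Suc n + i) * fact (Suc n + i)" by (rule Suc)
  finally show ?case by simp
qed simp

lemma linear_ode_imp_recurrence:
  fixes a :: "nat \<Rightarrow> 'a::field_char_0"
  assumes "satisfies_linear_ode_const_coeffs (Abs_fps (\<lambda>n. a n / fact n))"
  obtains p :: "'a poly" where "p \<noteq> 0" "\<And>n. (\<Sum>i\<le>degree p. coeff p i * a (n + i)) = 0"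
proof -
  define f where "f = Abs_fps (\<lambda>n. a n / fact n)"
  obtain p :: "'a poly" where p: "p \<noteq> 0" "(\<Sum>i\<le>degree p. fps_const (coeff p i) * (fps_deriv ^^ i) f) = 0"
    using assms by (auto simp: satisfies_linear_ode_const_coeffs_def f_def)
  have "(\<Sum>i\<le>degree p. coeff p i * a (n + i)) = 0" for n
  proof -
    have "coeff p i * a (n + i) = fps_nth (fps_const (coeff p i) * (fps_deriv ^^ i) f) n * fact n" for i
      using fps_nth_deriv_fact[of i f n] by (simp add: mult.assoc) (simp add: f_def)
    then have "(\<Sum>i\<le>degree p. coeff p i * a (n + i))
        = fps_nth (\<Sum>i\<le>degree p. fps_const (coeff p i) * (fps_deriv ^^ i) f) n * fact n"
      by (simp only: fps_sum_nth sum_distrib_right)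
    then show ?thesis using p(2) by simp
  qed
  then show ?thesis using p(1) that by blast
qed

text \<open>The denominator is the reflected polynomial: coefficient m of the product is the
  recurrence at m - degree p, and so vanishes once m is at least the degree.\<close>

lemma recurrence_imp_rational:
  fixes p :: "'a::field poly"
  assumes "p \<noteq> 0" "\<And>n. (\<Sum>i\<le>degree p. coeff p i * a (n + i)) = 0"
  shows "rational_fps (Abs_fps a)"
proof -
  define N where "N = degree p"
  define F where "F = fps_of_poly (reflect_poly p) * Abs_fps a"
  have "fps_nth F m = 0" if "m \<ge> N" for m
  proof -
    have "fps_nth F m = (\<Sum>i\<le>m. (if i \<le> N then coeff p (N - i) else 0) * a (m - i))"
      by (simp add: F_def fps_mult_nth coeff_reflect_poly N_def not_le atLeast0AtMost
          if_distrib cong: if_cong) (intro sum.cong refl, auto)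
    also have "\<dots> = (\<Sum>i\<le>N. coeff p (N - i) * a (m - i))"
      using that by (intro sum.mono_neutral_cong_right) auto
    also have "\<dots> = (\<Sum>i\<le>N. coeff p i * a (m - N + i))"
      by (rule sum.reindex_bij_witness[of _ "\<lambda>i. N - i" "\<lambda>i. N - i"]) (use that in auto)
    finally show ?thesis using assms(2)[of "m - N"] by (simp add: N_def)
  qed
  then have "F = fps_of_poly (Poly (map (fps_nth F) [0..<N]))"
    by (intro fps_ext) (simp add: nth_default_def)
  then show ?thesis
    unfolding rational_fps_def F_def using assms(1) by (metis reflect_poly_eq_0_iff)
qed

section \<open>Labelings of planar trees\<close>

abbreviation arity :: "('u, 'l) ptree \<Rightarrow> nat" where
  "arity t \<equiv> length (leaf_list t)"

text \<open>
  Ordered partitions into blocks of the given sizes with increasing minima: the first block contains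
  the least of all labels, whence the two subtractions.
\<close>

fun shuffles_of :: "nat list \<Rightarrow> nat" where
  "shuffles_of [] = 1"
| "shuffles_of (n # ns) = (n + sum_list ns - 1 choose (n - 1)) * shuffles_of ns"

text \<open>A closed formula for the number of shuffle monomials on a given label set with a given
  skeleton; \<open>card_labeled\<close> proves that it counts them.\<close>

fun labelings :: "('u, 'l) ptree \<Rightarrow> nat" where
  "labelings (Leaf l) = 1"
| "labelings (Node u ts) = shuffles_of (map arity ts) * prod_list (map labelings ts)"

definition forest_labelings :: "('u, 'l) ptree list \<Rightarrow> nat" where
  "forest_labelings ts = shuffles_of (map arity ts) * prod_list (map labelings ts)"

abbreviation forest_arity :: "('u, 'l) ptree list \<Rightarrow> nat" where
  "forest_arity ts \<equiv> sum_list (map arity ts)"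

lemma labelings_Node: "labelings (Node u ts) = forest_labelings ts"
  by (simp add: forest_labelings_def)

lemma forest_labelings_Nil [simp]: "forest_labelings [] = 1"
  by (simp add: forest_labelings_def)

lemma forest_labelings_Cons: "forest_labelings (t # ts)
    = (arity t + forest_arity ts - 1 choose (arity t - 1)) * labelings t * forest_labelings ts"
  by (simp add: forest_labelings_def)

lemma arity_Node: "arity (Node u ts) = forest_arity ts"
  by (simp add: length_concat comp_def)

lemma shuffles_of_pos: "shuffles_of ns \<ge> 1"
proof (induction ns)
  case (Cons n ns)
  have "(n + sum_list ns - 1 choose (n - 1)) \<ge> 1" by (simp add: Suc_leI)
  with Cons show ?case by (simp add: Suc_le_eq)
qed simp

lemma labelings_pos: "labelings t \<ge> 1"
proof (induction t)
  case (Node u ts)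
  then have "prod_list (map labelings ts) \<ge> 1" by (induction ts) (auto simp: Suc_le_eq)
  with shuffles_of_pos[of "map arity ts"] show ?case by (simp add: Suc_le_eq)
qed simp

lemma forest_labelings_pos: "forest_labelings ts \<ge> 1"
  using labelings_pos[of "Node undefined ts"] by (simp only: labelings_Node)

lemma le_mult_of_ge_1: "(a::nat) \<ge> 1 \<Longrightarrow> b \<ge> 1 \<Longrightarrow> x \<le> a * b * x"
  using mult_le_mono[OF mult_le_mono[of 1 a 1 b] order_refl[of x]] by simp

lemma forest_labelings_append: "forest_labelings ts \<le> forest_labelings (ls @ ts)"
proof (induction ls)
  case (Cons l ls)
  have "1 \<le> (arity l + forest_arity (ls @ ts) - 1 choose (arity l - 1))" by (simp add: Suc_leI)
  from le_mult_of_ge_1[OF this labelings_pos[of l], of "forest_labelings (ls @ ts)"]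
  show ?case using le_trans[OF Cons] by (simp only: append_Cons forest_labelings_Cons)
qed simp

lemma forest_labelings_mem: "labelings t \<le> forest_labelings (ls @ t # rs)"
proof -
  have "1 \<le> (arity t + forest_arity rs - 1 choose (arity t - 1))" by (simp add: Suc_leI)
  from le_mult_of_ge_1[OF this forest_labelings_pos[of rs], of "labelings t"]
  have "labelings t \<le> forest_labelings (t # rs)" by (simp add: forest_labelings_Cons mult_ac)
  also have "\<dots> \<le> forest_labelings (ls @ t # rs)" by (rule forest_labelings_append)
  finally show ?thesis .
qed

text \<open>Besides the least label, \<open>t\<close> receives arity t - 1 labels. With something to
  its right, they are chosen from at least arity t candidates, which gives at least arity t
  choices.\<close>

lemma forest_labelings_right_sibling:
  assumes "arity t \<ge> 1" "forest_arity rs \<ge> 1"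
  shows "arity t * labelings t \<le> forest_labelings (ls @ t # rs)"
proof -
  have "arity t = (arity t choose (arity t - 1))"
    using assms(1) binomial_symmetric[of 1 "arity t"] by simp
  also have "\<dots> \<le> (arity t + forest_arity rs - 1 choose (arity t - 1))"
    using assms by (intro binomial_right_mono) auto
  finally have "arity t * labelings t * 1 \<le> (arity t + forest_arity rs - 1 choose (arity t - 1))
      * labelings t * forest_labelings rs"
    using forest_labelings_pos by (intro mult_le_mono) auto
  also have "\<dots> \<le> forest_labelings (ls @ t # rs)"
    using forest_labelings_append[of "t # rs" ls] by (simp only: forest_labelings_Cons)
  finally show ?thesis by simp
qed

text \<open>The sibling \<open>x\<close> has a label besides its minimum, and there are more than
  arity t ways to place it relative to the labels of \<open>t\<close>. A left sibling with a single
  leaf offers no such choice, as it is forced to take the least available label.\<close>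

lemma forest_labelings_left_sibling:
  assumes "x \<in> set ls" "arity x \<ge> 2" "arity t \<ge> 1"
  shows "arity t * labelings t \<le> forest_labelings (ls @ [t])"
proof -
  obtain l1 l2 where ls: "ls = l1 @ x # l2" using assms(1) by (meson split_list)
  define N where "N = arity x + forest_arity (l2 @ [t]) - 1"
  have "arity t \<le> (Suc (arity t) choose arity t)" by simp
  also have "\<dots> \<le> (arity x - 1 + arity t choose arity t)"
    using assms by (intro binomial_right_mono) auto
  also have "\<dots> = (arity x - 1 + arity t choose (arity x - 1))"
    by (subst binomial_symmetric) auto
  also have "\<dots> \<le> (N choose (arity x - 1))"
    using assms by (intro binomial_right_mono) (auto simp: N_def)
  finally have "arity t * 1 * labelings t \<le> (N choose (arity x - 1)) * labelings x * forest_labelings (l2 @ [t])"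
    using labelings_pos forest_labelings_mem[of t l2 "[]"] by (intro mult_le_mono) auto
  also have "\<dots> \<le> forest_labelings (ls @ [t])"
    unfolding ls N_def using forest_labelings_append[of "x # l2 @ [t]" l1]
    by (simp only: forest_labelings_Cons append_assoc append_Cons)
  finally show ?thesis by simp
qed

section \<open>Classes of planar trees with subfactorially many labelings\<close>

text \<open>The right-hand side is a lower bound for i!, the left-hand side a subfactorial bound at
  n = m + i * c with exponent n / (4 * c). Eventually n is at most 2 * c * i, so the exponent is at
  most i / 2 and the left-hand side is roughly the square root of i ^ i, up to exponential
  factors.\<close>

lemma power_over_exp_dominates:
  fixes c m K :: real
  assumes "c \<ge> 1" "m > 0" "K > 0"
  shows "\<forall>\<^sub>F i :: nat in sequentially.
    K * (m + real i * c) powr ((m + real i * c) / (4 * c)) < real i ^ i / exp (real i)"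
proof -
  have "2 * c > 0" using assms by simp
  then have "\<forall>\<^sub>F i :: nat in sequentially.
      ln K + (real i / 2) * ln ((2 * c) * real i) < real i * (ln (real i) - 1)"
    by real_asymp
  moreover have "\<forall>\<^sub>F i :: nat in sequentially. m / c < real i"
    by real_asymp
  ultimately show ?thesis
    using eventually_gt_at_top[of 0]
  proof eventually_elim
    case (elim i)
    have le: "m \<le> real i * c" using elim(2) assms by (simp add: divide_less_eq)
    have "1 * 1 \<le> real i * c" using elim(3) assms by (intro mult_mono) auto
    then have "(m + real i * c) powr ((m + real i * c) / (4 * c)) \<le> (m + real i * c) powr (real i / 2)"
      using le assms by (intro powr_mono) (auto simp: divide_le_eq mult.commute)
    also have "\<dots> \<le> ((2 * c) * real i) powr (real i / 2)"
      using le assms by (intro powr_mono2) (auto simp: mult.commute)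
    finally have "K * (m + real i * c) powr ((m + real i * c) / (4 * c))
        \<le> K * ((2 * c) * real i) powr (real i / 2)"
      using assms by (intro mult_left_mono) auto
    also have "\<dots> = exp (ln K + (real i / 2) * ln ((2 * c) * real i))"
      using assms elim by (simp add: exp_add powr_def)
    also have "\<dots> < exp (real i * (ln (real i) - 1))" using elim by simp
    also have "\<dots> = exp (real i * ln (real i)) / exp (real i)"
      by (simp add: right_diff_distrib exp_diff)
    also have "exp (real i * ln (real i)) = real i ^ i"
      using elim by (simp add: exp_of_nat_mult)
    finally show ?case .
  qed
qed

text \<open>
  The map \<open>st\<close> plays the role of a finite bottom-up tree automaton recognizing \<open>L\<close>.
\<close>

locale tree_class =
  fixes \<Upsilon> :: "'u set" and ar :: "'u \<Rightarrow> nat"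
    and L :: "('u, unit) ptree set" and st :: "('u, unit) ptree \<Rightarrow> 'q"
  assumes finite_ops: "finite \<Upsilon>" and ar_pos: "u \<in> \<Upsilon> \<Longrightarrow> ar u \<ge> 1"
    and finite_states: "finite (st ` L)"
    and Node_in_L: "Node u ts \<in> L \<Longrightarrow> u \<in> \<Upsilon> \<and> length ts = ar u \<and> set ts \<subseteq> L"
    and state_cong: "Node u ts \<in> L \<Longrightarrow> set ts' \<subseteq> L \<Longrightarrow> map st ts' = map st ts
      \<Longrightarrow> Node u ts' \<in> L \<and> st (Node u ts') = st (Node u ts)"
    and finite_arity: "finite {t \<in> L. arity t = n}"
    and subfactorial:
      "subfactorial_growth (\<lambda>n. real (\<Sum>t | t \<in> L \<and> arity t = n. labelings t))"
begin

section \<open>Counting sequences and generating series of the states\<close>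

definition LL :: "'q \<Rightarrow> ('u, unit) ptree set" where "LL q = {t \<in> L. st t = q}"

definition LF :: "'q list \<Rightarrow> ('u, unit) ptree list set" where
  "LF qs = {ts. list_all2 (\<lambda>t q. t \<in> LL q) ts qs}"

definition cnt :: "'q \<Rightarrow> nat \<Rightarrow> nat" where
  "cnt q n = (\<Sum>t | t \<in> LL q \<and> arity t = n. labelings t)"

definition fcnt :: "'q list \<Rightarrow> nat \<Rightarrow> nat" where
  "fcnt qs n = (\<Sum>ts | ts \<in> LF qs \<and> forest_arity ts = n. forest_labelings ts)"

definition y :: "'q \<Rightarrow> rat fps" where
  "y q = Abs_fps (\<lambda>n. of_nat (cnt q n) / fact n)"

text \<open>
  Differentiation marks the least label, which belongs to the first tree of a forest.
\<close>

fun fy :: "'q list \<Rightarrow> rat fps" where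
  "fy [] = 1"
| "fy (q # qs) = fps_integral0 (fps_deriv (y q) * fy qs)"

lemma arity_pos: "t \<in> L \<Longrightarrow> arity t \<ge> 1"
proof (induction t)
  case (Node u ts)
  from Node_in_L[OF Node.prems] have *: "u \<in> \<Upsilon>" "length ts = ar u" "set ts \<subseteq> L" by auto
  with ar_pos[of u] obtain t ts' where ts: "ts = t # ts'" by (cases ts) auto
  then have "arity t \<ge> 1" using Node.IH[of t] * by auto
  then show ?case by (simp add: ts)
qed simp

lemma finite_LL: "finite {t. t \<in> LL q \<and> arity t = n}"
  by (rule finite_subset[OF _ finite_arity[of n]]) (auto simp: LL_def)

lemma LF_Cons: "{ts. ts \<in> LF (q # qs) \<and> forest_arity ts = n}
    = (\<lambda>(t, ts). t # ts) ` (\<Union>a\<le>n. {t. t \<in> LL q \<and> arity t = a} \<times>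
        {ts. ts \<in> LF qs \<and> forest_arity ts = n - a})"
  by (auto simp: LF_def list_all2_Cons2 image_iff)

lemma finite_LF: "finite {ts. ts \<in> LF qs \<and> forest_arity ts = n}"
proof (induction qs arbitrary: n)
  case Nil
  have "{ts. ts \<in> LF [] \<and> forest_arity ts = n} \<subseteq> {[]}" by (auto simp: LF_def)
  then show ?case by (rule finite_subset) simp
next
  case (Cons q qs)
  then show ?case unfolding LF_Cons by (intro finite_imageI finite_UN_I finite_cartesian_product finite_LL) auto
qed

lemma cnt_0: "cnt q 0 = 0"
  unfolding cnt_def using arity_pos by (intro sum.neutral) (force simp: LL_def)

text \<open>The sum runs over the number a of leaves of the first tree, which takes the least label
  and a - 1 of the other n - 1. The term a = 0, where the subtraction is truncated, vanishes because
  every tree of the class has a leaf.\<close>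

lemma fcnt_Cons: "fcnt (q # qs) n
    = (\<Sum>a\<le>n. (n - 1 choose (a - 1)) * cnt q a * fcnt qs (n - a))"
proof -
  let ?A = "\<lambda>a. {t. t \<in> LL q \<and> arity t = a} \<times> {ts. ts \<in> LF qs \<and> forest_arity ts = n - a}"
  have "fcnt (q # qs) n = (\<Sum>(t, ts)\<in>(\<Union>a\<le>n. ?A a). forest_labelings (t # ts))"
    unfolding fcnt_def LF_Cons by (subst sum.reindex) (auto simp: inj_on_def split_beta)
  also have "\<dots> = (\<Sum>a\<le>n. \<Sum>(t, ts)\<in>?A a. forest_labelings (t # ts))"
    by (intro sum.UNION_disjoint ballI impI finite_cartesian_product finite_LL finite_LF) auto
  also have "\<dots> = (\<Sum>a\<le>n. (n - 1 choose (a - 1)) * cnt q a * fcnt qs (n - a))"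
  proof (rule sum.cong[OF refl])
    fix a assume a: "a \<in> {..n}"
    have "(\<Sum>(t, ts)\<in>?A a. forest_labelings (t # ts))
      = (\<Sum>(t, ts)\<in>?A a. (n - 1 choose (a - 1)) * (labelings t * forest_labelings ts))"
      by (rule sum.cong) (use a in \<open>auto simp: forest_labelings_Cons\<close>)
    also have "\<dots> = (n - 1 choose (a - 1)) * (cnt q a * fcnt qs (n - a))"
      unfolding cnt_def fcnt_def sum_product sum.cartesian_product
      by (simp only: sum_distrib_left split_def)
    finally show "(\<Sum>(t, ts)\<in>?A a. forest_labelings (t # ts))
      = (n - 1 choose (a - 1)) * cnt q a * fcnt qs (n - a)" by (simp add: mult.assoc)
  qed
  finally show ?thesis .
qed

text \<open>Dividing by n! turns the convolution with n - 1 over a - 1 into the integral of a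
  product. The two shifts by one, in n and in a, are the integration and the differentiation of the
  first factor.\<close>

lemma fy_nth: "fps_nth (fy qs) n = of_nat (fcnt qs n) / fact n"
proof (induction qs arbitrary: n)
  case Nil
  have "{ts. ts \<in> LF [] \<and> forest_arity ts = n} = (if n = 0 then {[]} else {})"
    by (auto simp: LF_def)
  then show ?case by (simp add: fcnt_def)
next
  case (Cons q qs)
  show ?case
  proof (cases n)
    case 0
    then show ?thesis by (simp add: fcnt_Cons cnt_0)
  next
    case (Suc m)
    have "fcnt (q # qs) n = (\<Sum>a\<le>m. (m choose a) * cnt q (Suc a) * fcnt qs (m - a))"
      unfolding fcnt_Cons Suc by (subst sum.atMost_Suc_shift) (simp add: cnt_0)
    then have "of_nat (fcnt (q # qs) n) / fact n
      = (\<Sum>a\<le>m. of_nat (m choose a) * of_nat (cnt q (Suc a)) * of_nat (fcnt qs (m - a)) / fact n :: rat)"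
      by (simp add: sum_divide_distrib)
    also have "\<dots> = (\<Sum>a\<le>m. (of_nat (Suc a) * fps_nth (y q) (Suc a)) * fps_nth (fy qs) (m - a) / of_nat (Suc m))"
    proof (rule sum.cong[OF refl])
      fix a assume "a \<in> {..m}"
      then have "(of_nat (m choose a) :: rat) = fact m / (fact a * fact (m - a))"
        by (simp add: binomial_fact)
      moreover have "of_nat (Suc a) * fps_nth (y q) (Suc a) = of_nat (cnt q (Suc a)) / fact a"
        by (simp add: y_def del: of_nat_Suc)
      moreover have "(fact n :: rat) = of_nat (Suc m) * fact m" by (simp add: Suc)
      ultimately show "of_nat (m choose a) * of_nat (cnt q (Suc a)) * of_nat (fcnt qs (m - a)) / fact n
        = (of_nat (Suc a) * fps_nth (y q) (Suc a)) * fps_nth (fy qs) (m - a) / (of_nat (Suc m) :: rat)"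
        unfolding Cons by (simp del: of_nat_Suc fact_Suc add: mult_ac)
    qed
    also have "\<dots> = fps_nth (fy (q # qs)) n"
      unfolding Suc fy.simps fps_integral_def fps_nth_Abs_fps
      by (simp add: fps_mult_nth atLeast0AtMost sum_distrib_left divide_inverse mult.commute[of _ "inverse _"]
          del: of_nat_Suc)
    finally show ?thesis by simp
  qed
qed

text \<open>The transitions of the automaton into \<open>q\<close>. One realizing forest is
  demanded, but by \<open>Tr_Node\<close> every forest with these states then realizes the
  transition.\<close>

definition Tr :: "'q \<Rightarrow> ('u \<times> 'q list) set" where
  "Tr q = {(u, qs). \<exists>ts\<in>LF qs. Node u ts \<in> LL q}"

lemma Tr_subset: "Tr q \<subseteq> (SIGMA u:\<Upsilon>. {qs. set qs \<subseteq> st ` L \<and> length qs = ar u})"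
proof safe
  fix u qs assume "(u, qs) \<in> Tr q"
  then obtain ts where ts: "list_all2 (\<lambda>t q. t \<in> LL q) ts qs" "Node u ts \<in> L"
    by (auto simp: Tr_def LF_def LL_def)
  from Node_in_L[OF ts(2)] have *: "u \<in> \<Upsilon>" "length ts = ar u" by auto
  then show "u \<in> \<Upsilon>" by simp
  show "length qs = ar u" using * list_all2_lengthD[OF ts(1)] by simp
  fix x assume "x \<in> set qs"
  then obtain i where "i < length qs" "x = qs ! i" by (auto simp: in_set_conv_nth)
  then have "ts ! i \<in> LL x" using ts(1) by (simp add: list_all2_conv_all_nth)
  then show "x \<in> st ` L" by (auto simp: LL_def)
qed

lemma finite_Tr: "finite (Tr q)"
  by (rule finite_subset[OF Tr_subset])
    (intro finite_SigmaI finite_ops finite_lists_length_eq finite_states)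

lemma Tr_Node: "(u, qs) \<in> Tr q \<Longrightarrow> ts \<in> LF qs \<Longrightarrow> Node u ts \<in> LL q"
proof -
  assume "(u, qs) \<in> Tr q" "ts \<in> LF qs"
  then obtain ts0 where ts0: "ts0 \<in> LF qs" "Node u ts0 \<in> LL q" by (auto simp: Tr_def)
  have st: "map st ts = qs \<and> set ts \<subseteq> L" if "ts \<in> LF qs" for ts
  proof -
    from that have "list_all2 (\<lambda>t q. t \<in> LL q) ts qs" by (simp add: LF_def)
    then show ?thesis by induction (auto simp: LL_def)
  qed
  show ?thesis
    using state_cong[of u ts0 ts] ts0 st[OF ts0(1)] st[OF \<open>ts \<in> LF qs\<close>] by (auto simp: LL_def)
qed

text \<open>Decomposition at the root. The transitions classify the trees without overlap, because a
  forest determines the states of its members.\<close>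

lemma y_eq: "y q = (if Leaf () \<in> LL q then fps_X else 0) + (\<Sum>(u, qs)\<in>Tr q. fy qs)"
proof (rule fps_ext)
  fix n :: nat
  let ?lf = "{t :: ('u, unit) ptree. t = Leaf () \<and> Leaf () \<in> LL q \<and> n = 1}"
  let ?N = "\<lambda>(u, qs). Node u ` {ts. ts \<in> LF qs \<and> forest_arity ts = n}"
  have LFst: "qs = map st ts" if "ts \<in> LF qs" for qs ts
  proof -
    from that have "list_all2 (\<lambda>t q. t \<in> LL q) ts qs" by (simp add: LF_def)
    then show ?thesis by induction (auto simp: LL_def)
  qed
  have split: "{t. t \<in> LL q \<and> arity t = n} = ?lf \<union> (\<Union>x\<in>Tr q. ?N x)"
  proof (intro Set.equalityI Set.subsetI)
    fix t assume "t \<in> {t. t \<in> LL q \<and> arity t = n}"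
    then have t: "t \<in> LL q" "arity t = n" by auto
    show "t \<in> ?lf \<union> (\<Union>x\<in>Tr q. ?N x)"
    proof (cases t)
      case (Leaf l)
      then show ?thesis using t by auto
    next
      case (Node u ts)
      then have "set ts \<subseteq> L" using Node_in_L[of u ts] t by (auto simp: LL_def)
      then have ts: "ts \<in> LF (map st ts)"
        by (auto simp: LF_def LL_def list_all2_conv_all_nth)
      then have "(u, map st ts) \<in> Tr q" using Node t by (auto simp: Tr_def)
      moreover have "t \<in> ?N (u, map st ts)"
        using Node t ts arity_Node[of u ts] by auto
      ultimately show ?thesis by blast
    qed
  next
    fix t assume "t \<in> ?lf \<union> (\<Union>x\<in>Tr q. ?N x)"
    then show "t \<in> {t. t \<in> LL q \<and> arity t = n}"
      using Tr_Node arity_Node by auto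
  qed
  have "finite ?lf" by (rule finite_subset[of _ "{Leaf ()}"]) auto
  moreover have "finite (\<Union>x\<in>Tr q. ?N x)"
    by (intro finite_UN_I finite_Tr) (auto intro: finite_LF)
  moreover have "?lf \<inter> (\<Union>x\<in>Tr q. ?N x) = {}" by auto
  ultimately have "cnt q n = sum labelings ?lf + sum labelings (\<Union>x\<in>Tr q. ?N x)"
    unfolding cnt_def split by (rule sum.union_disjoint)
  also have "sum labelings (\<Union>x\<in>Tr q. ?N x) = (\<Sum>x\<in>Tr q. sum labelings (?N x))"
    by (rule sum.UNION_disjoint) (auto intro!: finite_Tr finite_LF dest: LFst)
  also have "\<dots> = (\<Sum>(u, qs)\<in>Tr q. fcnt qs n)"
    by (rule sum.cong) (auto simp: fcnt_def sum.reindex inj_on_def labelings_Node simp del: labelings.simps)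
  also have "sum labelings ?lf = (if Leaf () \<in> LL q \<and> n = 1 then 1 else 0)"
    by auto
  finally have "of_nat (cnt q n) / fact n = (if Leaf () \<in> LL q \<and> n = 1 then 1 else 0)
      + (\<Sum>(u, qs)\<in>Tr q. of_nat (fcnt qs n) / fact n :: rat)"
    by (auto simp: sum_divide_distrib add_divide_distrib split_beta)
  then show "fps_nth (y q) n = fps_nth ((if Leaf () \<in> LL q then fps_X else 0) + (\<Sum>(u, qs)\<in>Tr q. fy qs)) n"
    by (auto simp: y_def fps_sum_nth split_beta fy_nth)
qed


section \<open>The recurrence order and contexts that multiply labelings\<close>

text \<open>The added arity \<open>c\<close> must not depend on the tree, so that iterating a
  context produces arities in an arithmetic progression.\<close>

definition leq :: "'q \<Rightarrow> 'q \<Rightarrow> bool" where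
  "leq q q' \<longleftrightarrow> (\<exists>c. \<forall>t\<in>LL q. \<exists>t'\<in>LL q'. arity t' = arity t + c \<and> labelings t \<le> labelings t')"

text \<open>The bound on \<open>c\<close> makes the arity, and with it the factor gained, increase
  from round to round.\<close>

definition grows :: "'q \<Rightarrow> 'q \<Rightarrow> bool" where
  "grows q q' \<longleftrightarrow> (\<exists>c\<ge>1. \<forall>t\<in>LL q. \<exists>t'\<in>LL q'. arity t' = arity t + c \<and>
    arity t * labelings t \<le> labelings t')"

lemma leq_trans: "leq q q' \<Longrightarrow> leq q' q'' \<Longrightarrow> leq q q''"
  unfolding leq_def
proof clarify
  fix c c' assume *: "\<forall>t\<in>LL q. \<exists>t'\<in>LL q'. arity t' = arity t + c \<and> labelings t \<le> labelings t'"
    "\<forall>t\<in>LL q'. \<exists>t'\<in>LL q''. arity t' = arity t + c' \<and> labelings t \<le> labelings t'"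
  show "\<exists>c. \<forall>t\<in>LL q. \<exists>t'\<in>LL q''. arity t' = arity t + c \<and> labelings t \<le> labelings t'"
  proof (intro exI[of _ "c + c'"] ballI)
    fix t assume "t \<in> LL q"
    with * obtain t' where "t' \<in> LL q'" "arity t' = arity t + c" "labelings t \<le> labelings t'" by blast
    moreover with * obtain t'' where "t'' \<in> LL q''" "arity t'' = arity t' + c'" "labelings t' \<le> labelings t''"
      by blast
    ultimately show "\<exists>t'\<in>LL q''. arity t' = arity t + (c + c') \<and> labelings t \<le> labelings t'"
      by (intro bexI[of _ t'']) auto
  qed
qed

lemma grows_leq_trans: "grows q q' \<Longrightarrow> leq q' q'' \<Longrightarrow> grows q q''"
  unfolding leq_def grows_def
proof clarify
  fix c c' :: nat
  assume *: "\<forall>t\<in>LL q. \<exists>t'\<in>LL q'. arity t' = arity t + c \<and> arity t * labelings t \<le> labelings t'"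
    "\<forall>t\<in>LL q'. \<exists>t'\<in>LL q''. arity t' = arity t + c' \<and> labelings t \<le> labelings t'" and c: "1 \<le> c"
  show "\<exists>c\<ge>1. \<forall>t\<in>LL q. \<exists>t'\<in>LL q''. arity t' = arity t + c \<and> arity t * labelings t \<le> labelings t'"
  proof (intro exI[of _ "c + c'"] ballI conjI)
    fix t assume "t \<in> LL q"
    with * obtain t' where "t' \<in> LL q'" "arity t' = arity t + c" "arity t * labelings t \<le> labelings t'"
      by blast
    moreover with * obtain t'' where "t'' \<in> LL q''" "arity t'' = arity t' + c'" "labelings t' \<le> labelings t''"
      by blast
    ultimately show "\<exists>t'\<in>LL q''. arity t' = arity t + (c + c') \<and> arity t * labelings t \<le> labelings t'"
      by (intro bexI[of _ t'']) auto
  qed (use c in auto)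
qed

lemma LF_append: "LF (ps @ qs) = {ls @ ts | ls ts. ls \<in> LF ps \<and> ts \<in> LF qs}"
  by (rule set_eqI) (simp add: LF_def list_all2_append2, blast dest: list_all2_lengthD)

lemma LF_Cons_iff: "ts \<in> LF (q # qs) \<longleftrightarrow> (\<exists>t ts'. ts = t # ts' \<and> t \<in> LL q \<and> ts' \<in> LF qs)"
  by (auto simp: LF_def list_all2_Cons2)

lemma Tr_siblings:
  assumes "(u, ps @ q # rs) \<in> Tr q'"
  obtains ls ss where "ls \<in> LF ps" "ss \<in> LF rs"
proof -
  obtain ts where "ts \<in> LF (ps @ q # rs)" using assms by (auto simp: Tr_def)
  then show ?thesis using that unfolding LF_append LF_Cons_iff by blast
qed

lemma Tr_Node_append:
  assumes "(u, ps @ q # rs) \<in> Tr q'" "ls \<in> LF ps" "ss \<in> LF rs" "t \<in> LL q"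
  shows "Node u (ls @ t # ss) \<in> LL q'"
  by (rule Tr_Node[OF assms(1)]) (use assms(2-) in \<open>auto simp: LF_append LF_Cons_iff\<close>)

lemma LL_arity_pos: "t \<in> LL q \<Longrightarrow> arity t \<ge> 1"
  using arity_pos by (auto simp: LL_def)

text \<open>One fixed choice of siblings realizing the transition serves for all trees
  \<open>t\<close>; this makes the added arity uniform.\<close>

lemma Tr_leq:
  assumes "(u, qs) \<in> Tr q'" "q \<in> set qs"
  shows "leq q q'"
proof -
  obtain ps rs where qs: "qs = ps @ q # rs" using assms(2) by (meson split_list)
  obtain ls ss where ls: "ls \<in> LF ps" "ss \<in> LF rs" using Tr_siblings assms(1) qs by blast
  show ?thesis unfolding leq_def
  proof (intro exI[of _ "forest_arity ls + forest_arity ss"] ballI)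
    fix t assume t: "t \<in> LL q"
    show "\<exists>t'\<in>LL q'. arity t' = arity t + (forest_arity ls + forest_arity ss) \<and> labelings t \<le> labelings t'"
    proof (rule bexI)
      show "Node u (ls @ t # ss) \<in> LL q'" using Tr_Node_append assms(1) qs ls t by blast
      show "arity (Node u (ls @ t # ss)) = arity t + (forest_arity ls + forest_arity ss) \<and>
          labelings t \<le> labelings (Node u (ls @ t # ss))"
        unfolding arity_Node labelings_Node using forest_labelings_mem[of t ls ss] by simp
    qed
  qed
qed

lemma Tr_grows_right:
  assumes "(u, ps @ q # r # rs) \<in> Tr q'"
  shows "grows q q'"
proof -
  obtain ls ss where ls: "ls \<in> LF ps" "ss \<in> LF (r # rs)" using Tr_siblings assms by blast
  have ss: "forest_arity ss \<ge> 1" using ls(2) LL_arity_pos by (force simp: LF_Cons_iff)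
  show ?thesis unfolding grows_def
  proof (intro exI[of _ "forest_arity ls + forest_arity ss"] ballI conjI)
    fix t assume t: "t \<in> LL q"
    show "\<exists>t'\<in>LL q'. arity t' = arity t + (forest_arity ls + forest_arity ss) \<and>
        arity t * labelings t \<le> labelings t'"
    proof (rule bexI)
      show "Node u (ls @ t # ss) \<in> LL q'" using Tr_Node_append assms(1) ls t by blast
      show "arity (Node u (ls @ t # ss)) = arity t + (forest_arity ls + forest_arity ss) \<and>
          arity t * labelings t \<le> labelings (Node u (ls @ t # ss))"
        unfolding arity_Node labelings_Node
        using forest_labelings_right_sibling[OF LL_arity_pos[OF t] ss] by simp
    qed
  qed (use ss in simp)
qed

lemma Tr_grows_left:
  assumes "(u, ps @ [q]) \<in> Tr q'" "p \<in> set ps" "x \<in> LL p" "arity x \<noteq> 1"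
  shows "grows q q'"
proof -
  obtain p1 p2 where ps: "ps = p1 @ p # p2" using assms(2) by (meson split_list)
  obtain l1 l2 where l: "l1 \<in> LF p1" "l2 \<in> LF (p2 @ [q])"
    using Tr_siblings[of u p1 p "p2 @ [q]"] assms(1) ps by auto
  then obtain l2' where "l2' \<in> LF p2" by (auto simp: LF_append)
  define ls where "ls = l1 @ x # l2'"
  have ls: "ls \<in> LF ps" using l(1) \<open>l2' \<in> LF p2\<close> assms(3)
    by (auto simp: ls_def ps LF_append LF_Cons_iff)
  have x: "arity x \<ge> 2" using assms(3,4) LL_arity_pos[of x p] by linarith
  show ?thesis unfolding grows_def
  proof (intro exI[of _ "forest_arity ls"] ballI conjI)
    fix t assume t: "t \<in> LL q"
    show "\<exists>t'\<in>LL q'. arity t' = arity t + forest_arity ls \<and> arity t * labelings t \<le> labelings t'"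
    proof (rule bexI)
      show "Node u (ls @ [t]) \<in> LL q'"
        using Tr_Node_append[OF assms(1) ls _ t, of "[]"] by (simp add: LF_def)
      show "arity (Node u (ls @ [t])) = arity t + forest_arity ls \<and>
          arity t * labelings t \<le> labelings (Node u (ls @ [t]))"
        unfolding arity_Node labelings_Node
        using forest_labelings_left_sibling[of x ls t] LL_arity_pos[OF t] x by (simp add: ls_def)
    qed
  qed (use x in \<open>simp add: ls_def\<close>)
qed

lemma not_grows_self:
  assumes "LL q \<noteq> {}"
  shows "\<not> grows q q"
proof
  assume "grows q q"
  then obtain c where c: "c \<ge> 1" "\<And>t. t \<in> LL q \<Longrightarrow> \<exists>t'\<in>LL q. arity t' = arity t + c \<and>
    arity t * labelings t \<le> labelings t'" unfolding grows_def by blast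
  obtain t0 where t0: "t0 \<in> LL q" using assms by blast
  define m where "m = arity t0"
  have m: "m \<ge> 1" using LL_arity_pos[OF t0] by (simp add: m_def)
  have ex: "\<exists>t\<in>LL q. arity t = m + i * c \<and> fact i \<le> labelings t" for i
  proof (induction i)
    case 0
    then show ?case using t0 labelings_pos by (intro bexI[of _ t0]) (auto simp: m_def)
  next
    case (Suc i)
    then obtain t where t: "t \<in> LL q" "arity t = m + i * c" "fact i \<le> labelings t" by blast
    then obtain t' where t': "t' \<in> LL q" "arity t' = arity t + c" "arity t * labelings t \<le> labelings t'"
      using c(2) by blast
    \<comment> \<open>After i rounds the arity has reached i + 1, so the next round contributes the
      next factor of the factorial.\<close>
    have "i * 1 \<le> i * c" using c(1) by (rule mult_le_mono2)
    then have "Suc i \<le> arity t" using m t(2) by linarith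
    then have "Suc i * fact i \<le> arity t * labelings t" using t(3) by (rule mult_le_mono)
    then show ?case using t t' by (intro bexI[of _ t']) auto
  qed
  define a where "a n = (\<Sum>t | t \<in> L \<and> arity t = n. labelings t)" for n
  have a: "fact i \<le> a (m + i * c)" for i
  proof -
    obtain t where t: "t \<in> LL q" "arity t = m + i * c" "fact i \<le> labelings t" using ex by blast
    have "labelings t \<le> a (m + i * c)"
      unfolding a_def using t finite_arity by (intro member_le_sum) (auto simp: LL_def)
    with t show ?thesis by simp
  qed
  \<comment> \<open>The constants A = 1 and B = 4 * c are those for which
    \<open>power_over_exp_dominates\<close> beats the resulting bound at n = m + i * c.\<close>
  obtain K where K: "K > 0" "\<forall>\<^sub>F n in sequentially. real (a n) < K * (real n / 1) powr (real n / (4 * real c))"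
    using subfactorial[unfolded subfactorial_growth_def, rule_format, of 1 "4 * real c"] c(1)
    unfolding a_def[symmetric] by auto
  have "filterlim (\<lambda>i. m + i * c) at_top sequentially"
  proof (intro filterlim_at_top_mono[OF filterlim_ident] always_eventually allI)
    show "i \<le> m + i * c" for i using trans_le_add2[OF mult_le_mono2[OF c(1), of i], of m] by (simp only: mult_1_right)
  qed
  from eventually_compose_filterlim[OF K(2) this]
  have "\<forall>\<^sub>F i in sequentially. real (a (m + i * c))
      < K * (real (m + i * c) / 1) powr (real (m + i * c) / (4 * real c))" .
  moreover have "\<forall>\<^sub>F i in sequentially.
      K * (real m + real i * real c) powr ((real m + real i * real c) / (4 * real c)) < real i ^ i / exp (real i)"
    using c(1) K(1) m by (intro power_over_exp_dominates) auto
  ultimately have "\<forall>\<^sub>F i :: nat in sequentially. False"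
  proof eventually_elim
    case (elim i)
    \<comment> \<open>The number i ^ i / i! is a single term of the exponential series at i.\<close>
    have "real i ^ i / exp (real i) \<le> fact i"
    proof -
      have "(real i) ^ i /\<^sub>R fact i \<le> suminf (\<lambda>n. real i ^ n /\<^sub>R fact n)"
        using sum_le_suminf[OF summable_exp_generic[of "real i"], of "{i}"] by simp
      then have "(real i) ^ i / fact i \<le> exp (real i)" by (simp add: exp_def divide_inverse mult.commute)
      then show ?thesis by (simp add: divide_le_eq mult.commute)
    qed
    also have "\<dots> \<le> real (a (m + i * c))" using a[of i] by (metis of_nat_fact of_nat_le_iff)
    finally show False using elim by simp
  qed
  then show False by simp
qed


text \<open>
  A recurrence that grows would yield trees of arity \<open>m + i c\<close> with at least \<open>i!\<close> labelings. Hence,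
  between states equivalent under \<open>leq\<close>, only the last child can recur, and all its left siblings
  have a single leaf.
\<close>

definition U :: "('q \<times> 'q) set" where
  "U = {(q, q'). \<exists>u. (u, [q]) \<in> Tr q'}"

lemma LL_nonempty: "q \<in> st ` L \<longleftrightarrow> LL q \<noteq> {}"
  by (auto simp: LL_def)

lemma Tr_states:
  assumes "(u, qs) \<in> Tr q"
  shows "q \<in> st ` L" "set qs \<subseteq> st ` L" "u \<in> \<Upsilon>" "length qs = ar u"
  using Tr_subset[of q] assms by (auto simp: Tr_def LL_def)

text \<open>
  A cycle of unary steps would produce infinitely many trees of the same arity.
\<close>

lemma wf_U: "wf U"
proof (rule finite_acyclic_wf)
  have "U \<subseteq> st ` L \<times> st ` L" using Tr_states by (fastforce simp: U_def)
  then show "finite U" using finite_states finite_subset by blast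
  have up: "\<exists>t'\<in>LL q'. arity t' = arity t \<and> size t < size t'"
    if "(q, q') \<in> U\<^sup>+" "t \<in> LL q" for q q' t
    using that
  proof (induction arbitrary: t rule: trancl_induct)
    case (base q')
    then obtain u where u: "(u, [q]) \<in> Tr q'" by (auto simp: U_def)
    then have "Node u [t] \<in> LL q'" using base(2) by (intro Tr_Node[OF u]) (auto simp: LF_def)
    then show ?case by (intro bexI[of _ "Node u [t]"]) auto
  next
    case (step q' q'')
    then obtain t' where t': "t' \<in> LL q'" "arity t' = arity t" "size t < size t'" by blast
    from step obtain u where u: "(u, [q']) \<in> Tr q''" by (auto simp: U_def)
    then have "Node u [t'] \<in> LL q''" using t' by (intro Tr_Node[OF u]) (auto simp: LF_def)
    then show ?case using t' by (intro bexI[of _ "Node u [t']"]) auto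
  qed
  show "acyclic U"
  proof (rule acyclicI, safe)
    fix q assume q: "(q, q) \<in> U\<^sup>+"
    then obtain q' where "(q', q) \<in> U" by (metis tranclD2)
    then obtain u where "(u, [q']) \<in> Tr q" by (auto simp: U_def)
    then have "LL q \<noteq> {}" using Tr_states(1) LL_nonempty by blast
    then obtain t0 where t0: "t0 \<in> LL q" by blast
    let ?S = "{t. t \<in> LL q \<and> arity t = arity t0}"
    have "Max (size ` ?S) \<in> size ` ?S" using t0 finite_LL by (intro Max_in) auto
    then obtain t where t: "t \<in> ?S" "size t = Max (size ` ?S)" by auto
    obtain t' where "t' \<in> LL q" "arity t' = arity t" "size t < size t'" using up[OF q] t(1) by blast
    then have "t' \<in> ?S" "size t < size t'" using t by auto
    then have "size t' \<le> Max (size ` ?S)" using finite_LL by (intro Max_ge) auto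
    then show False using \<open>size t < size t'\<close> t(2) by simp
  qed
qed

lemma y_single:
  assumes "\<And>t. t \<in> LL q \<Longrightarrow> arity t = 1"
  shows "y q = fps_const (of_nat (cnt q 1)) * fps_X"
proof (rule fps_ext)
  fix n
  have "cnt q n = 0" if "n \<noteq> 1"
  proof -
    have "{t. t \<in> LL q \<and> arity t = n} = {}" using assms that by auto
    then show ?thesis unfolding cnt_def by (simp only: sum.empty)
  qed
  then show "fps_nth (y q) n = fps_nth (fps_const (of_nat (cnt q 1)) * fps_X) n"
    by (cases "n = 1") (auto simp: y_def fps_X_def)
qed

lemma fps_integral0_const_mult:
  "fps_integral0 (fps_const c * f) = fps_const c * fps_integral0 (f :: rat fps)"
  by (rule fps_ext) (simp add: fps_integral_def mult_ac)

text \<open>The series of a sibling state with single leaves only is a multiple of X, so its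
  derivative is a scalar: each left sibling costs one integration and no product. The innermost
  integral restores \<open>y q\<close>, which has no constant term.\<close>

lemma fy_linear:
  assumes "\<And>p t. p \<in> set ps \<Longrightarrow> t \<in> LL p \<Longrightarrow> arity t = 1"
  shows "\<exists>c. fy (ps @ [q]) = fps_const c * (fps_integral0 ^^ length ps) (y q)"
  using assms
proof (induction ps)
  case Nil
  have "fps_integral0 (fps_deriv (y q)) = y q"
  proof (rule fps_ext)
    show "fps_nth (fps_integral0 (fps_deriv (y q))) n = fps_nth (y q) n" for n
      by (cases n) (auto simp: fps_integral_def y_def cnt_0 simp del: of_nat_Suc fact_Suc)
  qed
  then show ?case by (intro exI[of _ 1]) simp
next
  case (Cons p ps)
  then obtain c where c: "fy (ps @ [q]) = fps_const c * (fps_integral0 ^^ length ps) (y q)" by auto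
  have "y p = fps_const (of_nat (cnt p 1)) * fps_X" using Cons.prems by (intro y_single) auto
  then have "fps_deriv (y p) = fps_const (of_nat (cnt p 1))" by simp
  then have "fy ((p # ps) @ [q]) = fps_const (of_nat (cnt p 1) * c) * fps_integral0 ((fps_integral0 ^^ length ps) (y q))"
    using c by (simp add: mult.assoc[symmetric]) (simp only: fps_integral0_const_mult)
  then show ?case by auto
qed

lemma deriv_finite_fy: "(\<And>q. q \<in> set qs \<Longrightarrow> deriv_finite (y q)) \<Longrightarrow> deriv_finite (fy qs)"
proof (induction qs)
  case Nil
  then show ?case by (simp add: deriv_finite_1)
next
  case (Cons q qs)
  then show ?case by (simp add: deriv_finite_integral deriv_finite_mult deriv_finite_deriv)
qed

section \<open>Induction along the recurrence order\<close>

definition below :: "('q \<times> 'q) set" where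
  "below = {(q', q). q' \<in> st ` L \<and> q \<in> st ` L \<and> leq q' q \<and> \<not> leq q q'}"

lemma wf_below: "wf below"
proof (rule finite_acyclic_wf)
  have "below \<subseteq> st ` L \<times> st ` L" by (auto simp: below_def)
  then show "finite below" using finite_states finite_subset by blast
  have "trans below" unfolding trans_def below_def using leq_trans by blast
  then show "acyclic below" by (auto simp: acyclic_def trancl_id below_def)
qed

text \<open>All states of the recurrence class \<open>K\<close> of \<open>q\<close> are treated
  together. Transitions that avoid \<open>K\<close> have children strictly below \<open>q\<close>
  and form the inhomogeneous part \<open>g\<close>; those that meet \<open>K\<close> form
  \<open>h\<close>, where the growth restriction leaves only linear terms.\<close>

lemma deriv_finite_y: "q \<in> st ` L \<Longrightarrow> deriv_finite (y q)"
proof (induction q rule: wf_induct_rule[OF wf_below])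
  case (1 q)
  define K where "K = {q' \<in> st ` L. leq q q' \<and> leq q' q}"
  have "leq q q" unfolding leq_def by (intro exI[of _ 0]) auto
  then have "q \<in> K" using "1.prems" by (simp add: K_def)
  define R where "R q' = {(u, qs) \<in> Tr q'. set qs \<inter> K \<noteq> {}}" for q'
  define h where "h q' = (\<Sum>(u, qs)\<in>R q'. fy qs)" for q'
  define g where "g q' = (if Leaf () \<in> LL q' then fps_X else 0) + (\<Sum>(u, qs)\<in>Tr q' - R q'. fy qs)" for q'
  \<comment> \<open>A crude bound for every arity: a node has fewer left siblings, hence fewer
    iterated integrals, than its arity.\<close>
  define J where "J = Suc (\<Sum>u\<in>\<Upsilon>. ar u)"
  have Rsub: "R q' \<subseteq> Tr q'" for q' by (auto simp: R_def)
  show ?case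
  proof (rule deriv_finite_linear_system[of K U J y g h])
    show "finite K" using finite_states by (simp add: K_def)
    show "wf U" by (rule wf_U)
    show "J > 0" by (simp add: J_def)
    show "y q' = g q' + h q'" for q'
      unfolding y_eq[of q'] g_def h_def
      using sum.subset_diff[OF Rsub finite_Tr, of "\<lambda>(u, qs). fy qs" q'] by simp
    show "deriv_finite (g q')" if q': "q' \<in> K" for q'
      unfolding g_def
    proof (intro deriv_finite_add deriv_finite_sum)
      show "deriv_finite (if Leaf () \<in> LL q' then fps_X else 0 :: rat fps)"
        by (simp add: deriv_finite_0 deriv_finite_X)
      fix x assume "x \<in> Tr q' - R q'"
      then obtain u qs where x: "x = (u, qs)" "(u, qs) \<in> Tr q'" "set qs \<inter> K = {}"
        by (cases x) (auto simp: R_def)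
      have "deriv_finite (fy qs)"
      proof (rule deriv_finite_fy)
        fix p assume p: "p \<in> set qs"
        then have "p \<in> st ` L" "p \<notin> K" using Tr_states(2)[OF x(2)] x(3) by auto
        moreover have "leq p q"
          using Tr_leq[OF x(2) p] q' leq_trans by (auto simp: K_def)
        ultimately have "(p, q) \<in> below" using "1.prems" by (auto simp: below_def K_def)
        then show "deriv_finite (y p)" using "1.IH" \<open>p \<in> st ` L\<close> by blast
      qed
      then show "deriv_finite (case x of (u, qs) \<Rightarrow> fy qs)" by (simp add: x)
    qed
    show "fps_deriv (h q') \<in> fps_vs.span ((\<lambda>(q', j). (fps_integral0 ^^ j) (y q')) ` (K \<times> {..<J})
        \<union> {fps_deriv (y p) |p. p \<in> K \<and> (p, q') \<in> U})" (is "_ \<in> fps_vs.span ?B") if q': "q' \<in> K" for q'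
    proof -
      have "fps_deriv (fy qs) \<in> fps_vs.span ?B" if "(u, qs) \<in> R q'" for u qs
      proof -
        from that have Tr: "(u, qs) \<in> Tr q'" by (simp add: R_def)
        from that obtain p where p: "p \<in> set qs" "p \<in> K" by (auto simp: R_def)
        then obtain ps rs where qs: "qs = ps @ p # rs" by (meson split_list)
        \<comment> \<open>A gain on the way from \<open>p\<close> to \<open>q'\<close> becomes a
          gain from \<open>p\<close> to itself, since \<open>q'\<close> leads back to
          \<open>p\<close> within the class.\<close>
        have ng: "\<not> grows p q'"
        proof
          assume "grows p q'"
          moreover have "leq q' p" using q' p leq_trans by (auto simp: K_def)
          ultimately have "grows p p" by (rule grows_leq_trans)
          with not_grows_self p show False by (auto simp: K_def LL_nonempty)
        qed
        have "rs = []" using Tr_grows_right[of u ps p] Tr qs ng by (cases rs) auto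
        then have qs: "qs = ps @ [p]" using qs by simp
        have "arity t = 1" if "p' \<in> set ps" "t \<in> LL p'" for p' t
          using Tr_grows_left[of u ps p q' p' t] that Tr qs ng by auto
        then obtain c where c: "fy qs = fps_const c * (fps_integral0 ^^ length ps) (y p)"
          using fy_linear[of ps p] unfolding qs by blast
        \<comment> \<open>Differentiation removes one integral. With no left sibling there is none
          to remove, but then the node is unary and the transition is recorded in
          \<open>U\<close>.\<close>
        have "fps_deriv ((fps_integral0 ^^ length ps) (y p)) \<in> ?B"
        proof (cases ps)
          case Nil
          then have "(p, q') \<in> U" using Tr qs by (auto simp: U_def)
          then show ?thesis using Nil p(2) by auto
        next
          case (Cons a ps')
          have "length ps' < J"
          proof -
            have "length ps' < ar u" using Tr_states(4)[OF Tr] qs Cons by simp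
            also have "ar u \<le> (\<Sum>u\<in>\<Upsilon>. ar u)"
              using Tr_states(3)[OF Tr] finite_ops by (intro member_le_sum) auto
            finally show ?thesis by (simp add: J_def)
          qed
          then show ?thesis
            using Cons p(2) by (auto simp: fps_deriv_fps_integral intro!: image_eqI[of _ _ "(p, length ps')"])
        qed
        then have "fps_const c * fps_deriv ((fps_integral0 ^^ length ps) (y p)) \<in> fps_vs.span ?B"
          by (intro fps_vs.span_scale fps_vs.span_base)
        then show ?thesis by (simp add: c)
      qed
      then show ?thesis
        unfolding h_def fps_deriv_sum by (intro fps_vs.span_sum) (auto simp: split_beta)
    qed
    show "q \<in> K" by fact
  qed
qed

theorem deriv_finite_total:
  "deriv_finite (Abs_fps (\<lambda>n. of_nat (\<Sum>t | t \<in> L \<and> arity t = n. labelings t) / fact n) :: rat fps)"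
proof -
  have "(\<Sum>t | t \<in> L \<and> arity t = n. labelings t) = (\<Sum>q\<in>st ` L. cnt q n)" for n
  proof -
    have "{t. t \<in> L \<and> arity t = n} = (\<Union>q\<in>st ` L. {t. t \<in> LL q \<and> arity t = n})"
      by (auto simp: LL_def)
    then show ?thesis
      unfolding cnt_def
      by (simp only:) (rule sum.UNION_disjoint[OF finite_states], use finite_LL in blast, auto simp: LL_def)
  qed
  then have "Abs_fps (\<lambda>n. of_nat (\<Sum>t | t \<in> L \<and> arity t = n. labelings t) / fact n)
      = (\<Sum>q\<in>st ` L. y q)"
    by (intro fps_ext) (simp add: fps_sum_nth y_def sum_divide_distrib)
  then show ?thesis using deriv_finite_y by (simp add: deriv_finite_sum)
qed

end

section \<open>Skeletons and pattern avoidance\<close>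

lemma set_leaf_list: "set (leaf_list t) = leaves t"
  by (induction t) auto

lemma finite_leaves [simp]: "finite (leaves t)"
  by (simp flip: set_leaf_list)

lemma arity_skeleton [simp]: "arity (skeleton t) = arity t"
proof (induction t)
  case (Node u ts)
  then show ?case by (simp add: skeleton_def length_concat comp_def cong: map_cong)
qed (simp add: skeleton_def)

lemma skeleton_simps [simp]:
  "skeleton (Leaf l) = Leaf ()" "skeleton (Node u ts) = Node u (map skeleton ts)"
  by (auto simp: skeleton_def)

lemma card_leaves: "distinct (leaf_list t) \<Longrightarrow> card (leaves t) = arity t"
  by (metis distinct_card set_leaf_list)

fun wf_skeleton :: "'u set \<Rightarrow> ('u \<Rightarrow> nat) \<Rightarrow> ('u, 'l) ptree \<Rightarrow> bool" where
  "wf_skeleton \<Upsilon> ar (Leaf l) \<longleftrightarrow> True"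
| "wf_skeleton \<Upsilon> ar (Node u ts) \<longleftrightarrow> u \<in> \<Upsilon> \<and> length ts = ar u \<and> (\<forall>t\<in>set ts. wf_skeleton \<Upsilon> ar t)"

lemma wf_skeleton_skeleton: "shuffle_tree \<Upsilon> ar t \<Longrightarrow> wf_skeleton \<Upsilon> ar (skeleton t)"
  by (induction t) auto

locale operations =
  fixes \<Upsilon> :: "'u set" and ar :: "'u \<Rightarrow> nat"
  assumes ar_ge_1: "u \<in> \<Upsilon> \<Longrightarrow> ar u \<ge> 1"
begin

lemma wf_skeleton_arity_pos: "wf_skeleton \<Upsilon> ar t \<Longrightarrow> arity t \<ge> 1"
proof (induction t)
  case (Node u ts)
  with ar_ge_1[of u] obtain t ts' where ts: "ts = t # ts'" by (cases ts) auto
  then have "arity t \<ge> 1" using Node by auto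
  then show ?case by (simp add: ts)
qed simp

lemma leaves_nonempty: "shuffle_tree \<Upsilon> ar t \<Longrightarrow> leaves t \<noteq> {}"
  using wf_skeleton_arity_pos[OF wf_skeleton_skeleton, of t]
  by (auto simp flip: set_leaf_list)

lemma min_leaf_in: "shuffle_tree \<Upsilon> ar t \<Longrightarrow> min_leaf t \<in> leaves t"
  unfolding min_leaf_def by (rule Min_in) (auto dest: leaves_nonempty)

section \<open>Counting the labelings of a fixed skeleton\<close>

definition labeled :: "('u, unit) ptree \<Rightarrow> nat set \<Rightarrow> ('u, nat) ptree set" where
  "labeled s S = {t \<in> shuffle_monomials \<Upsilon> ar S. skeleton t = s}"

definition labeled_forests :: "('u, unit) ptree list \<Rightarrow> nat set \<Rightarrow> ('u, nat) ptree list set" where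
  "labeled_forests ss S = {ts. map skeleton ts = ss \<and> (\<forall>t\<in>set ts. shuffle_tree \<Upsilon> ar t) \<and>
    distinct (concat (map leaf_list ts)) \<and> (\<Union>t\<in>set ts. leaves t) = S \<and>
    sorted_wrt (<) (map min_leaf ts)}"

lemma labeled_Node:
  assumes "u \<in> \<Upsilon>" "length ss = ar u"
  shows "labeled (Node u ss) S = Node u ` labeled_forests ss S"
proof (intro equalityI subsetI)
  fix t assume "t \<in> labeled (Node u ss) S"
  then show "t \<in> Node u ` labeled_forests ss S"
    by (cases t) (auto simp: labeled_def labeled_forests_def shuffle_monomials_def)
qed (use assms in \<open>auto simp: labeled_def labeled_forests_def shuffle_monomials_def\<close>)

lemma labeled_Leaf: "labeled (Leaf ()) {x} = {Leaf x}"
proof (intro equalityI subsetI)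
  fix t assume "t \<in> labeled (Leaf ()) {x}"
  then show "t \<in> {Leaf x}"
    by (cases t) (auto simp: labeled_def shuffle_monomials_def)
qed (auto simp: labeled_def shuffle_monomials_def)

text \<open>Increasing minima mean that the first tree contains the least label of \<open>S\<close>
  and that the remaining forest has increasing minima; nothing else relates the two.\<close>

lemma labeled_forests_Cons:
  assumes S: "finite S"
  shows "labeled_forests (s # ss) S
    = (\<lambda>(t, ts). t # ts) ` (SIGMA t:(\<Union>A\<in>{A. A \<subseteq> S \<and> card A = arity s \<and> Min S \<in> A}. labeled s A).
        labeled_forests ss (S - leaves t))"
    (is "_ = _ ` Sigma (\<Union>?\<A>) ?B")
proof (intro equalityI subsetI)
  fix tts assume "tts \<in> labeled_forests (s # ss) S"
  then obtain t ts where tts: "tts = t # ts" "skeleton t = s" "map skeleton ts = ss"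
    "shuffle_tree \<Upsilon> ar t" "\<forall>t\<in>set ts. shuffle_tree \<Upsilon> ar t"
    "distinct (leaf_list t)" "distinct (concat (map leaf_list ts))"
    "leaves t \<inter> (\<Union>t\<in>set ts. leaves t) = {}" "leaves t \<union> (\<Union>t\<in>set ts. leaves t) = S"
    "\<forall>t'\<in>set ts. min_leaf t < min_leaf t'" "sorted_wrt (<) (map min_leaf ts)"
    by (auto simp: labeled_forests_def set_leaf_list)
  have "min_leaf t \<le> x" if xS: "x \<in> S" for x
  proof (cases "x \<in> leaves t")
    case False
    then obtain t' where t': "t' \<in> set ts" "x \<in> leaves t'" using tts(9) xS by auto
    then have "min_leaf t' \<le> x" by (simp add: min_leaf_def)
    with tts(10) t' show ?thesis by force
  qed (simp add: min_leaf_def)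
  then have "Min S = min_leaf t"
    using min_leaf_in[OF tts(4)] tts(9) S by (intro Min_eqI) auto
  then have "Min S \<in> leaves t" using min_leaf_in[OF tts(4)] by simp
  moreover have "S - leaves t = (\<Union>t\<in>set ts. leaves t)" using tts(8,9) by auto
  moreover have "card (leaves t) = arity s" using card_leaves[OF tts(6)] tts(2) by auto
  moreover have "leaves t \<subseteq> S" using tts(9) by auto
  ultimately show "tts \<in> (\<lambda>(t, ts). t # ts) ` Sigma (\<Union>?\<A>) ?B"
    using tts by (intro image_eqI[of _ _ "(t, ts)"])
      (auto simp: labeled_def shuffle_monomials_def labeled_forests_def)
next
  fix tts assume "tts \<in> (\<lambda>(t, ts). t # ts) ` Sigma (\<Union>?\<A>) ?B"
  then obtain t ts where tts: "tts = t # ts" "leaves t \<subseteq> S" "Min S \<in> leaves t" "skeleton t = s"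
    "shuffle_tree \<Upsilon> ar t" "distinct (leaf_list t)" "ts \<in> labeled_forests ss (S - leaves t)"
    by (auto simp: labeled_def shuffle_monomials_def)
  have "min_leaf t < min_leaf t'" if "t' \<in> set ts" for t'
  proof -
    have "min_leaf t' \<in> S - leaves t"
      using tts(7) that min_leaf_in[of t'] by (auto simp: labeled_forests_def)
    then have "Min S \<le> min_leaf t'" "Min S \<noteq> min_leaf t'" using S tts(3) by auto
    moreover have "min_leaf t \<le> Min S" using tts(3) by (simp add: min_leaf_def)
    ultimately show ?thesis by linarith
  qed
  then show "tts \<in> labeled_forests (s # ss) S"
    using tts by (auto simp: labeled_forests_def set_leaf_list)
qed

lemma card_subsets_containing:
  assumes "finite S" "x \<in> S" "k \<ge> 1"
  shows "card {A. A \<subseteq> S \<and> card A = k \<and> x \<in> A} = (card S - 1 choose (k - 1))"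
proof -
  have "{A. A \<subseteq> S \<and> card A = k \<and> x \<in> A} = insert x ` {A. A \<subseteq> S - {x} \<and> card A = k - 1}"
  proof (intro equalityI subsetI)
    fix A assume A: "A \<in> {A. A \<subseteq> S \<and> card A = k \<and> x \<in> A}"
    then have "finite A" using assms(1) finite_subset by blast
    then show "A \<in> insert x ` {A. A \<subseteq> S - {x} \<and> card A = k - 1}"
      using A by (intro image_eqI[of _ _ "A - {x}"]) auto
  next
    fix A assume "A \<in> insert x ` {A. A \<subseteq> S - {x} \<and> card A = k - 1}"
    then obtain B where B: "A = insert x B" "B \<subseteq> S - {x}" "card B = k - 1" by auto
    then have "finite B" using assms(1) finite_subset by blast
    then show "A \<in> {A. A \<subseteq> S \<and> card A = k \<and> x \<in> A}"
      using B assms by (auto simp: card_insert_if)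
  qed
  moreover have "inj_on (insert x) {A. A \<subseteq> S - {x} \<and> card A = k - 1}"
    by (auto simp: inj_on_def)
  ultimately have "card {A. A \<subseteq> S \<and> card A = k \<and> x \<in> A} = card {A. A \<subseteq> S - {x} \<and> card A = k - 1}"
    by (simp add: card_image)
  also have "\<dots> = (card S - 1 choose (k - 1))"
    using assms by (subst n_subsets) auto
  finally show ?thesis .
qed

text \<open>The leaf set of the first tree is any subset of the right size containing
  \<open>Min S\<close>. Whichever labels it leaves over, the rest has the same number of labelings,
  so the counts multiply. The assumption on single trees is the induction hypothesis of
  \<open>card_labeled\<close>.\<close>

lemma card_labeled_forests:
  assumes "\<And>s S. s \<in> set ss \<Longrightarrow> finite S \<Longrightarrow> card S = arity s \<Longrightarrow>
      finite (labeled s S) \<and> card (labeled s S) = labelings s"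
    and "\<And>s. s \<in> set ss \<Longrightarrow> arity s \<ge> 1"
    and "finite S" "card S = forest_arity ss"
  shows "finite (labeled_forests ss S) \<and> card (labeled_forests ss S) = forest_labelings ss"
  using assms
proof (induction ss arbitrary: S)
  case Nil
  then have "labeled_forests [] S = {[]}" by (auto simp: labeled_forests_def)
  then show ?case by simp
next
  case (Cons s ss)
  define \<A> where "\<A> = {A. A \<subseteq> S \<and> card A = arity s \<and> Min S \<in> A}"
  have s1: "arity s \<ge> 1" using Cons.prems(2) by simp
  then have "S \<noteq> {}" using Cons.prems(4) by auto
  have fA: "finite \<A>" using Cons.prems(3) by (auto simp: \<A>_def)
  have lab: "finite (labeled s A) \<and> card (labeled s A) = labelings s" if "A \<in> \<A>" for A
  proof (rule Cons.prems(1))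
    show "finite A" using that Cons.prems(3) by (auto simp: \<A>_def intro: finite_subset)
  qed (use that in \<open>auto simp: \<A>_def\<close>)
  have lf: "finite (labeled_forests ss (S - leaves t)) \<and>
      card (labeled_forests ss (S - leaves t)) = forest_labelings ss" if "t \<in> labeled s A" "A \<in> \<A>" for t A
  proof (rule Cons.IH)
    have "leaves t = A" using that by (auto simp: labeled_def shuffle_monomials_def)
    then show "card (S - leaves t) = forest_arity ss"
      using that Cons.prems(3,4) by (subst card_Diff_subset) (auto simp: \<A>_def intro: finite_subset)
  qed (use Cons.prems in auto)
  have fU: "finite (\<Union>A\<in>\<A>. labeled s A)" using fA lab by blast
  have "card (\<Union>A\<in>\<A>. labeled s A) = (\<Sum>A\<in>\<A>. card (labeled s A))"
    by (rule card_UN_disjoint[OF fA]) (use lab in \<open>auto simp: labeled_def shuffle_monomials_def\<close>)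
  also have "\<dots> = card \<A> * labelings s" using lab by simp
  also have "card \<A> = (card S - 1 choose (arity s - 1))"
    unfolding \<A>_def using Cons.prems(3) \<open>S \<noteq> {}\<close> s1 by (intro card_subsets_containing) auto
  finally have cU: "card (\<Union>A\<in>\<A>. labeled s A) = (card S - 1 choose (arity s - 1)) * labelings s" .
  have eq: "labeled_forests (s # ss) S = (\<lambda>(t, ts). t # ts) `
      (SIGMA t:(\<Union>A\<in>\<A>. labeled s A). labeled_forests ss (S - leaves t))"
    unfolding \<A>_def by (rule labeled_forests_Cons[OF Cons.prems(3)])
  have "card (labeled_forests (s # ss) S)
      = card (SIGMA t:(\<Union>A\<in>\<A>. labeled s A). labeled_forests ss (S - leaves t))"
    unfolding eq by (rule card_image) (auto simp: inj_on_def)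
  also have "\<dots> = (\<Sum>t\<in>(\<Union>A\<in>\<A>. labeled s A). card (labeled_forests ss (S - leaves t)))"
    using fU lf by (intro card_SigmaI) auto
  also have "\<dots> = (\<Sum>t\<in>(\<Union>A\<in>\<A>. labeled s A). forest_labelings ss)"
    by (rule sum.cong) (use lf in auto)
  finally have "card (labeled_forests (s # ss) S) = forest_labelings (s # ss)"
    using cU Cons.prems(4) by (simp add: forest_labelings_Cons)
  moreover have "finite (labeled_forests (s # ss) S)"
    unfolding eq using fU lf by (intro finite_imageI finite_SigmaI) auto
  ultimately show ?case by blast
qed

lemma card_labeled:
  assumes "wf_skeleton \<Upsilon> ar s" "finite S" "card S = arity s"
  shows "finite (labeled s S) \<and> card (labeled s S) = labelings s"
  using assms
proof (induction s arbitrary: S)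
  case (Leaf l)
  then obtain x where "S = {x}" by (auto simp: card_1_singleton_iff)
  then show ?case by (simp add: labeled_Leaf)
next
  case (Node u ss)
  have "finite (labeled_forests ss S) \<and> card (labeled_forests ss S) = forest_labelings ss"
  proof (rule card_labeled_forests)
    fix s S assume "s \<in> set ss" "finite (S :: nat set)" "card S = arity s"
    with Node.IH[of s S] Node.prems(1)
    show "finite (labeled s S) \<and> card (labeled s S) = labelings s" by auto
  qed (use Node.prems wf_skeleton_arity_pos arity_Node in \<open>auto simp del: leaf_list.simps\<close>)
  moreover have "labeled (Node u ss) S = Node u ` labeled_forests ss S"
    using Node.prems by (intro labeled_Node) auto
  moreover have "inj_on (Node u) X" for X :: "('u, nat) ptree list set" by (auto simp: inj_on_def)
  ultimately show ?case by (simp add: card_image labelings_Node del: labelings.simps)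
qed

end

section \<open>Pattern matching on skeletons and the states of the automaton\<close>

text \<open>The counterpart of \<open>truncation\<close> for skeletons: a leaf of the pattern stands
  for a subtree that is cut off.\<close>

inductive matches :: "('u, unit) ptree \<Rightarrow> ('u, unit) ptree \<Rightarrow> bool" where
  matches_Leaf: "matches (Leaf ()) t"
| matches_Node: "list_all2 matches ps ts \<Longrightarrow> matches (Node u ps) (Node u ts)"

lemma matches_Node_iff: "matches (Node u ps) t \<longleftrightarrow> (\<exists>ts. t = Node u ts \<and> list_all2 matches ps ts)"
  by (auto elim: matches.cases intro: matches_Node)

lemma subterm_trans: "subterm b c \<Longrightarrow> subterm a b \<Longrightarrow> subterm a c"
  by (induction rule: subterm.induct) (auto intro: subterm.intros)

lemma subterm_Node_iff: "subterm s (Node u ts) \<longleftrightarrow> s = Node u ts \<or> (\<exists>t\<in>set ts. subterm s t)"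
  by (auto elim: subterm.cases intro: subterm.intros)

lemma subterm_Leaf_iff: "subterm s (Leaf l) \<longleftrightarrow> s = Leaf l"
  by (auto elim: subterm.cases intro: subterm.intros)

lemma finite_subterms: "finite {s. subterm s t}"
proof (induction t)
  case (Node u ts)
  have "{s. subterm s (Node u ts)} = insert (Node u ts) (\<Union>t\<in>set ts. {s. subterm s t})"
    by (auto simp: subterm_Node_iff)
  with Node show ?case by simp
qed (simp add: subterm_Leaf_iff)

lemma subterm_skeleton_iff: "subterm s (skeleton t) \<longleftrightarrow> (\<exists>t'. subterm t' t \<and> s = skeleton t')"
  by (induction t) (auto simp: subterm_Node_iff subterm_Leaf_iff)

definition avoiders :: "'u set \<Rightarrow> ('u \<Rightarrow> nat) \<Rightarrow> ('u, unit) ptree set \<Rightarrow> ('u, unit) ptree set" where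
  "avoiders \<Upsilon> ar Ps = {s. wf_skeleton \<Upsilon> ar s \<and> (\<forall>t p. subterm t s \<longrightarrow> p \<in> Ps \<longrightarrow> \<not> matches p t)}"

text \<open>This is the state of a tree. All subterms of the patterns are recorded, because a match
  at the root is decided by which children of the pattern match at the children of the tree.\<close>

definition matched_subpatterns :: "('u, unit) ptree set \<Rightarrow> ('u, unit) ptree \<Rightarrow> ('u, unit) ptree set" where
  "matched_subpatterns Ps t = {p. (\<exists>p'\<in>Ps. subterm p p') \<and> matches p t}"

lemma finite_matched_subpatterns_range:
  assumes "finite Ps"
  shows "finite (matched_subpatterns Ps ` L)"
proof (rule finite_subset)
  show "matched_subpatterns Ps ` L \<subseteq> Pow (\<Union>p'\<in>Ps. {p. subterm p p'})"
    by (auto simp: matched_subpatterns_def)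
  show "finite (Pow (\<Union>p'\<in>Ps. {p. subterm p p'}))" using assms finite_subterms by auto
qed

lemma avoiders_Node:
  "Node u ts \<in> avoiders \<Upsilon> ar Ps \<longleftrightarrow> u \<in> \<Upsilon> \<and> length ts = ar u \<and> set ts \<subseteq> avoiders \<Upsilon> ar Ps \<and>
    matched_subpatterns Ps (Node u ts) \<inter> Ps = {}"
proof -
  have "(\<forall>p\<in>Ps. \<not> matches p (Node u ts)) \<longleftrightarrow> matched_subpatterns Ps (Node u ts) \<inter> Ps = {}"
    by (auto simp: matched_subpatterns_def intro: subterm.intros)
  then show ?thesis by (auto simp: avoiders_def subterm_Node_iff)
qed

text \<open>The recorded patterns are closed under passing to children, so the states of the
  children contain everything that is needed to compare the children of a pattern.\<close>

lemma matched_subpatterns_cong: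
  assumes "map (matched_subpatterns Ps) ts' = map (matched_subpatterns Ps) ts"
  shows "matched_subpatterns Ps (Node u ts') = matched_subpatterns Ps (Node u ts)"
proof -
  have *: "matched_subpatterns Ps (Node u ts') \<subseteq> matched_subpatterns Ps (Node u ts)"
    if eq: "map (matched_subpatterns Ps) ts' = map (matched_subpatterns Ps) ts" for ts ts'
  proof
    fix p assume p: "p \<in> matched_subpatterns Ps (Node u ts')"
    then obtain p' where p': "p' \<in> Ps" "subterm p p'" and m: "matches p (Node u ts')"
      by (auto simp: matched_subpatterns_def)
    have "matches p (Node u ts)"
    proof (cases p)
      case (Leaf l)
      then show ?thesis by (simp add: matches_Leaf)
    next
      case (Node v ps)
      with m have v: "v = u" and ps: "list_all2 matches ps ts'" by (auto simp: matches_Node_iff)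
      have "list_all2 matches ps ts"
        unfolding list_all2_conv_all_nth
      proof (intro conjI allI impI)
        show l: "length ps = length ts" using list_all2_lengthD[OF ps] map_eq_imp_length_eq[OF eq] by simp
        fix i assume i: "i < length ps"
        have "subterm (ps ! i) p"
          using Node i by (auto simp: subterm_Node_iff intro!: bexI[of _ "ps ! i"] subterm.intros)
        then have "subterm (ps ! i) p'" using subterm_trans p'(2) by blast
        moreover have "matches (ps ! i) (ts' ! i)" using ps i by (simp add: list_all2_conv_all_nth)
        ultimately have "ps ! i \<in> matched_subpatterns Ps (ts' ! i)"
          using p'(1) by (auto simp: matched_subpatterns_def)
        also have "matched_subpatterns Ps (ts' ! i) = matched_subpatterns Ps (ts ! i)"
          using eq i l by (metis map_eq_imp_length_eq nth_map)
        finally show "matches (ps ! i) (ts ! i)" by (simp add: matched_subpatterns_def)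
      qed
      then show ?thesis using Node v by (simp add: matches_Node)
    qed
    then show "p \<in> matched_subpatterns Ps (Node u ts)" using p' by (auto simp: matched_subpatterns_def)
  qed
  show ?thesis using *[OF assms] *[OF assms[symmetric]] by blast
qed

section \<open>Relabeling, grafting and truncation\<close>

lemma strict_mono_on_Min:
  fixes h :: "nat \<Rightarrow> nat"
  assumes "strict_mono_on A h" "finite A" "A \<noteq> {}"
  shows "Min (h ` A) = h (Min A)"
proof (rule Min_eqI)
  fix y assume "y \<in> h ` A"
  then obtain x where "x \<in> A" "y = h x" by blast
  then show "h (Min A) \<le> y"
    using mono_onD[OF strict_mono_on_imp_mono_on[OF assms(1)], of "Min A" x] assms(2,3) by auto
qed (use assms in auto)

lemma min_leaf_map:
  assumes "strict_mono_on (leaves t) h" "leaves t \<noteq> {}"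
  shows "min_leaf (map_ptree id h t) = h (min_leaf t)"
  using assms by (simp add: min_leaf_def ptree.set_map strict_mono_on_Min)

lemma leaf_list_map: "leaf_list (map_ptree id h t) = map h (leaf_list t)"
  by (induction t) (auto simp: map_concat comp_def cong: map_cong)

lemma skeleton_map: "skeleton (map_ptree id h t) = skeleton t"
  by (simp add: skeleton_def ptree.map_comp comp_def id_def)

text \<open>Simultaneous grafting at all leaves. It undoes a truncation in one step, while
  \<open>graft\<close> is the case of a single leaf.\<close>

fun subst :: "('l \<Rightarrow> ('u, 'm) ptree) \<Rightarrow> ('u, 'l) ptree \<Rightarrow> ('u, 'm) ptree" where
  "subst \<sigma> (Leaf l) = \<sigma> l"
| "subst \<sigma> (Node u ts) = Node u (map (subst \<sigma>) ts)"

lemma graft_eq_subst: "graft t s b = subst (\<lambda>l. if l = s then b else Leaf l) t"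
  by (induction t) auto

lemma subst_cong: "(\<And>l. l \<in> leaves t \<Longrightarrow> \<sigma> l = \<tau> l) \<Longrightarrow> subst \<sigma> t = subst \<tau> t"
  by (induction t) auto

lemma subst_Leaf: "subst Leaf t = t"
  by (induction t) (auto intro: map_idI)

lemma subst_subst: "subst \<tau> (subst \<sigma> t) = subst (\<lambda>l. subst \<tau> (\<sigma> l)) t"
  by (induction t) auto

lemma leaf_list_subst: "leaf_list (subst \<sigma> t) = concat (map (\<lambda>l. leaf_list (\<sigma> l)) (leaf_list t))"
proof (induction t)
  case (Node u ts)
  then show ?case by (induction ts) auto
qed simp

lemma leaves_subst: "leaves (subst \<sigma> t) = (\<Union>l\<in>leaves t. leaves (\<sigma> l))"
  by (induction t) auto

lemma graft_ident: "s \<notin> leaves t \<Longrightarrow> graft t s b = t"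
proof -
  assume "s \<notin> leaves t"
  then have "graft t s b = subst Leaf t"
    unfolding graft_eq_subst by (intro subst_cong) auto
  then show ?thesis by (simp add: subst_Leaf)
qed

lemma leaves_graft: "leaves (graft t s b) = (if s \<in> leaves t then leaves t - {s} \<union> leaves b else leaves t)"
  by (auto simp: graft_eq_subst leaves_subst split: if_splits)

lemma distinct_concat_disjoint:
  "distinct (concat (map f xs)) \<Longrightarrow> distinct xs \<Longrightarrow> a \<in> set xs \<Longrightarrow> b \<in> set xs \<Longrightarrow> a \<noteq> b \<Longrightarrow>
    set (f a) \<inter> set (f b) = {}"
  by (induction xs) auto

lemma distinct_graft:
  assumes "distinct (leaf_list t)" "distinct (leaf_list b)" "leaves t \<inter> leaves b \<subseteq> {s}"
  shows "distinct (leaf_list (graft t s b))"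
proof -
  have "distinct (concat (map (\<lambda>l. leaf_list (if l = s then b else Leaf l)) xs))"
    if "distinct xs" "set xs \<inter> leaves b \<subseteq> {s}" for xs
    using that assms(2)
    by (induction xs) (auto simp: set_leaf_list split: if_splits)
  from this[of "leaf_list t"] assms(1,3) show ?thesis
    by (simp add: graft_eq_subst leaf_list_subst set_leaf_list)
qed

context operations begin

abbreviation M :: "nat set \<Rightarrow> ('u, nat) ptree set" where
  "M \<equiv> shuffle_monomials \<Upsilon> ar"

lemma label_set_leaves: "shuffle_tree \<Upsilon> ar t \<Longrightarrow> label_set (leaves t)"
  by (auto simp: label_set_def dest: leaves_nonempty)

lemma shuffle_tree_map:
  "shuffle_tree \<Upsilon> ar t \<Longrightarrow> strict_mono_on (leaves t) h \<Longrightarrow> shuffle_tree \<Upsilon> ar (map_ptree id h t)"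
proof (induction t)
  case (Node u ts)
  have sm: "strict_mono_on (leaves t) h" if "t \<in> set ts" for t
    using Node.prems(2) that by (auto elim: monotone_on_subset)
  have ml: "min_leaf (map_ptree id h t) = h (min_leaf t)" "min_leaf t \<in> leaves t" if "t \<in> set ts" for t
    using that Node.prems(1) sm by (auto intro!: min_leaf_map min_leaf_in dest: leaves_nonempty)
  have "sorted_wrt (\<lambda>x y. min_leaf x < min_leaf y) ts"
    using Node.prems(1) by (simp add: sorted_wrt_map)
  then have "sorted_wrt (\<lambda>x y. min_leaf (map_ptree id h x) < min_leaf (map_ptree id h y)) ts"
  proof (rule sorted_wrt_mono_rel[rotated])
    fix x y assume xy: "x \<in> set ts" "y \<in> set ts" "min_leaf x < min_leaf y"
    then show "min_leaf (map_ptree id h x) < min_leaf (map_ptree id h y)"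
      using ml[OF xy(1)] ml[OF xy(2)] Node.prems(2) by (auto simp: strict_mono_on_def)
  qed
  then show ?case using Node sm by (auto simp: sorted_wrt_map id_def)
qed simp

lemma map_in_M:
  assumes "t \<in> M S" "strict_mono_on S h"
  shows "map_ptree id h t \<in> M (h ` S)"
  using assms strict_mono_on_imp_inj_on[OF assms(2)]
  by (auto simp: shuffle_monomials_def shuffle_tree_map leaf_list_map distinct_map set_leaf_list ptree.set_map)

text \<open>The leaf \<open>s\<close> is replaced by a tree whose least label is \<open>s\<close>,
  so no minimum changes at any vertex and the order of the inputs stays increasing.\<close>

lemma graft_shuffle_tree:
  assumes b: "shuffle_tree \<Upsilon> ar b" "min_leaf b = s"
  shows "shuffle_tree \<Upsilon> ar t \<Longrightarrow> leaves t \<inter> leaves b \<subseteq> {s} \<Longrightarrow>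
    shuffle_tree \<Upsilon> ar (graft t s b) \<and> min_leaf (graft t s b) = min_leaf t"
proof (induction t)
  case (Leaf l)
  then show ?case using b by (auto simp: min_leaf_def)
next
  case (Node u ts)
  have IH: "shuffle_tree \<Upsilon> ar (graft t s b) \<and> min_leaf (graft t s b) = min_leaf t" if "t \<in> set ts" for t
    using Node that by (intro Node.IH) auto
  then have "map min_leaf (map (\<lambda>t. graft t s b) ts) = map min_leaf ts" by simp
  then have 1: "shuffle_tree \<Upsilon> ar (graft (Node u ts) s b)"
    using Node.prems(1) IH by (simp del: map_map)
  have "min_leaf (graft (Node u ts) s b) = min_leaf (Node u ts)"
  proof -
    have "Min (leaves (Node u ts)) = Min (\<Union>t\<in>set ts. leaves (graft t s b))"
      if "s \<in> leaves (Node u ts)"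
    proof -
      have sb: "s \<in> leaves b" "\<And>x. x \<in> leaves b \<Longrightarrow> s \<le> x"
        using b min_leaf_in[OF b(1)] by (auto simp: min_leaf_def)
      have L: "(\<Union>t\<in>set ts. leaves (graft t s b)) = leaves (Node u ts) \<union> leaves b"
        using leaves_graft[of "Node u ts" s b] that sb by auto
      have ne: "leaves (Node u ts) \<noteq> {}" using that by auto
      have "Min (leaves (Node u ts)) \<le> s" using that by (intro Min_le) auto
      show ?thesis unfolding L
      proof (rule Min_eqI[symmetric])
        fix y assume "y \<in> leaves (Node u ts) \<union> leaves b"
        then show "Min (leaves (Node u ts)) \<le> y"
          using \<open>Min (leaves (Node u ts)) \<le> s\<close> sb(2)[of y] by (auto intro: order_trans Min_le)
      qed (use ne Min_in[OF _ ne] in auto)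
    qed
    then show ?thesis
      by (cases "s \<in> leaves (Node u ts)") (auto simp: min_leaf_def graft_ident simp del: graft.simps(2) intro: arg_cong[of _ _ Min] simp: leaves_graft)
  qed
  with 1 show ?case by blast
qed

lemma graft_in_M:
  assumes "a \<in> M S" "b \<in> M T" "shuffle_graftable S s T"
  shows "graft a s b \<in> M (S - {s} \<union> T)"
proof -
  have "leaves a \<inter> leaves b \<subseteq> {s}" "min_leaf b = s"
    using assms by (auto simp: shuffle_monomials_def shuffle_graftable_def min_leaf_def)
  then show ?thesis
    using assms graft_shuffle_tree[of b s a] distinct_graft[of a b s]
    by (auto simp: shuffle_monomials_def shuffle_graftable_def leaves_graft)
qed

lemma size_graft_ge: "s \<in> leaves t \<Longrightarrow> size b \<le> size (graft t s b)"
proof (induction t)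
  case (Node u ts)
  then obtain t where t: "t \<in> set ts" "s \<in> leaves t" by auto
  have "size b \<le> size (graft t s b)" using Node t by blast
  also have "\<dots> \<le> size_list size (map (\<lambda>t. graft t s b) ts)"
    using t by (intro size_list_estimation'[of "graft t s b"]) auto
  finally show ?case by simp
qed simp

lemma size_graft_Node_gt: "s \<in> leaves (Node u ts) \<Longrightarrow> size b < size (graft (Node u ts) s b)"
proof -
  assume "s \<in> leaves (Node u ts)"
  then obtain t where t: "t \<in> set ts" "s \<in> leaves t" by auto
  have "size b \<le> size (graft t s b)" using t size_graft_ge by blast
  also have "\<dots> \<le> size_list size (map (\<lambda>t. graft t s b) ts)"
    using t by (intro size_list_estimation'[of "graft t s b"]) auto
  finally show ?thesis by simp
qed

text \<open>Ensures that composing with a fixed monomial causes no cancellation. A leaf and a vertex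
  cannot give the same tree: a graft below a vertex is strictly larger than \<open>b\<close>, and
  where \<open>s\<close> does not occur, the result lacks the label \<open>s\<close>, which
  \<open>b\<close> contains.\<close>

lemma graft_left_inj:
  assumes "s \<in> leaves b"
  shows "graft a s b = graft a' s b \<Longrightarrow> leaves a \<inter> leaves b \<subseteq> {s} \<Longrightarrow> leaves a' \<inter> leaves b \<subseteq> {s} \<Longrightarrow> a = a'"
proof (induction a arbitrary: a')
  case (Leaf l)
  show ?case
  proof (cases a')
    case (Leaf l')
    then show ?thesis using Leaf.prems assms by (auto split: if_splits)
  next
    case (Node u ts)
    show ?thesis
    proof (cases "s \<in> leaves a'")
      case True
      then have "size b < size (graft a' s b)" using Node size_graft_Node_gt by metis
      then have "b \<noteq> graft a' s b" by (metis less_irrefl)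
      then show ?thesis using Leaf.prems(1) Node by (cases "l = s") auto
    next
      case False
      then have "graft (Leaf l) s b = a'" using Leaf.prems(1) graft_ident by metis
      then show ?thesis using False assms Node by (auto split: if_splits)
    qed
  qed
next
  case (Node u ts)
  show ?case
  proof (cases a')
    case (Leaf l')
    show ?thesis
    proof (cases "s \<in> leaves (Node u ts)")
      case True
      then have "size b < size (graft (Node u ts) s b)" by (rule size_graft_Node_gt)
      then have "b \<noteq> graft (Node u ts) s b" by (metis less_irrefl)
      then show ?thesis using Node.prems(1) Leaf by (cases "l' = s") auto
    next
      case False
      then have "graft a' s b = Node u ts" using Node.prems(1) graft_ident by metis
      then show ?thesis using False assms Leaf by (auto split: if_splits)
    qed
  next
    case a': (Node v ts')
    with Node.prems(1) have uv: "u = v" and eq: "map (\<lambda>t. graft t s b) ts = map (\<lambda>t. graft t s b) ts'"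
      by auto
    have len: "length ts = length ts'" using eq map_eq_imp_length_eq by blast
    have "ts ! i = ts' ! i" if i: "i < length ts" for i
    proof (rule Node.IH)
      show "ts ! i \<in> set ts" using i by simp
      show "graft (ts ! i) s b = graft (ts' ! i) s b" using eq i len by (metis nth_map)
      show "leaves (ts ! i) \<inter> leaves b \<subseteq> {s}" using Node.prems(2) i by (auto dest: nth_mem)
      show "leaves (ts' ! i) \<inter> leaves b \<subseteq> {s}" using Node.prems(3) a' i len by (auto dest: nth_mem)
    qed
    then show ?thesis using a' uv len by (simp add: list_eq_iff_nth_eq)
  qed
qed

lemma graft_right_inj: "s \<in> leaves a \<Longrightarrow> graft a s b = graft a s b' \<Longrightarrow> b = b'"
  by (induction a) auto

text \<open>Each leaf of \<open>u\<close> is the minimum of the subtree cut off there, and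
  substituting these subtrees restores \<open>t\<close>. As different branches have disjoint labels,
  the substitutions found for the branches glue to a single one.\<close>

lemma truncation_subst:
  "truncation t u \<Longrightarrow> shuffle_tree \<Upsilon> ar t \<Longrightarrow> distinct (leaf_list t) \<Longrightarrow>
    leaves u \<subseteq> leaves t \<and>
    (\<exists>\<sigma>. t = subst \<sigma> u \<and> (\<forall>l\<in>leaves u. shuffle_tree \<Upsilon> ar (\<sigma> l) \<and> min_leaf (\<sigma> l) = l))"
proof (induction rule: truncation.induct)
  case (1 t)
  then show ?case using min_leaf_in by (auto intro!: exI[of _ "\<lambda>_. t"])
next
  case (2 ts ws u)
  have "(\<Union>w\<in>set ws. leaves w) \<subseteq> (\<Union>t\<in>set ts. leaves t) \<and>
    (\<exists>\<sigma>. ts = map (subst \<sigma>) ws \<and> (\<forall>l\<in>(\<Union>w\<in>set ws. leaves w). shuffle_tree \<Upsilon> ar (\<sigma> l) \<and> min_leaf (\<sigma> l) = l))"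
    if "list_all2 (\<lambda>t w. truncation t w \<and> (shuffle_tree \<Upsilon> ar t \<longrightarrow> distinct (leaf_list t) \<longrightarrow>
          leaves w \<subseteq> leaves t \<and>
          (\<exists>\<sigma>. t = subst \<sigma> w \<and> (\<forall>l\<in>leaves w. shuffle_tree \<Upsilon> ar (\<sigma> l) \<and> min_leaf (\<sigma> l) = l)))) ts ws"
      "\<forall>t\<in>set ts. shuffle_tree \<Upsilon> ar t" "distinct (concat (map leaf_list ts))" for ts ws
    using that
  proof (induction rule: list_all2_induct)
    case Nil
    then show ?case by auto
  next
    case (Cons t ts w ws)
    from Cons(1) Cons.prems obtain \<sigma>1 where 1: "leaves w \<subseteq> leaves t" "t = subst \<sigma>1 w"
      "\<forall>l\<in>leaves w. shuffle_tree \<Upsilon> ar (\<sigma>1 l) \<and> min_leaf (\<sigma>1 l) = l" by auto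
    from Cons.IH Cons.prems obtain \<sigma>2 where 2: "(\<Union>w\<in>set ws. leaves w) \<subseteq> (\<Union>t\<in>set ts. leaves t)"
      "ts = map (subst \<sigma>2) ws"
      "\<forall>l\<in>(\<Union>w\<in>set ws. leaves w). shuffle_tree \<Upsilon> ar (\<sigma>2 l) \<and> min_leaf (\<sigma>2 l) = l" by auto
    have disj: "leaves t \<inter> (\<Union>t\<in>set ts. leaves t) = {}"
      using Cons.prems(2) by (auto simp: set_leaf_list)
    define \<sigma> where "\<sigma> l = (if l \<in> leaves w then \<sigma>1 l else \<sigma>2 l)" for l
    have "t = subst \<sigma> w" unfolding 1(2) by (rule subst_cong) (simp add: \<sigma>_def)
    moreover have "subst \<sigma>2 w' = subst \<sigma> w'" if "w' \<in> set ws" for w'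
      by (rule subst_cong) (use 1(1) 2(1) disj that in \<open>auto simp: \<sigma>_def\<close>)
    then have "ts = map (subst \<sigma>) ws" unfolding 2(2) by simp
    moreover have "\<forall>l\<in>(\<Union>w\<in>set (w # ws). leaves w). shuffle_tree \<Upsilon> ar (\<sigma> l) \<and> min_leaf (\<sigma> l) = l"
      using 1(3) 2(3) by (auto simp: \<sigma>_def)
    ultimately show ?case using 1(1) 2(1) by (intro conjI exI[of _ \<sigma>]) auto
  qed
  from this[of ts ws] 2 show ?case by auto
qed

text \<open>Every subtree that is cut off leaves its minimum behind, so the minima at all vertices
  survive.\<close>

lemma truncation_shuffle_tree:
  "truncation t u \<Longrightarrow> shuffle_tree \<Upsilon> ar t \<Longrightarrow> shuffle_tree \<Upsilon> ar u \<and> min_leaf u = min_leaf t"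
proof (induction rule: truncation.induct)
  case (1 t)
  then show ?case by (simp add: min_leaf_def)
next
  case (2 ts ws u)
  from 2 have len: "length ws = length ts" by (auto dest: list_all2_lengthD)
  have nth: "shuffle_tree \<Upsilon> ar (ws ! i) \<and> min_leaf (ws ! i) = min_leaf (ts ! i)" if "i < length ts" for i
    using 2 that by (auto simp: list_all2_conv_all_nth)
  then have map_eq: "map min_leaf ws = map min_leaf ts" by (intro nth_equalityI) (auto simp: len)
  have st: "\<forall>w\<in>set ws. shuffle_tree \<Upsilon> ar w" using nth len by (metis in_set_conv_nth)
  then have 1: "shuffle_tree \<Upsilon> ar (Node u ws)" using 2 len map_eq by simp
  have ml: "min_leaf (Node u xs) = Min (set (map min_leaf xs))"
    if "shuffle_tree \<Upsilon> ar (Node u xs)" for xs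
  proof -
    have ne': "xs \<noteq> []" using leaves_nonempty[OF that] by auto
    have "Min (\<Union>x\<in>set xs. leaves x) = Min (min_leaf ` set xs)"
    proof (rule Min_eqI)
      fix y assume "y \<in> (\<Union>x\<in>set xs. leaves x)"
      then obtain x where x: "x \<in> set xs" "y \<in> leaves x" by blast
      have "Min (min_leaf ` set xs) \<le> min_leaf x" using x by simp
      also have "\<dots> \<le> y" using x by (simp add: min_leaf_def)
      finally show "Min (min_leaf ` set xs) \<le> y" .
    next
      have "Min (min_leaf ` set xs) \<in> min_leaf ` set xs" using ne' by (intro Min_in) auto
      then obtain x where x: "x \<in> set xs" "Min (min_leaf ` set xs) = min_leaf x" by auto
      then have "min_leaf x \<in> leaves x" using that by (intro min_leaf_in) auto
      with x show "Min (min_leaf ` set xs) \<in> (\<Union>x\<in>set xs. leaves x)" by auto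
    qed auto
    then show ?thesis by (simp add: min_leaf_def)
  qed
  show ?case using 1 ml[OF 1] ml[OF 2(2)] map_eq by simp
qed

lemma truncation_distinct:
  assumes "truncation t u" "shuffle_tree \<Upsilon> ar t" "distinct (leaf_list t)"
  shows "distinct (leaf_list u)"
proof -
  obtain \<sigma> where s: "t = subst \<sigma> u" "\<forall>l\<in>leaves u. shuffle_tree \<Upsilon> ar (\<sigma> l) \<and> min_leaf (\<sigma> l) = l"
    using truncation_subst[OF assms] by blast
  have "distinct xs" if "distinct (concat (map (\<lambda>l. leaf_list (\<sigma> l)) xs))" "set xs \<subseteq> leaves u" for xs
    using that
  proof (induction xs)
    case (Cons x xs)
    have "x \<notin> set xs"
    proof
      assume "x \<in> set xs"
      moreover have "x \<in> leaves (\<sigma> x)" using min_leaf_in[of "\<sigma> x"] s(2) Cons.prems(2) by force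
      ultimately show False using Cons.prems(1) by (auto simp: set_leaf_list)
    qed
    then show ?case using Cons by auto
  qed simp
  from this[of "leaf_list u"] show ?thesis
    using assms(3) unfolding s(1) leaf_list_subst by (simp add: set_leaf_list)
qed

end

section \<open>Divisibility of shuffle monomials read off from skeletons\<close>

lemma truncation_matches: "truncation t u \<Longrightarrow> matches (skeleton u) (skeleton t)"
proof (induction rule: truncation.induct)
  case (2 ts ws u)
  then show ?case
    by (auto intro!: matches_Node simp: list_all2_conv_all_nth)
qed (simp add: matches_Leaf)

lemma matches_truncation:
  "matches p s \<Longrightarrow> s = skeleton t \<Longrightarrow> \<exists>u. truncation t u \<and> skeleton u = p"
proof (induction arbitrary: t rule: matches.induct)
  case (matches_Leaf s)
  show ?case by (intro exI[of _ "Leaf (min_leaf t)"]) (auto intro: truncation.intros)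
next
  case (matches_Node ps ss u)
  then obtain ts where t: "t = Node u ts" "ss = map skeleton ts" by (cases t) auto
  have "\<exists>w. truncation (ts ! i) w \<and> skeleton w = ps ! i" if "i < length ts" for i
    using matches_Node.IH t that by (auto simp: list_all2_conv_all_nth)
  then obtain w where w: "\<And>i. i < length ts \<Longrightarrow> truncation (ts ! i) (w i) \<and> skeleton (w i) = ps ! i"
    by metis
  have len: "length ps = length ts" using matches_Node.IH t by (auto dest: list_all2_lengthD)
  define ws where "ws = map w [0..<length ts]"
  have "list_all2 truncation ts ws" using w by (auto simp: ws_def list_all2_conv_all_nth)
  then have "truncation t (Node u ws)" unfolding t by (rule truncation.intros)
  moreover have "map skeleton ws = ps" using w len by (intro nth_equalityI) (auto simp: ws_def)
  ultimately show ?case by (intro exI[of _ "Node u ws"]) auto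
qed

lemma subterm_shuffle_tree:
  "subterm t v \<Longrightarrow> shuffle_tree \<Upsilon> ar v \<Longrightarrow> distinct (leaf_list v) \<Longrightarrow>
    shuffle_tree \<Upsilon> ar t \<and> distinct (leaf_list t)"
  by (induction rule: subterm.induct) (auto simp: distinct_concat_iff)

lemma ex_standardization:
  fixes S :: "nat set"
  assumes "finite S"
  obtains h where "strict_mono_on S h" "h ` S = {1..card S}"
proof -
  define h where "h x = card {y \<in> S. y \<le> x}" for x
  have sm: "strict_mono_on S h"
  proof (rule strict_mono_onI)
    fix x y assume "x \<in> S" "y \<in> S" "x < y"
    then have "{z \<in> S. z \<le> x} \<subseteq> {z \<in> S. z \<le> y}" "y \<in> {z \<in> S. z \<le> y}" "y \<notin> {z \<in> S. z \<le> x}"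
      by auto
    then have "{z \<in> S. z \<le> x} \<subset> {z \<in> S. z \<le> y}" by blast
    then show "h x < h y" unfolding h_def using assms by (intro psubset_card_mono) auto
  qed
  have "h x \<in> {1..card S}" if "x \<in> S" for x
  proof -
    have "{y \<in> S. y \<le> x} \<noteq> {}" using that by auto
    then have "h x > 0" unfolding h_def using assms by (simp add: card_gt_0_iff)
    moreover have "h x \<le> card S" unfolding h_def using assms by (intro card_mono) auto
    ultimately show ?thesis by simp
  qed
  then have "h ` S \<subseteq> {1..card S}" by auto
  then have "h ` S = {1..card S}"
    using card_image[OF strict_mono_on_imp_inj_on[OF sm]] by (intro card_subset_eq) auto
  with sm that show ?thesis by blast
qed

text \<open>A divisor always leaves a match of skeletons. Conversely, a match only yields a
  connected subtree with the skeleton of some m in \<open>B\<close>, whose leaves may be ordered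
  differently from those of m. Standardized to the labels from 1 on, this subtree lies in
  \<open>B\<close> by shuffle regularity, and it divides \<open>v\<close>.\<close>

lemma (in operations) divisible_iff_not_avoider:
  assumes reg: "shuffle_regular \<Upsilon> ar B" and B: "B \<subseteq> (\<Union>n\<in>{1..}. M {1..n})"
    and v: "v \<in> M S"
  shows "(\<exists>m\<in>B. divides m v) \<longleftrightarrow> skeleton v \<notin> avoiders \<Upsilon> ar (skeleton ` B)"
proof
  assume "\<exists>m\<in>B. divides m v"
  then obtain m t u h where *: "m \<in> B" "subterm t v" "truncation t u" "map_ptree id h u = m"
    by (auto simp: divides_def)
  then have "matches (skeleton m) (skeleton t)" using truncation_matches skeleton_map by metis
  moreover have "subterm (skeleton t) (skeleton v)" using * subterm_skeleton_iff by blast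
  ultimately show "skeleton v \<notin> avoiders \<Upsilon> ar (skeleton ` B)"
    using *(1) by (auto simp: avoiders_def)
next
  assume "skeleton v \<notin> avoiders \<Upsilon> ar (skeleton ` B)"
  then obtain s m where s: "subterm s (skeleton v)" "m \<in> B" "matches (skeleton m) s"
    using v wf_skeleton_skeleton[of \<Upsilon> ar v] by (auto simp: avoiders_def shuffle_monomials_def)
  then obtain t where t: "subterm t v" "s = skeleton t" using subterm_skeleton_iff by blast
  obtain u where u: "truncation t u" "skeleton u = skeleton m"
    using matches_truncation[OF s(3) t(2)] by blast
  have ts: "shuffle_tree \<Upsilon> ar t" "distinct (leaf_list t)"
    using subterm_shuffle_tree[OF t(1)] v by (auto simp: shuffle_monomials_def)
  have us: "u \<in> M (leaves u)"
    using truncation_shuffle_tree[OF u(1) ts(1)] truncation_distinct[OF u(1) ts]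
    by (simp add: shuffle_monomials_def)
  obtain h where h: "strict_mono_on (leaves u) h" "h ` leaves u = {1..card (leaves u)}"
    using ex_standardization[of "leaves u"] by auto
  have "map_ptree id h u \<in> M {1..card (leaves u)}" using map_in_M[OF us h(1)] h(2) by simp
  moreover have "card (leaves u) \<ge> 1"
    using us leaves_nonempty[of u] by (auto simp: shuffle_monomials_def Suc_le_eq card_gt_0_iff)
  moreover have "skeleton (map_ptree id h u) = skeleton m" by (simp add: skeleton_map u(2))
  ultimately have "map_ptree id h u \<in> B" using reg s(2) by (auto simp: shuffle_regular_def)
  then show "\<exists>m\<in>B. divides m v" using t(1) u(1) h(1) by (auto simp: divides_def)
qed

section \<open>Leading monomials and dimensions\<close>

lemma keys_sum_single:
  fixes x :: "'a \<Rightarrow>\<^sub>0 'k::comm_monoid_add"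
  assumes "inj_on \<phi> (Poly_Mapping.keys x)"
  shows "Poly_Mapping.keys (\<Sum>a\<in>Poly_Mapping.keys x. Poly_Mapping.single (\<phi> a) (Poly_Mapping.lookup x a))
    = \<phi> ` Poly_Mapping.keys x" (is "Poly_Mapping.keys ?y = _")
proof (intro equalityI subsetI)
  fix t assume "t \<in> Poly_Mapping.keys ?y"
  then have "Poly_Mapping.lookup ?y t \<noteq> 0" by (simp add: in_keys_iff)
  then have "(\<Sum>a\<in>Poly_Mapping.keys x. Poly_Mapping.lookup x a when \<phi> a = t) \<noteq> 0"
    by (simp add: lookup_sum lookup_single)
  then obtain a where "a \<in> Poly_Mapping.keys x" "(Poly_Mapping.lookup x a when \<phi> a = t) \<noteq> 0"
    by (meson sum.not_neutral_contains_not_neutral)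
  then show "t \<in> \<phi> ` Poly_Mapping.keys x" by (auto simp: when_def split: if_splits)
next
  fix t assume "t \<in> \<phi> ` Poly_Mapping.keys x"
  then obtain a where a: "a \<in> Poly_Mapping.keys x" "t = \<phi> a" by blast
  have "Poly_Mapping.lookup ?y t = (\<Sum>a'\<in>Poly_Mapping.keys x. Poly_Mapping.lookup x a' when \<phi> a' = t)"
    by (simp add: lookup_sum lookup_single)
  also have "\<dots> = (\<Sum>a'\<in>Poly_Mapping.keys x. if a' = a then Poly_Mapping.lookup x a else 0)"
    by (rule sum.cong) (use a assms in \<open>auto simp: when_def inj_on_def\<close>)
  also have "\<dots> = Poly_Mapping.lookup x a" using a by simp
  finally show "t \<in> Poly_Mapping.keys ?y" using a by (simp add: in_keys_iff)
qed

lemma sum_single_lookup: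
  fixes x :: "'a \<Rightarrow>\<^sub>0 'k::comm_monoid_add"
  shows "(\<Sum>a\<in>Poly_Mapping.keys x. Poly_Mapping.single a (Poly_Mapping.lookup x a)) = x"
proof (rule poly_mapping_eqI)
  fix t
  show "Poly_Mapping.lookup (\<Sum>a\<in>Poly_Mapping.keys x. Poly_Mapping.single a (Poly_Mapping.lookup x a)) t
      = Poly_Mapping.lookup x t"
    by (simp add: lookup_sum lookup_single when_def in_keys_iff)
qed

lemma pm_scale_single: "pm_scale c (Poly_Mapping.single a d) = Poly_Mapping.single a (c * d)"
  unfolding pm_scale_def by (rule poly_mapping_eqI) (simp add: map.rep_eq lookup_single when_def)

lemma map_ptree_inv:
  assumes "inj_on h S" "leaves t \<subseteq> S"
  shows "map_ptree id (inv_into S h) (map_ptree id h t) = t"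
proof -
  have "map_ptree (id \<circ> id) (inv_into S h \<circ> h) t = map_ptree id id t"
    using assms by (intro ptree.map_cong) auto
  then show ?thesis by (simp add: ptree.map_comp ptree.map_id)
qed

section \<open>The presentation map and the order on monomials\<close>

locale presented_operad =
  fixes scale :: "'k::field \<Rightarrow> 'p::ab_group_add \<Rightarrow> 'p"
    and P :: "'p operad_data"
    and \<Upsilon> :: "'u set"
    and ar :: "'u \<Rightarrow> nat"
    and \<pi> :: "nat set \<Rightarrow> (('u, nat) ptree \<Rightarrow>\<^sub>0 'k) \<Rightarrow> 'p"
    and C :: "nat set \<Rightarrow> (('u, nat) ptree \<Rightarrow>\<^sub>0 'k) set"
    and ord :: "('u, nat) ptree rel"
  assumes operad: "shuffle_operad scale P"
    and presentation: "shuffle_presentation scale P \<Upsilon> ar \<pi> C"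
    and admissible: "admissible_order \<Upsilon> ar ord"
begin

sublocale operations \<Upsilon> ar
  using presentation by unfold_locales (simp add: shuffle_presentation_def)

sublocale P: operad_over scale "\<lambda>S h. strict_mono_on S h" shuffle_graftable P
  using operad by (simp add: shuffle_operad_def)

abbreviation keys :: "(('u, nat) ptree \<Rightarrow>\<^sub>0 'k) \<Rightarrow> ('u, nat) ptree set" where
  "keys \<equiv> Poly_Mapping.keys"

abbreviation lead :: "(('u, nat) ptree \<Rightarrow>\<^sub>0 'k) \<Rightarrow> ('u, nat) ptree" where
  "lead \<equiv> leading_monomial ord"

abbreviation mono :: "('u, nat) ptree \<Rightarrow> ('u, nat) ptree \<Rightarrow>\<^sub>0 'k" where
  "mono t \<equiv> Poly_Mapping.single t 1"

abbreviation F :: "(('u, nat) ptree \<Rightarrow>\<^sub>0 'k) operad_data" where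
  "F \<equiv> free_shuffle_operad \<Upsilon> ar"

lemma component_F: "component F S = {x. keys x \<subseteq> M S}"
  by (simp add: free_shuffle_operad_def)

lemma C_iff: "x \<in> C S \<longleftrightarrow> keys x \<subseteq> M S \<and> \<pi> S x = 0"
  using presentation by (simp add: shuffle_presentation_def component_F)

lemma hom: "shuffle_operad_hom pm_scale F scale P \<pi>"
  using presentation by (simp add: shuffle_presentation_def)

lemma pi_surj: "label_set S \<Longrightarrow> \<pi> S ` {x. keys x \<subseteq> M S} = component P S"
  using presentation by (simp add: shuffle_presentation_def component_F)

lemma pi_closed: "label_set S \<Longrightarrow> keys x \<subseteq> M S \<Longrightarrow> \<pi> S x \<in> component P S"
  using hom by (auto simp: shuffle_operad_hom_def component_F)

lemma pi_add: "label_set S \<Longrightarrow> keys x \<subseteq> M S \<Longrightarrow> keys y \<subseteq> M S \<Longrightarrow> \<pi> S (x + y) = \<pi> S x + \<pi> S y"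
  using hom by (auto simp: shuffle_operad_hom_def component_F)

lemma pi_scale: "label_set S \<Longrightarrow> keys x \<subseteq> M S \<Longrightarrow> \<pi> S (pm_scale k x) = scale k (\<pi> S x)"
  using hom by (auto simp: shuffle_operad_hom_def component_F)

lemma pi_relab: "label_set S \<Longrightarrow> keys x \<subseteq> M S \<Longrightarrow> strict_mono_on S h \<Longrightarrow>
    \<pi> (h ` S) (relab F S h x) = relab P S h (\<pi> S x)"
  using hom by (auto simp: shuffle_operad_hom_def component_F)

lemma pi_circ: "label_set S \<Longrightarrow> label_set T \<Longrightarrow> shuffle_graftable S s T \<Longrightarrow> keys x \<subseteq> M S \<Longrightarrow>
    keys y \<subseteq> M T \<Longrightarrow> \<pi> (S - {s} \<union> T) (circ F S s T x y) = circ P S s T (\<pi> S x) (\<pi> T y)"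
  using hom by (auto simp: shuffle_operad_hom_def component_F)

lemma pi_zero: "label_set S \<Longrightarrow> \<pi> S 0 = 0"
  using pi_add[of S 0 0] by simp

lemma pi_sum:
  assumes "label_set S" "finite A" "A \<subseteq> M S"
  shows "\<pi> S (\<Sum>a\<in>A. Poly_Mapping.single a (c a)) = (\<Sum>a\<in>A. scale (c a) (\<pi> S (mono a)))"
  using assms(2,3)
proof (induction A rule: finite_induct)
  case empty
  then show ?case by (simp add: pi_zero assms(1))
next
  case (insert a A)
  have k: "keys (\<Sum>a\<in>A. Poly_Mapping.single a (c a)) \<subseteq> M S"
    using insert by (intro order_trans[OF keys_sum]) (auto split: if_splits)
  have "\<pi> S (Poly_Mapping.single a (c a)) = scale (c a) (\<pi> S (mono a))"
    using pi_scale[of S "mono a" "c a"] assms(1) insert by (simp add: pm_scale_single)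
  moreover have "keys (Poly_Mapping.single a (c a)) \<subseteq> M S" using insert by auto
  ultimately show ?case using insert k by (simp add: pi_add assms(1))
qed

lemma pi_expand:
  assumes "label_set S" "keys x \<subseteq> M S"
  shows "\<pi> S x = (\<Sum>a\<in>keys x. scale (Poly_Mapping.lookup x a) (\<pi> S (mono a)))"
  using pi_sum[OF assms(1) finite_keys assms(2), of "Poly_Mapping.lookup x"]
  by (simp add: sum_single_lookup)

lemma well_order: "label_set S \<Longrightarrow> well_order_on (M S) (Restr ord (M S))"
  using admissible by (simp add: admissible_order_def)

lemma ord_refl: "label_set S \<Longrightarrow> a \<in> M S \<Longrightarrow> (a, a) \<in> ord"
  using well_order[of S]
  by (auto simp: well_order_on_def linear_order_on_def partial_order_on_def preorder_on_def refl_on_def)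

lemma ord_antisym: "label_set S \<Longrightarrow> a \<in> M S \<Longrightarrow> b \<in> M S \<Longrightarrow> (a, b) \<in> ord \<Longrightarrow> (b, a) \<in> ord \<Longrightarrow> a = b"
  using well_order[of S]
  by (auto simp: well_order_on_def linear_order_on_def partial_order_on_def antisym_def)

lemma ord_trans: "label_set S \<Longrightarrow> a \<in> M S \<Longrightarrow> b \<in> M S \<Longrightarrow> c \<in> M S \<Longrightarrow>
    (a, b) \<in> ord \<Longrightarrow> (b, c) \<in> ord \<Longrightarrow> (a, c) \<in> ord"
  using well_order[of S]
  unfolding well_order_on_def linear_order_on_def partial_order_on_def preorder_on_def
  by (blast dest: transD)

lemma ord_total: "label_set S \<Longrightarrow> a \<in> M S \<Longrightarrow> b \<in> M S \<Longrightarrow> (a, b) \<in> ord \<or> (b, a) \<in> ord"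
  using well_order[of S] ord_refl[of S a]
  by (cases "a = b") (auto simp: well_order_on_def linear_order_on_def total_on_def)

lemma wf_ord: "label_set S \<Longrightarrow> wf (Restr ord (M S) - Id)"
  using well_order by (simp add: well_order_on_def)

lemma lead_eqI:
  assumes "label_set S" "keys x \<subseteq> M S" "m \<in> keys x" "\<And>m'. m' \<in> keys x \<Longrightarrow> (m', m) \<in> ord"
  shows "lead x = m"
  unfolding leading_monomial_def
proof (rule the_equality)
  fix m1 assume "m1 \<in> keys x \<and> (\<forall>m'\<in>keys x. (m', m1) \<in> ord)"
  then show "m1 = m" using assms ord_antisym[OF assms(1), of m1 m] by blast
qed (use assms in auto)

lemma lead_greatest:
  assumes S: "label_set S" "keys x \<subseteq> M S" "x \<noteq> 0"
  shows "lead x \<in> keys x" "m' \<in> keys x \<Longrightarrow> (m', lead x) \<in> ord"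
proof -
  have ex: "\<exists>m\<in>A. \<forall>m'\<in>A. (m', m) \<in> ord" if "finite A" "A \<noteq> {}" "A \<subseteq> M S" for A
    using that
  proof (induction A rule: finite_ne_induct)
    case (singleton a)
    then show ?case using ord_refl[OF S(1)] by auto
  next
    case (insert a A)
    then obtain m where m: "m \<in> A" "\<forall>m'\<in>A. (m', m) \<in> ord" by auto
    show ?case
    proof (cases "(a, m) \<in> ord")
      case True
      with m show ?thesis by auto
    next
      case False
      then have am: "(m, a) \<in> ord" using ord_total[OF S(1), of a m] insert.prems m by auto
      have "(m', a) \<in> ord" if "m' \<in> insert a A" for m'
        using that ord_refl[OF S(1), of a] ord_trans[OF S(1), of m' m a] m am insert.prems by auto
      then show ?thesis by blast
    qed
  qed
  obtain m where m: "m \<in> keys x" "\<And>m'. m' \<in> keys x \<Longrightarrow> (m', m) \<in> ord"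
    using ex[of "keys x"] S by auto
  then have "lead x = m" using lead_eqI[OF S(1,2)] by blast
  with m show "lead x \<in> keys x" "m' \<in> keys x \<Longrightarrow> (m', lead x) \<in> ord" by auto
qed

section \<open>Leading monomials of the ideal\<close>

definition X :: "('u, nat) ptree set" where
  "X = {lead x | S x. label_set S \<and> x \<in> C S \<and> x \<noteq> 0}"

lemma X_E:
  assumes "m \<in> X"
  obtains S x where "label_set S" "x \<in> C S" "keys x \<subseteq> M S" "x \<noteq> 0" "lead x = m" "m \<in> keys x"
    "m \<in> M S" "leaves m = S" "\<And>m'. m' \<in> keys x \<Longrightarrow> (m', m) \<in> ord"
proof -
  obtain S x where x: "label_set S" "x \<in> C S" "x \<noteq> 0" "lead x = m" using assms by (auto simp: X_def)
  then have k: "keys x \<subseteq> M S" by (simp add: C_iff)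
  note lg = lead_greatest[OF x(1) k x(3)]
  then have "m \<in> M S" using k x by auto
  then show ?thesis using that[OF x(1,2) k x(3,4)] lg x(4) by (auto simp: shuffle_monomials_def)
qed

text \<open>The common core of the closure properties: an operation on monomials that respects the
  order and is injective sends leading monomials to leading monomials, since injectivity prevents
  cancellation.\<close>

lemma X_image:
  assumes x: "label_set S" "keys x \<subseteq> M S" "m \<in> keys x" "\<And>m'. m' \<in> keys x \<Longrightarrow> (m', m) \<in> ord"
    and S': "label_set S'" "inj_on \<phi> (M S)" "\<phi> ` M S \<subseteq> M S'"
    and ord: "\<And>a a'. a \<in> M S \<Longrightarrow> a' \<in> M S \<Longrightarrow> (a, a') \<in> ord \<Longrightarrow> (\<phi> a, \<phi> a') \<in> ord"
    and y: "y = (\<Sum>a\<in>keys x. Poly_Mapping.single (\<phi> a) (Poly_Mapping.lookup x a))" "\<pi> S' y = 0"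
  shows "\<phi> m \<in> X"
proof -
  have k: "keys y = \<phi> ` keys x"
    unfolding y(1) using S'(2) x(2) by (intro keys_sum_single) (auto intro: inj_on_subset)
  then have kM: "keys y \<subseteq> M S'" using x(2) S'(3) by auto
  have "lead y = \<phi> m"
  proof (rule lead_eqI[OF S'(1) kM])
    show "\<phi> m \<in> keys y" using k x(3) by simp
    fix m' assume "m' \<in> keys y"
    then obtain a where "a \<in> keys x" "m' = \<phi> a" using k by auto
    then show "(m', \<phi> m) \<in> ord" using ord[of a m] x(2-4) by blast
  qed
  moreover have "y \<in> C S'" using kM y(2) by (simp add: C_iff)
  moreover have "y \<noteq> 0" using k x(3) by auto
  ultimately show ?thesis
    unfolding X_def using S'(1) by (intro CollectI exI[of _ S'] exI[of _ y]) auto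
qed

lemma P_zero: "label_set S \<Longrightarrow> 0 \<in> component P S"
  using P.comp_subspace P.subspace_0 by blast

lemma X_map:
  assumes "m \<in> X" "strict_mono_on (leaves m) h"
  shows "map_ptree id h m \<in> X"
proof -
  obtain S x where x: "label_set S" "x \<in> C S" "keys x \<subseteq> M S" "m \<in> keys x" "leaves m = S"
    "\<And>m'. m' \<in> keys x \<Longrightarrow> (m', m) \<in> ord"
    using X_E[OF assms(1)] by metis
  have h: "strict_mono_on S h" using assms(2) x(5) by simp
  show ?thesis
  proof (rule X_image[OF x(1,3,4,6)])
    show "label_set (h ` S)" using x(1) by (simp add: label_set_def)
    show "inj_on (map_ptree id h) (M S)"
      using map_ptree_inv[OF strict_mono_on_imp_inj_on[OF h]]
      by (intro inj_on_inverseI[of _ "map_ptree id (inv_into S h)"]) (auto simp: shuffle_monomials_def)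
    show "map_ptree id h ` M S \<subseteq> M (h ` S)" using map_in_M h by blast
    show "(map_ptree id h a, map_ptree id h a') \<in> ord"
      if "a \<in> M S" "a' \<in> M S" "(a, a') \<in> ord" for a a'
      using admissible that x(1) h unfolding admissible_order_def by blast
    show "relab F S h x = (\<Sum>a\<in>keys x. Poly_Mapping.single (map_ptree id h a) (Poly_Mapping.lookup x a))"
      by (simp add: free_shuffle_operad_def)
    have "\<pi> (h ` S) (relab F S h x) = relab P S h 0"
      using pi_relab[OF x(1,3) h] x(2) by (simp add: C_iff)
    also have "\<dots> = 0"
      using P.relab_scale[OF x(1) h P_zero[OF x(1)], of 0] by simp
    finally show "\<pi> (h ` S) (relab F S h x) = 0" .
  qed
qed

lemma label_set_graft: "label_set S \<Longrightarrow> label_set T \<Longrightarrow> label_set (S - {s} \<union> T)"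
  by (auto simp: label_set_def)

lemma graftable_disjoint:
  assumes "shuffle_graftable S s T" "a \<in> M S" "b \<in> M T"
  shows "leaves a \<inter> leaves b \<subseteq> {s}" "s \<in> leaves a" "s \<in> leaves b"
  using assms by (auto simp: shuffle_graftable_def shuffle_monomials_def)

lemma X_graft_left:
  assumes "m \<in> X" "b \<in> M T" "label_set T" "shuffle_graftable (leaves m) s T"
  shows "graft m s b \<in> X"
proof -
  obtain S x where x: "label_set S" "x \<in> C S" "keys x \<subseteq> M S" "m \<in> keys x" "leaves m = S"
    "\<And>m'. m' \<in> keys x \<Longrightarrow> (m', m) \<in> ord"
    using X_E[OF assms(1)] by metis
  have g: "shuffle_graftable S s T" using assms(4) x(5) by simp
  have kb: "keys (mono b) \<subseteq> M T" using assms(2) by simp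
  show ?thesis
  proof (rule X_image[OF x(1,3,4,6), where \<phi> = "\<lambda>a. graft a s b"])
    show "label_set (S - {s} \<union> T)" using label_set_graft x(1) assms(3) .
    show "inj_on (\<lambda>a. graft a s b) (M S)"
    proof (rule inj_onI)
      fix a a' assume a: "a \<in> M S" "a' \<in> M S" "graft a s b = graft a' s b"
      show "a = a'"
        by (rule graft_left_inj[OF _ a(3)]) (use graftable_disjoint[OF g _ assms(2)] a in auto)
    qed
    show "(\<lambda>a. graft a s b) ` M S \<subseteq> M (S - {s} \<union> T)" using graft_in_M assms(2) g by blast
    show "(graft a s b, graft a' s b) \<in> ord" if "a \<in> M S" "a' \<in> M S" "(a, a') \<in> ord" for a a'
      using admissible that x(1) assms(2,3) g unfolding admissible_order_def by blast
    show "circ F S s T x (mono b)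
        = (\<Sum>a\<in>keys x. Poly_Mapping.single (graft a s b) (Poly_Mapping.lookup x a))"
      by (simp add: free_shuffle_operad_def)
    have "\<pi> (S - {s} \<union> T) (circ F S s T x (mono b)) = circ P S s T 0 (\<pi> T (mono b))"
      using pi_circ[OF x(1) assms(3) g x(3) kb] x(2) by (simp add: C_iff)
    also have "\<dots> = 0"
      using P.circ_scale_left[OF x(1) assms(3) g P_zero[OF x(1)] pi_closed[OF assms(3) kb], of 0] by simp
    finally show "\<pi> (S - {s} \<union> T) (circ F S s T x (mono b)) = 0" .
  qed
qed

lemma X_graft_right:
  assumes "m \<in> X" "a \<in> M S" "label_set S" "shuffle_graftable S s (leaves m)"
  shows "graft a s m \<in> X"
proof -
  obtain T x where x: "label_set T" "x \<in> C T" "keys x \<subseteq> M T" "m \<in> keys x" "leaves m = T"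
    "\<And>m'. m' \<in> keys x \<Longrightarrow> (m', m) \<in> ord"
    using X_E[OF assms(1)] by metis
  have g: "shuffle_graftable S s T" using assms(4) x(5) by simp
  have ka: "keys (mono a) \<subseteq> M S" using assms(2) by simp
  show ?thesis
  proof (rule X_image[OF x(1,3,4,6), where \<phi> = "\<lambda>b. graft a s b"])
    show "label_set (S - {s} \<union> T)" using label_set_graft x(1) assms(3) by blast
    show "inj_on (\<lambda>b. graft a s b) (M T)"
    proof (rule inj_onI)
      fix b b' assume b: "b \<in> M T" "b' \<in> M T" "graft a s b = graft a s b'"
      show "b = b'"
        by (rule graft_right_inj[OF _ b(3)]) (use graftable_disjoint[OF g assms(2)] b in auto)
    qed
    show "(\<lambda>b. graft a s b) ` M T \<subseteq> M (S - {s} \<union> T)" using graft_in_M assms(2) g by blast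
    show "(graft a s b, graft a s b') \<in> ord" if "b \<in> M T" "b' \<in> M T" "(b, b') \<in> ord" for b b'
      using admissible that x(1) assms(2,3) g unfolding admissible_order_def by blast
    show "circ F S s T (mono a) x
        = (\<Sum>b\<in>keys x. Poly_Mapping.single (graft a s b) (Poly_Mapping.lookup x b))"
      by (simp add: free_shuffle_operad_def)
    have "\<pi> (S - {s} \<union> T) (circ F S s T (mono a) x) = circ P S s T (\<pi> S (mono a)) 0"
      using pi_circ[OF assms(3) x(1) g ka x(3)] x(2) by (simp add: C_iff)
    also have "\<dots> = 0"
      using P.circ_scale_right[OF assms(3) x(1) g pi_closed[OF assms(3) ka] P_zero[OF x(1)], of 0] by simp
    finally show "\<pi> (S - {s} \<union> T) (circ F S s T (mono a) x) = 0" .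
  qed
qed

lemma M_leaves: "m \<in> X \<Longrightarrow> m \<in> M (leaves m)"
  by (metis X_E)

text \<open>The ideal is closed under partial compositions, so the truncation is undone one leaf at
  a time; \<tau> A is the substitution after the leaves in \<open>A\<close> have been
  filled.\<close>

lemma X_truncation:
  assumes "u \<in> X" "truncation t u" "shuffle_tree \<Upsilon> ar t" "distinct (leaf_list t)"
  shows "t \<in> X"
proof -
  obtain \<sigma> where t: "t = subst \<sigma> u"
    and \<sigma>: "\<And>l. l \<in> leaves u \<Longrightarrow> shuffle_tree \<Upsilon> ar (\<sigma> l) \<and> min_leaf (\<sigma> l) = l"
    using truncation_subst[OF assms(2-4)] by blast
  have du: "distinct (leaf_list u)" using M_leaves[OF assms(1)] by (simp add: shuffle_monomials_def)
  have dt: "distinct (concat (map (\<lambda>l. leaf_list (\<sigma> l)) (leaf_list u)))"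
    using assms(4) by (simp add: t leaf_list_subst)
  have d\<sigma>: "distinct (leaf_list (\<sigma> l))" if "l \<in> leaves u" for l
    using dt that by (auto simp: distinct_concat_iff simp flip: set_leaf_list)
  have disj: "leaves (\<sigma> k) \<inter> leaves (\<sigma> l) = {}" if "k \<in> leaves u" "l \<in> leaves u" "k \<noteq> l" for k l
    using distinct_concat_disjoint[OF dt du, of k l] that by (simp add: set_leaf_list)
  have self: "l \<in> leaves (\<sigma> l)" if "l \<in> leaves u" for l using min_leaf_in[of "\<sigma> l"] \<sigma>[OF that] by simp
  define \<tau> where "\<tau> A l = (if l \<in> A then \<sigma> l else Leaf l)" for A l
  have "subst (\<tau> A) u \<in> X" if "finite A" "A \<subseteq> leaves u" for A
    using that
  proof (induction A rule: finite_induct)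
    case empty
    then show ?case using assms(1) by (simp add: \<tau>_def subst_Leaf)
  next
    case (insert l A)
    then have l: "l \<in> leaves u" "l \<notin> A" and A: "A \<subseteq> leaves u" by auto
    have "graft (subst (\<tau> A) u) l (\<sigma> l) = subst (\<tau> (insert l A)) u"
      unfolding graft_eq_subst subst_subst unfolding graft_eq_subst[symmetric]
    proof (rule subst_cong)
      fix k assume k: "k \<in> leaves u"
      show "graft (\<tau> A k) l (\<sigma> l) = \<tau> (insert l A) k"
      proof (cases "k \<in> A")
        case True
        \<comment> \<open>The subtrees filled in earlier do not contain the label \<open>l\<close>,
          so grafting at \<open>l\<close> leaves them alone.\<close>
        then have "l \<notin> leaves (\<sigma> k)" using self[OF l(1)] disj[OF k l(1)] l(2) by auto
        then show ?thesis using True by (simp add: \<tau>_def graft_ident)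
      qed (auto simp: \<tau>_def)
    qed
    moreover have "graft (subst (\<tau> A) u) l (\<sigma> l) \<in> X"
    proof (rule X_graft_left[OF insert.IH[OF A]])
      show "\<sigma> l \<in> M (leaves (\<sigma> l))" using \<sigma> d\<sigma> l by (simp add: shuffle_monomials_def)
      show "label_set (leaves (\<sigma> l))" using \<sigma> l label_set_leaves by blast
      have "x = l" if "x \<in> leaves (\<tau> A k)" "k \<in> leaves u" "x \<in> leaves (\<sigma> l)" for x k
      proof (cases "k \<in> A")
        case True
        then show ?thesis using that disj[of k l] l by (auto simp: \<tau>_def)
      next
        case False
        then have "x = k" using that by (simp add: \<tau>_def)
        then show ?thesis using self[OF that(2)] disj[OF that(2) l(1)] that(3) by auto
      qed
      moreover have "l \<in> leaves (\<tau> A l)" using l by (simp add: \<tau>_def)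
      ultimately have "leaves (subst (\<tau> A) u) \<inter> leaves (\<sigma> l) = {l}"
        using self[OF l(1)] l(1) by (auto simp: leaves_subst)
      then show "shuffle_graftable (leaves (subst (\<tau> A) u)) l (leaves (\<sigma> l))"
        using \<sigma>[OF l(1)] by (simp add: shuffle_graftable_def min_leaf_def)
    qed
    ultimately show ?case by simp
  qed
  from this[of "leaves u"] have "subst (\<tau> (leaves u)) u \<in> X" by simp
  moreover have "subst (\<tau> (leaves u)) u = t"
    unfolding t by (rule subst_cong) (simp add: \<tau>_def)
  ultimately show ?thesis by simp
qed

text \<open>The child \<open>v\<close> is replaced by a leaf carrying its minimum, which gives a
  shuffle monomial into which \<open>v\<close> can be grafted back.\<close>

lemma X_subterm:
  "subterm t v \<Longrightarrow> t \<in> X \<Longrightarrow> shuffle_tree \<Upsilon> ar v \<Longrightarrow> distinct (leaf_list v) \<Longrightarrow> v \<in> X"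
proof (induction rule: subterm.induct)
  case (2 t v ts u)
  obtain ls rs where ts: "ts = ls @ v # rs" using 2(2) by (meson split_list)
  have v: "shuffle_tree \<Upsilon> ar v" "distinct (leaf_list v)" using 2(5,6) ts by auto
  then have vX: "v \<in> X" using 2 by blast
  define m where "m = min_leaf v"
  have m: "m \<in> leaves v" using min_leaf_in v by (simp add: m_def)
  define a where "a = Node u (ls @ Leaf m # rs)"
  have disj: "leaves v \<inter> leaves x = {}" if "x \<in> set ls \<union> set rs" for x
    using 2(6) that unfolding ts by (auto simp: set_leaf_list)
  have ml: "min_leaf (Leaf m :: ('u, nat) ptree) = min_leaf v"
    by (simp add: min_leaf_def[of "Leaf m"]) (simp add: m_def)
  have "shuffle_tree \<Upsilon> ar a" using 2(5) ml by (simp add: ts a_def)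
  moreover have "distinct (leaf_list a)"
    using 2(6) m by (auto simp: ts a_def set_leaf_list)
  ultimately have a: "a \<in> M (leaves a)" "label_set (leaves a)"
    using label_set_leaves by (auto simp: shuffle_monomials_def)
  have "leaves a \<inter> leaves v = {m}" using disj m by (auto simp: a_def)
  then have "graft a m v \<in> X"
    using vX a by (intro X_graft_right[of v a "leaves a"]) (auto simp: shuffle_graftable_def m_def min_leaf_def)
  moreover have "graft x m v = x" if "x \<in> set ls \<union> set rs" for x
    using disj[OF that] m by (intro graft_ident) auto
  then have "graft a m v = Node u ts" by (auto simp: a_def ts intro: map_idI)
  ultimately show ?case by simp
qed

text \<open>The three ingredients of \<open>divides\<close> are undone in reverse order: the
  relabeling, the truncation and the passage to a subterm.\<close>

lemma X_divides:
  assumes "w \<in> X" "divides w v" "v \<in> M S"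
  shows "v \<in> X"
proof -
  obtain t u h where *: "subterm t v" "truncation t u" "strict_mono_on (leaves u) h" "map_ptree id h u = w"
    using assms(2) by (auto simp: divides_def)
  have v: "shuffle_tree \<Upsilon> ar v" "distinct (leaf_list v)" using assms(3) by (auto simp: shuffle_monomials_def)
  note t = subterm_shuffle_tree[OF *(1) v]
  have lw: "leaves w = h ` leaves u" using *(4) by (auto simp: ptree.set_map)
  have inj: "inj_on h (leaves u)" using *(3) by (rule strict_mono_on_imp_inj_on)
  define g where "g = inv_into (leaves u) h"
  have "strict_mono_on (leaves w) g"
  proof (rule strict_mono_onI)
    fix x y assume "x \<in> leaves w" "y \<in> leaves w" "x < y"
    then obtain x' y' where x': "x = h x'" "y = h y'" "x' \<in> leaves u" "y' \<in> leaves u" "h x' < h y'"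
      by (auto simp: lw)
    have "x' < y'"
      using x' *(3) by (metis linorder_neqE_nat order_less_asym strict_mono_onD less_irrefl)
    then show "g x < g y" using x' inj by (simp add: g_def)
  qed
  then have "map_ptree id g w \<in> X" using X_map assms(1) by blast
  moreover have "map_ptree id g w = u"
    using map_ptree_inv[OF inj, of u] *(4) by (simp add: g_def)
  ultimately have "t \<in> X" using X_truncation *(2) t by blast
  then show ?thesis using X_subterm *(1) v by blast
qed

section \<open>Normal monomials as a basis of the quotient\<close>

text \<open>A nontrivial relation would be a nonzero element of the ideal all of whose monomials lie
  outside \<open>X\<close>, whereas its leading monomial lies in \<open>X\<close>.\<close>

lemma pi_relation_zero:
  assumes "label_set S" "finite A" "A \<subseteq> M S - X"
    and "(\<Sum>a\<in>A. scale (c a) (\<pi> S (mono a))) = 0" "a \<in> A"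
  shows "c a = 0"
proof (rule ccontr)
  assume "c a \<noteq> 0"
  define x where "x = (\<Sum>a\<in>A. Poly_Mapping.single a (c a))"
  have lk: "Poly_Mapping.lookup x t = (if t \<in> A then c t else 0)" for t
    using assms(2) by (simp add: x_def lookup_sum lookup_single when_def)
  have k: "keys x \<subseteq> A" by (auto simp: in_keys_iff lk split: if_splits)
  have "x \<noteq> 0" using lk[of a] \<open>c a \<noteq> 0\<close> assms(5) by auto
  moreover have "x \<in> C S"
    using k assms pi_sum[OF assms(1,2), of c] by (auto simp: C_iff x_def[symmetric])
  ultimately have "lead x \<in> X" using assms(1) by (auto simp: X_def)
  moreover have "lead x \<in> keys x" using lead_greatest(1)[OF assms(1) _ \<open>x \<noteq> 0\<close>] k assms(3) by blast
  ultimately show False using k assms(3) by blast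
qed

lemma pi_inj: assumes "label_set S" shows "inj_on (\<lambda>m. \<pi> S (mono m)) (M S - X)"
proof (rule inj_onI, rule ccontr)
  fix a b assume ab: "a \<in> M S - X" "b \<in> M S - X" "\<pi> S (mono a) = \<pi> S (mono b)" "a \<noteq> b"
  have "(\<Sum>t\<in>{a, b}. scale (if t = a then 1 else - 1) (\<pi> S (mono t))) = 0"
    using ab by simp
  from pi_relation_zero[OF assms _ _ this, of a] ab show False by auto
qed

lemma pi_independent:
  assumes "label_set S"
  shows "P.independent ((\<lambda>m. \<pi> S (mono m)) ` (M S - X))"
  unfolding P.independent_explicit_module
proof (intro allI impI)
  fix T u v
  assume T: "finite T" "T \<subseteq> (\<lambda>m. \<pi> S (mono m)) ` (M S - X)"
    and s: "(\<Sum>v\<in>T. scale (u v) v) = 0" and v: "v \<in> T"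
  obtain A where A: "A \<subseteq> M S - X" "finite A" "T = (\<lambda>m. \<pi> S (mono m)) ` A"
    using finite_subset_image[OF T] by blast
  have "inj_on (\<lambda>m. \<pi> S (mono m)) A" using pi_inj[OF assms] A(1) by (rule inj_on_subset)
  then have "(\<Sum>a\<in>A. scale (u (\<pi> S (mono a))) (\<pi> S (mono a))) = 0"
    using s unfolding A(3) by (simp add: sum.reindex)
  with pi_relation_zero[OF assms A(2,1) this] v A(3) show "u v = 0" by auto
qed

text \<open>Modulo the ideal, a leading monomial is a combination of smaller monomials on the same
  labels; the well-order makes this reduction terminate.\<close>

lemma pi_mono_in_span:
  assumes S: "label_set S"
  shows "m \<in> M S \<Longrightarrow> \<pi> S (mono m) \<in> P.span ((\<lambda>m. \<pi> S (mono m)) ` (M S - X))"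
proof (induction m rule: wf_induct_rule[OF wf_ord[OF S]])
  case (1 m)
  show ?case
  proof (cases "m \<in> X")
    case False
    then show ?thesis using "1.prems" by (intro P.span_base) auto
  next
    case True
    then obtain S' x where x: "x \<in> C S'" "keys x \<subseteq> M S'" "m \<in> keys x" "leaves m = S'"
      "\<And>m'. m' \<in> keys x \<Longrightarrow> (m', m) \<in> ord"
      using X_E by metis
    have S': "S' = S" using x(4) "1.prems" by (auto simp: shuffle_monomials_def)
    define c where "c = Poly_Mapping.lookup x m"
    have c: "c \<noteq> 0" using x(3) by (simp add: c_def in_keys_iff)
    define r where "r = (\<Sum>a\<in>keys x - {m}. scale (Poly_Mapping.lookup x a) (\<pi> S (mono a)))"
    have "0 = \<pi> S x" using x(1) S' by (simp add: C_iff)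
    also have "\<dots> = scale c (\<pi> S (mono m)) + r"
      unfolding r_def c_def using pi_expand[OF S, of x] x(2,3) S' by (simp add: sum.remove)
    finally have "scale c (\<pi> S (mono m)) = - r" by (simp add: eq_neg_iff_add_eq_0)
    then have "scale (1 / c) (scale c (\<pi> S (mono m))) = scale (1 / c) (- r)" by simp
    then have "\<pi> S (mono m) = scale (1 / c) (- r)" using c by simp
    moreover have "\<pi> S (mono a) \<in> P.span ((\<lambda>m. \<pi> S (mono m)) ` (M S - X))" if "a \<in> keys x - {m}" for a
      using that x(2,5) S' "1.prems" by (intro "1.IH") auto
    then have "r \<in> P.span ((\<lambda>m. \<pi> S (mono m)) ` (M S - X))"
      unfolding r_def by (intro P.span_sum P.span_scale)
    ultimately show ?thesis by (auto intro: P.span_scale P.span_neg)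
  qed
qed

text \<open>Unary operations can give infinitely many monomials on one label set. The finite
  dimension makes the normal ones finite in number, so that the cardinality is a genuine
  count.\<close>

theorem dim_component:
  assumes "label_set S" "finite_dim scale (component P S)"
  shows "finite (M S - X)" "P.dim (component P S) = card (M S - X)"
proof -
  let ?B = "(\<lambda>m. \<pi> S (mono m)) ` (M S - X)"
  have B: "?B \<subseteq> component P S" using pi_closed[OF assms(1)] by auto
  have "component P S \<subseteq> P.span ?B"
  proof
    fix y assume "y \<in> component P S"
    then obtain x where x: "keys x \<subseteq> M S" "y = \<pi> S x" using pi_surj[OF assms(1)] by blast
    show "y \<in> P.span ?B"
      unfolding x(2) pi_expand[OF assms(1) x(1)]
      using x(1) pi_mono_in_span[OF assms(1)] by (intro P.span_sum P.span_scale) auto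
  qed
  then have "P.span ?B = P.span (component P S)"
    by (metis B P.span_mono P.span_span subset_antisym)
  then show "P.dim (component P S) = card (M S - X)"
    using P.dim_eq_card[OF _ pi_independent[OF assms(1)]] card_image[OF pi_inj[OF assms(1)]] by simp
  obtain D where D: "finite D" "component P S \<subseteq> P.span D"
    using assms(2) by (auto simp: finite_dim_def)
  then have "finite ?B" using P.independent_span_bound[OF D(1) pi_independent[OF assms(1)]] B by blast
  then show "finite (M S - X)" using pi_inj[OF assms(1)] finite_imageD by blast
qed

end

section \<open>From avoiding trees to the dimensions of the operad\<close>

theorem corollary3p4p1:
  fixes scale :: "'k::field_char_0 \<Rightarrow> 'p::ab_group_add \<Rightarrow> 'p"
    and P :: "'p operad_data"
    and \<Upsilon> :: "'u set"
    and ar :: "'u \<Rightarrow> nat"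
    and \<pi> :: "nat set \<Rightarrow> (('u, nat) ptree \<Rightarrow>\<^sub>0 'k) \<Rightarrow> 'p"
    and C :: "nat set \<Rightarrow> (('u, nat) ptree \<Rightarrow>\<^sub>0 'k) set"
  assumes operad:
      "(symmetric_operad scale P \<and> symmetric_presentation scale P \<Upsilon> ar \<pi> C) \<or>
       (shuffle_operad scale P \<and> shuffle_presentation scale P \<Upsilon> ar \<pi> C)"
    and finitely_generated: "finite \<Upsilon>"
    and groebner: "has_finite_shuffle_regular_groebner_basis \<Upsilon> ar C"
    and finite_dims: "\<And>n. n \<ge> 1 \<Longrightarrow> finite_dim scale (component P {1..n})"
    and growth: "subfactorial_growth (\<lambda>n. real (operad_dim scale P n))"
  shows "satisfies_linear_ode_const_coeffs (egf (operad_dim scale P)) \<and>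
         rational_fps (ogf (operad_dim scale P)) \<and>
         (exponential_growth (operad_dim scale P) \<or> polynomial_growth (operad_dim scale P))"
proof -
  have op: "shuffle_operad scale P" and pres: "shuffle_presentation scale P \<Upsilon> ar \<pi> C"
    using operad symmetric_operad_imp_shuffle_operad by (auto simp: symmetric_presentation_def)
  obtain ord G where ord: "admissible_order \<Upsilon> ar ord" and G: "reduced_groebner_basis ord C G" "finite G"
    and reg: "shuffle_regular \<Upsilon> ar (leading_monomial ord ` G)"
    using groebner by (auto simp: has_finite_shuffle_regular_groebner_basis_def)
  interpret presented_operad scale P \<Upsilon> ar \<pi> C ord
    by unfold_locales (fact op pres ord)+
  define B where "B = leading_monomial ord ` G"
  define A where "A = avoiders \<Upsilon> ar (skeleton ` B)"
  define total where "total n = (\<Sum>t | t \<in> A \<and> arity t = n. labelings t)" for n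
  have ls: "label_set {1..n}" if "n \<ge> 1" for n :: nat using that by (simp add: label_set_def)
  have GC: "\<exists>n\<ge>1. g \<in> C {1..n}" "g \<noteq> 0" if "g \<in> G" for g
    using G that by (auto simp: reduced_groebner_basis_def groebner_basis_def)
  have BX: "B \<subseteq> X" using GC ls by (fastforce simp: B_def X_def)
  have BM: "B \<subseteq> (\<Union>n\<in>{1..}. M {1..n})"
  proof
    fix m assume "m \<in> B"
    then obtain g where "g \<in> G" "m = lead g" by (auto simp: B_def)
    then obtain n where g: "m = lead g" "g \<noteq> 0" "n \<ge> 1" "g \<in> C {1..n}"
      using GC[of g] by blast
    then have "m \<in> M {1..n}" using lead_greatest(1)[OF ls] by (auto simp: C_iff)
    then show "m \<in> (\<Union>n\<in>{1..}. M {1..n})" using g(3) by auto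
  qed
  \<comment> \<open>The Groebner property shows that every leading monomial is divisible by one in
    \<open>B\<close>; the converse is the closure of \<open>X\<close> under multiples.\<close>
  have normal: "M {1..n} - X = {v \<in> M {1..n}. skeleton v \<in> A}" if n: "n \<ge> 1" for n
  proof -
    have "v \<in> X \<longleftrightarrow> skeleton v \<notin> A" if v: "v \<in> M {1..n}" for v
    proof -
      have "(\<exists>m\<in>B. divides m v) \<longleftrightarrow> skeleton v \<notin> A"
        unfolding A_def using divisible_iff_not_avoider[OF reg[folded B_def] BM v] .
      moreover have "\<exists>m\<in>B. divides m v" if vX: "v \<in> X"
      proof -
        obtain S x where x: "x \<in> C S" "x \<noteq> 0" "lead x = v" "leaves v = S" using X_E[OF vX] by metis
        \<comment> \<open>The set \<open>X\<close> ranges over all label sets, the Groebner property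
          only over initial segments; the leaves of \<open>v\<close> determine which label set is
          meant.\<close>
        moreover have "S = {1..n}" using x(4) v by (simp add: shuffle_monomials_def)
        ultimately have "\<exists>g\<in>G. g \<noteq> 0 \<and> divides (lead g) (lead x)"
          using G(1) n by (auto simp: reduced_groebner_basis_def groebner_basis_def)
        then show ?thesis using x(3) by (auto simp: B_def)
      qed
      moreover have "v \<in> X" if "m \<in> B" "divides m v" for m
        using X_divides[OF _ that(2) v] BX that(1) by blast
      ultimately show ?thesis by blast
    qed
    then show ?thesis by auto
  qed
  have wfA: "wf_skeleton \<Upsilon> ar s" if "s \<in> A" for s using that by (simp add: A_def avoiders_def)
  have finA: "finite {t \<in> A. arity t = n}" and dim: "n \<ge> 1 \<Longrightarrow> operad_dim scale P n = total n" for n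
  proof -
    have lab: "finite (labeled s {1..n}) \<and> card (labeled s {1..n}) = labelings s"
      if "s \<in> A" "arity s = n" for s
      using card_labeled[OF wfA[OF that(1)], of "{1..n}"] that by simp
    have N: "{v \<in> M {1..n}. skeleton v \<in> A} = (\<Union>s\<in>{t \<in> A. arity t = n}. labeled s {1..n})"
    proof -
      have "arity (skeleton v) = n" if "v \<in> M {1..n}" for v
        using card_leaves[of v] that by (simp add: shuffle_monomials_def)
      then show ?thesis by (auto simp: labeled_def)
    qed
    show fin: "finite {t \<in> A. arity t = n}"
    proof (cases "n \<ge> 1")
      case True
      then have "finite {v \<in> M {1..n}. skeleton v \<in> A}"
        using dim_component(1)[OF ls finite_dims] normal by simp
      \<comment> \<open>Each avoiding skeleton carries at least one labeling, so finitely many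
        normal monomials leave room for finitely many skeletons only.\<close>
      moreover have "{t \<in> A. arity t = n} \<subseteq> skeleton ` {v \<in> M {1..n}. skeleton v \<in> A}"
      proof
        fix s assume s: "s \<in> {t \<in> A. arity t = n}"
        then have "labeled s {1..n} \<noteq> {}"
          using lab[of s] labelings_pos[of s] by auto
        then obtain v where "v \<in> labeled s {1..n}" by blast
        with s show "s \<in> skeleton ` {v \<in> M {1..n}. skeleton v \<in> A}"
          by (auto simp: labeled_def)
      qed
      ultimately show ?thesis by (rule finite_surj)
    next
      case False
      then have "{t \<in> A. arity t = n} = {}" using wfA wf_skeleton_arity_pos by force
      then show ?thesis by (simp only: finite.emptyI)
    qed
    assume n: "n \<ge> 1"
    have "operad_dim scale P n = card {v \<in> M {1..n}. skeleton v \<in> A}"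
      unfolding operad_dim_def using dim_component(2)[OF ls finite_dims] normal n by simp
    also have "\<dots> = (\<Sum>s\<in>{t \<in> A. arity t = n}. card (labeled s {1..n}))"
      unfolding N by (rule card_UN_disjoint[OF fin]) (use lab in \<open>auto simp: labeled_def\<close>)
    also have "\<dots> = total n" unfolding total_def by (rule sum.cong) (use lab in auto)
    finally show "operad_dim scale P n = total n" .
  qed
  \<comment> \<open>At n = 0, \<open>operad_dim\<close> refers to the component of the empty label
    set, about which the axioms say nothing. Growth is an eventual property and ignores it, and
    \<open>e\<close> below is 0 there by definition.\<close>
  have ev: "\<forall>\<^sub>F n in sequentially. total n = operad_dim scale P n"
    using eventually_ge_at_top[of 1] by eventually_elim (simp add: dim)
  interpret T: tree_class \<Upsilon> ar A "matched_subpatterns (skeleton ` B)"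
  proof
    show "finite (matched_subpatterns (skeleton ` B) ` A)"
      using G(2) by (intro finite_matched_subpatterns_range) (simp add: B_def)
    show "u \<in> \<Upsilon> \<and> length ts = ar u \<and> set ts \<subseteq> A" if "Node u ts \<in> A" for u ts
      using that by (simp add: A_def avoiders_Node)
    show "Node u ts' \<in> A \<and> matched_subpatterns (skeleton ` B) (Node u ts')
        = matched_subpatterns (skeleton ` B) (Node u ts)"
      if "Node u ts \<in> A" "set ts' \<subseteq> A"
        "map (matched_subpatterns (skeleton ` B)) ts' = map (matched_subpatterns (skeleton ` B)) ts" for u ts ts'
      using that(1,2) matched_subpatterns_cong[OF that(3), of u] map_eq_imp_length_eq[OF that(3)]
      by (simp add: A_def avoiders_Node)
    show "subfactorial_growth (\<lambda>n. real (\<Sum>t | t \<in> A \<and> arity t = n. labelings t))"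
      unfolding total_def[symmetric] subfactorial_growth_def
    proof (intro allI impI)
      fix a b :: real assume "a > 0" "b > 0"
      then obtain c where "c > 0"
        "\<forall>\<^sub>F n in sequentially. real (operad_dim scale P n) < c * (real n / a) powr (real n / b)"
        using growth by (auto simp: subfactorial_growth_def)
      moreover from this(2) ev
      have "\<forall>\<^sub>F n in sequentially. real (total n) < c * (real n / a) powr (real n / b)"
        by eventually_elim simp
      ultimately show "\<exists>c>0. \<forall>\<^sub>F n in sequentially. real (total n) < c * (real n / a) powr (real n / b)"
        by blast
    qed
  qed (use finitely_generated ar_ge_1 finA in auto)
  define e :: "nat \<Rightarrow> rat" where "e n = (if n = 0 then 0 else of_nat (operad_dim scale P n))" for n
  have "total 0 = 0"
  proof -
    have "{t \<in> A. arity t = 0} = {}" using wfA wf_skeleton_arity_pos by force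
    then show ?thesis unfolding total_def by (simp only: sum.empty)
  qed
  then have e: "e n = of_nat (total n)" for n using dim[of n] by (cases "n = 0") (auto simp: e_def)
  have egf: "egf (operad_dim scale P) = Abs_fps (\<lambda>n. e n / fact n)"
    by (rule fps_ext) (simp add: egf_def e_def)
  have ode: "satisfies_linear_ode_const_coeffs (egf (operad_dim scale P))"
    unfolding egf e total_def by (rule deriv_finite_imp_linear_ode[OF T.deriv_finite_total])
  obtain p where p: "p \<noteq> 0" "\<And>n. (\<Sum>i\<le>degree p. coeff p i * e (n + i)) = 0"
    using linear_ode_imp_recurrence[OF ode[unfolded egf]] by blast
  have "rational_fps (ogf (operad_dim scale P))"
    using recurrence_imp_rational[of p e, OF p] by (simp add: ogf_def e_def[abs_def])
  moreover have "exponential_growth (operad_dim scale P) \<or> polynomial_growth (operad_dim scale P)"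
    by (rule linear_recurrence_growth[OF p]) (simp add: e_def)
  ultimately show ?thesis using ode by blast
qed

end
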